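(* Let $G\subset\mathbb{C}$ be a Jordan domain bounded by a rectifiable curve $L$ of length $l$, let $\zeta\in G$, and let $\phi$ be the conformal mapping of $G$ onto a disk $D_R=\{w:|w|<R\}$ with $\phi(\zeta)=0$, $\phi'(\zeta)=1$. Let $p\in\mathbb{N}$ and, for $n\in\mathbb{N}$, let $\tilde Q_{n,p}$ be a polynomial of degree at most $n$ with $\tilde Q_{n,p}(\zeta)=1$ such that $$\left\|(\phi')^{1/p}-\tilde Q_{n,p}\right\|_p=\inf\left\{\left\|(\phi')^{1/p}-P_n\right\|_p: P_n(\zeta)=1\right\},$$ where the infimum is over polynomials $P_n$ of degree at most $n$, and let $$\tilde J_{n,p}(z)=\int_\zeta^z(\tilde Q_{n,p}(t))^p\,dt .$$ Then $$\left\|\phi-\tilde J_{n,p}\right\|_{\infty}\le\frac12\left(3(2\pi R)^{1/p}+l^{1/p}\right)^{p-1}\left\|(\phi')^{1/p}-\tilde Q_{n,p}\right\|_p .$$ Hence $\|\phi-\tilde J_{n,p}\|_\infty\to0$ as $n\to\infty$ when $G$ is a Smirnov domain.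
   Context: For $0<p<\infty$, $E_p(G)$ denotes the Smirnov space of analytic functions $f$ in $G$ (equivalently, those with $(f\circ\psi)(\psi')^{1/p}$ in the Hardy space $H^p(D_R)$, where $\psi=\phi^{-1}$), normed (quasi-normed if $p<1$) by their boundary values: $\|f\|_p=\left(\int_L|f(z)|^p|dz|\right)^{1/p}$. The radius $R$ is determined by $G$ and $\zeta$ through the normalization of $\phi$. $(\phi')^{1/p}$ is the analytic branch in $G$ equal to $1$ at $\zeta$; it belongs to $E_p(G)$. $\|\cdot\|_\infty$ is the supremum norm on $\overline G$ ($\phi$ being extended continuously to $\overline G$). $G$ is called a Smirnov domain if polynomials are dense in norm in $E_p(G)$; this is equivalent to $\log|\psi'|$ being representable in $D_R$ by the Poisson integral of its boundary values, and so does not depend on $p$. *)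

theory Defs
  imports "HOL-Complex_Analysis.Complex_Analysis"
begin

definition inscribed_lengths :: "(real \<Rightarrow> complex) \<Rightarrow> real \<Rightarrow> real \<Rightarrow> real set" where
  "inscribed_lengths \<gamma> a b =
     {(\<Sum>i<n. dist (\<gamma> (t i)) (\<gamma> (t (Suc i)))) | (n :: nat) t. mono t \<and> range t \<subseteq> {a..b}}"

definition rectifiable_curve :: "(real \<Rightarrow> complex) \<Rightarrow> bool" where
  "rectifiable_curve \<gamma> \<longleftrightarrow> bdd_above (inscribed_lengths \<gamma> 0 1)"

definition curve_length :: "(real \<Rightarrow> complex) \<Rightarrow> real \<Rightarrow> real \<Rightarrow> real" where
  "curve_length \<gamma> a b = Sup (inscribed_lengths \<gamma> a b)"

definition jordan_domain_bounded_by :: "complex set \<Rightarrow> (real \<Rightarrow> complex) \<Rightarrow> bool" where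
  "jordan_domain_bounded_by G \<gamma> \<longleftrightarrow>
     simple_path \<gamma> \<and> pathfinish \<gamma> = pathstart \<gamma> \<and> G = inside (path_image \<gamma>)"

text \<open>The measure |dz|, transported to the parameter interval: the Lebesgue-Stieltjes measure of
  the arc length function, which is extended by constants outside [0,1] so that no mass lies there.
  It is completed because a boundary function is only determined almost everywhere.\<close>

definition arc_measure :: "(real \<Rightarrow> complex) \<Rightarrow> real measure" where
  "arc_measure \<gamma> = completion (interval_measure (\<lambda>t. curve_length \<gamma> 0 (max 0 (min 1 t))))"

text \<open>Nontangential approach to a boundary point, in the form that does not presuppose a tangent.
  The boundary value is arbitrary at points where there is no unique nontangential limit; for
  functions in a Smirnov space these points form a null set.\<close>

definition approach_region :: "complex set \<Rightarrow> real \<Rightarrow> complex \<Rightarrow> complex set" where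
  "approach_region G \<alpha> z = {w \<in> G. dist w z < (1 + \<alpha>) * infdist w (frontier G)}"

definition boundary_value :: "complex set \<Rightarrow> (complex \<Rightarrow> complex) \<Rightarrow> complex \<Rightarrow> complex" where
  "boundary_value G f z =
     (THE c. \<forall>\<alpha>>0. (f \<longlongrightarrow> c) (at z within approach_region G \<alpha> z))"

definition smirnov_norm :: "real \<Rightarrow> complex set \<Rightarrow> (real \<Rightarrow> complex) \<Rightarrow> (complex \<Rightarrow> complex) \<Rightarrow> real" where
  "smirnov_norm p G \<gamma> f =
     (LINT t|arc_measure \<gamma>. cmod (boundary_value G f (\<gamma> t)) powr p) powr (1 / p)"

definition hardy_space :: "real \<Rightarrow> real \<Rightarrow> (complex \<Rightarrow> complex) set" where
  "hardy_space p R =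
     {g. g holomorphic_on ball 0 R \<and>
         bdd_above ((\<lambda>r. integral {0..2 * pi} (\<lambda>\<theta>. cmod (g (of_real r * cis \<theta>)) powr p)) ` {0<..<R})}"

text \<open>The functions f with (f o \<psi>) (\<psi>')^(1/p) in the Hardy space, for a conformal map \<psi> of a disk
  about 0 onto G; the choice of \<psi> is immaterial. Here k is a branch of log \<psi>', so
  exp (k / p) is the branch of (\<psi>')^(1/p).\<close>

definition smirnov_space :: "real \<Rightarrow> complex set \<Rightarrow> (complex \<Rightarrow> complex) set" where
  "smirnov_space p G =
     {f. f holomorphic_on G \<and>
         (\<exists>R \<psi> k. R > 0 \<and> \<psi> holomorphic_on ball 0 R \<and> bij_betw \<psi> (ball 0 R) G \<and>
            k holomorphic_on ball 0 R \<and> (\<forall>w\<in>ball 0 R. exp (k w) = deriv \<psi> w) \<and>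
            (\<lambda>w. f (\<psi> w) * exp (k w / of_real p)) \<in> hardy_space p R)}"

text \<open>Whether G is a Smirnov domain does not depend on the exponent p > 0, which the definition
  by density of the polynomials in E_p(G) nevertheless mentions.\<close>

definition smirnov_domain :: "real \<Rightarrow> complex set \<Rightarrow> (real \<Rightarrow> complex) \<Rightarrow> bool" where
  "smirnov_domain p G \<gamma> \<longleftrightarrow>
     (\<forall>f\<in>smirnov_space p G. \<forall>\<epsilon>>0. \<exists>P :: complex poly. smirnov_norm p G \<gamma> (\<lambda>z. f z - poly P z) < \<epsilon>)"

definition sup_norm_on :: "complex set \<Rightarrow> (complex \<Rightarrow> complex) \<Rightarrow> real" where
  "sup_norm_on A f = (SUP z\<in>A. cmod (f z))"

text \<open>The integral from \<zeta> to z is path independent because the integrand is a polynomial, so the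
  segment may be used even where it leaves G.\<close>

definition J_poly :: "nat \<Rightarrow> complex \<Rightarrow> complex poly \<Rightarrow> complex \<Rightarrow> complex" where
  "J_poly p \<zeta> Q z = contour_integral (linepath \<zeta> z) (\<lambda>t. poly Q t ^ p)"

end

(*
  Let Psi parametrize the closure of G by the closed unit disk, with Psi = phi^-1 up to scaling and
  rotation; phi is injective on the closure because its fibres over the circle are connected, and a
  nonconstant holomorphic function cannot collapse an arc of L. Since Psi' has no zeros,
  Psi' = q^2 with q in H^2, so the circle restrictions of Psi' converge in L^1. Hence Psi is
  absolutely continuous on the circle with a density that is nonzero a.e., arc length on L is the
  image of its modulus, and at almost every boundary point Psi has an unrestricted derivative. There
  approach regions of G correspond to Stolz angles, which yields the boundary values of (phi')^(1/p)
  and the identity of the Smirnov norm with a weighted L^p norm on the circle. For F = phi - J,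
  joining two boundary points by either arc and using the mean value of F gives
  |F| <= 1/2 int |F'| |dz|; factoring a^p - b^p and applying the inequalities of Hoelder and
  Minkowski, with the competitor 1 to bound the norm of Q, gives the estimate. In a Smirnov domain
  an approximating polynomial is corrected at zeta by a constant, controlled by point evaluation.
*)

theory Submission
  imports Defs "HOL-Probability.Probability" "HOL-Real_Asymp.Real_Asymp"
begin

section \<open>Maximal function and Lebesgue points\<close>

text \<open>The relation that drives the estimates is |\<phi>'| |\<Psi>'| = R, which holds because
  \<phi> and \<Psi> are inverse to each other up to a linear factor of modulus R. It makes
  \<open>h\<close> composed with \<Psi> a constant times \<open>exp (- (k / p))\<close>, where
  \<open>k\<close> is a logarithm of \<Psi>', so that the boundary behaviour of \<open>h\<close> is
  read off from that of \<Psi>'. It also makes the p-norm of \<open>h\<close> exactly (2 pi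
  R)^(1/p). Hence the constant: the competitor 1 gives an error of at most (2 pi R)^(1/p) + l^(1/p),
  so the optimal polynomial has norm at most 2 (2 pi R)^(1/p) + l^(1/p), and adding the norm of
  \<open>h\<close> makes the factor 3. The obstacle is that the norm is defined through
  nontangential limits taken inside G and integrated against the Stieltjes measure of a curve
  parameter unrelated to \<phi>. Two facts are therefore needed at almost every angle: the boundary
  derivative of \<Psi> exists without restriction on the approach, and it is nonzero. Only then are
  approach regions of G and of the disk comparable, and boundary values unique.\<close>

lemma hardy_littlewood_maximal:
  fixes u :: "real \<Rightarrow> real"
  assumes u: "integrable lborel u" "\<And>y. u y \<ge> 0" and "L > 0"
  obtains T where "{\<theta>. \<exists>r>0. r \<le> B \<and> (LINT y:cball \<theta> r|lborel. u y) > L * r} \<subseteq> T"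
    "T \<in> lmeasurable" "measure lebesgue T \<le> 10 / L * (LINT y|lborel. u y)"
proof -
  define S where "S = {\<theta>. \<exists>r>0. r \<le> B \<and> (LINT y:cball \<theta> r|lborel. u y) > L * r}"
  have "\<forall>\<theta>\<in>S. \<exists>r>0. r \<le> B \<and> (LINT y:cball \<theta> r|lborel. u y) > L * r"
    unfolding S_def by auto
  then obtain r where r: "\<And>\<theta>. \<theta> \<in> S \<Longrightarrow> 0 < r \<theta> \<and> r \<theta> \<le> B"
    "\<And>\<theta>. \<theta> \<in> S \<Longrightarrow> (LINT y:cball \<theta> (r \<theta>)|lborel. u y) > L * r \<theta>"
    by metis
  have "S \<subseteq> (\<Union>i\<in>S. cball i (r i))"
    using r(1) by (force intro: less_imp_le)
  \<comment> \<open>Vitali's covering lemma selects disjoint intervals whose fivefold enlargements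
    cover \<open>S\<close>. An enlarged interval has length \<open>10 * r i\<close>, and
    \<open>r i\<close> is below \<open>1 / L\<close> times the mass of \<open>u\<close> on the
    selected one. Disjointness adds these masses up to at most the whole integral.\<close>
  then obtain C where C: "countable C" "C \<subseteq> S"
     "pairwise (\<lambda>i j. disjnt (cball i (r i)) (cball j (r j))) C"
     "S \<subseteq> (\<Union>i\<in>C. cball i (5 * r i))"
    using Vitali_covering_lemma_cballs[where S = S and K = S and a = "\<lambda>i. i" and r = r and B = B] r(1) by blast
  define T where "T = (\<Union>i\<in>C. cball i (5 * r i))"
  have T: "T \<in> sets lborel"
    unfolding T_def using C(1) by (auto intro!: sets.countable_UN')
  have disj: "disjoint_family_on (\<lambda>i. cball i (r i)) C"
    using C(3) by (auto simp: disjoint_family_on_def pairwise_def disjnt_def)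
  have le: "emeasure lborel (cball i (5 * r i))
      \<le> ennreal (10 / L) * emeasure (density lborel (\<lambda>y. ennreal (u y))) (cball i (r i))" if "i \<in> C" for i
  proof -
    have i: "i \<in> S" using that C(2) by auto
    have si: "integrable lborel (\<lambda>y. indicator (cball i (r i)) y *\<^sub>R u y)"
      by (intro integrable_mult_indicator u) auto
    have "emeasure (density lborel (\<lambda>y. ennreal (u y))) (cball i (r i))
       = (\<integral>\<^sup>+y. ennreal (indicator (cball i (r i)) y *\<^sub>R u y) \<partial>lborel)"
      using u by (subst emeasure_density)
         (auto intro!: nn_integral_cong simp: mult.commute indicator_def)
    also have "\<dots> = ennreal (LINT y:cball i (r i)|lborel. u y)"
      unfolding set_lebesgue_integral_def using si u(2) by (intro nn_integral_eq_integral) auto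
    finally have 1: "emeasure (density lborel (\<lambda>y. ennreal (u y))) (cball i (r i))
       = ennreal (LINT y:cball i (r i)|lborel. u y)" .
    have "emeasure lborel (cball i (5 * r i)) = ennreal (10 * r i)"
      using r(1)[OF i] by (simp add: cball_eq_atLeastAtMost)
    also have "\<dots> \<le> ennreal (10 / L * (LINT y:cball i (r i)|lborel. u y))"
      using r(2)[OF i] \<open>L > 0\<close> by (intro ennreal_leI) (simp add: field_simps)
    also have "\<dots> = ennreal (10 / L) * emeasure (density lborel (\<lambda>y. ennreal (u y))) (cball i (r i))"
      unfolding 1 using \<open>L > 0\<close> by (intro ennreal_mult') simp
    finally show ?thesis .
  qed
  \<comment> \<open>The countable sum over \<open>C\<close> is written as an integral over
    \<open>count_space C\<close>, the form in which additivity over disjoint countable unions is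
    available.\<close>
  have "emeasure lborel T \<le> (\<integral>\<^sup>+i. emeasure lborel (cball i (5 * r i)) \<partial>count_space C)"
  proof (cases "C = {}")
    case True then show ?thesis by (simp add: T_def)
  next
    case False
    show ?thesis unfolding T_def
    proof (cases "finite C")
      case True
      have "emeasure lborel (\<Union>i\<in>C. cball i (5 * r i)) \<le> (\<Sum>i\<in>C. emeasure lborel (cball i (5 * r i)))"
        by (intro emeasure_subadditive_finite True) auto
      then show "emeasure lborel (\<Union>i\<in>C. cball i (5 * r i)) \<le> (\<integral>\<^sup>+i. emeasure lborel (cball i (5 * r i)) \<partial>count_space C)"
        by (simp add: nn_integral_count_space_finite True)
    next
      case inf: False
      let ?e = "from_nat_into C"
      have bij: "bij_betw ?e UNIV C" using C(1) inf by (simp add: bij_betw_from_nat_into)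
      have "(\<Union>i\<in>C. cball i (5 * r i)) = (\<Union>n. cball (?e n) (5 * r (?e n)))"
        using bij by (auto simp: bij_betw_def) (metis rangeE)
      then have "emeasure lborel (\<Union>i\<in>C. cball i (5 * r i)) \<le> (\<Sum>n. emeasure lborel (cball (?e n) (5 * r (?e n))))"
        by (simp only:) (intro emeasure_subadditive_countably, auto)
      also have "\<dots> = (\<integral>\<^sup>+n. emeasure lborel (cball (?e n) (5 * r (?e n))) \<partial>count_space UNIV)"
        by (simp add: nn_integral_count_space_nat)
      also have "\<dots> = (\<integral>\<^sup>+i. emeasure lborel (cball i (5 * r i)) \<partial>count_space C)"
        by (rule nn_integral_bij_count_space[OF bij])
      finally show "emeasure lborel (\<Union>i\<in>C. cball i (5 * r i)) \<le> (\<integral>\<^sup>+i. emeasure lborel (cball i (5 * r i)) \<partial>count_space C)" .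
    qed
  qed
  also have "\<dots> \<le> (\<integral>\<^sup>+i. ennreal (10 / L) * emeasure (density lborel (\<lambda>y. ennreal (u y))) (cball i (r i)) \<partial>count_space C)"
    by (intro nn_integral_mono le) simp
  also have "\<dots> = ennreal (10 / L) * emeasure (density lborel (\<lambda>y. ennreal (u y))) (\<Union>i\<in>C. cball i (r i))"
    using disj C(1) by (subst emeasure_UN_countable) (auto simp: nn_integral_cmult)
  also have "\<dots> \<le> ennreal (10 / L) * emeasure (density lborel (\<lambda>y. ennreal (u y))) UNIV"
    by (intro mult_left_mono emeasure_mono) auto
  also have "emeasure (density lborel (\<lambda>y. ennreal (u y))) UNIV = ennreal (LINT y|lborel. u y)"
    using u by (subst emeasure_density) (auto simp: nn_integral_eq_integral)
  also have "ennreal (10 / L) * ennreal (LINT y|lborel. u y) = ennreal (10 / L * (LINT y|lborel. u y))"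
    using \<open>L > 0\<close> by (intro ennreal_mult'[symmetric]) simp
  finally have em: "emeasure lborel T \<le> ennreal (10 / L * (LINT y|lborel. u y))" .
  have "emeasure lborel T < \<infinity>" by (rule le_less_trans[OF em]) simp
  then have Tm: "T \<in> lmeasurable" using T by (auto intro!: fmeasurableI)
  moreover have "measure lebesgue T \<le> 10 / L * (LINT y|lborel. u y)"
    unfolding measure_def using em T \<open>L > 0\<close> u
    by (auto intro!: enn2real_leI divide_nonneg_nonneg mult_nonneg_nonneg integral_nonneg)
  ultimately show ?thesis using C(4) that unfolding S_def T_def by blast
qed

text \<open>Almost every point is a Lebesgue point; the hypothesis of approximability by continuous
  functions holds for every integrable function, but here approximants are always at hand.\<close>

lemma lebesgue_points:
  fixes x :: "real \<Rightarrow> complex" and g :: "nat \<Rightarrow> real \<Rightarrow> complex"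
  assumes x: "set_integrable lborel {a..b} x"
    and g: "\<And>n. continuous_on {a..b} (g n)"
    and lim: "(\<lambda>n. LINT s:{a..b}|lborel. norm (x s - g n s)) \<longlonglongrightarrow> 0"
  obtains N where "negligible N"
    "\<And>\<theta> \<epsilon>. \<theta> \<in> {a<..<b} - N \<Longrightarrow> \<epsilon> > 0 \<Longrightarrow> \<exists>\<delta>>0. \<forall>y. \<bar>y - \<theta>\<bar> < \<delta> \<longrightarrow>
        (LINT s:{min \<theta> y..max \<theta> y}|lborel. norm (x s - x \<theta>)) \<le> \<epsilon> * \<bar>y - \<theta>\<bar>"
proof -
  define good where "good \<epsilon> \<theta> \<longleftrightarrow> (\<exists>\<delta>>0. \<forall>y. \<bar>y - \<theta>\<bar> < \<delta> \<longrightarrow>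
        (LINT s:{min \<theta> y..max \<theta> y}|lborel. norm (x s - x \<theta>)) \<le> \<epsilon> * \<bar>y - \<theta>\<bar>)" for \<epsilon> \<theta>
  define u where "u n s = indicator {a..b} s * norm (x s - g n s)" for n s
  have gi: "set_integrable lborel {a..b} (g n)" for n
    using g borel_integrable_atLeastAtMost' by blast
  have ui: "integrable lborel (u n)" for n
    using set_integrable_norm[OF set_integral_diff(1)[OF x gi[of n]]]
    unfolding u_def set_integrable_def by simp
  have u0: "u n s \<ge> 0" for n s unfolding u_def by simp
  have ulim: "(\<lambda>n. LINT s|lborel. u n s) \<longlonglongrightarrow> 0"
    using lim unfolding u_def set_lebesgue_integral_def by simp
  have E: "negligible {\<theta>\<in>{a<..<b}. \<not> good \<epsilon> \<theta>}" if ep: "\<epsilon> > 0" for \<epsilon>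
    unfolding negligible_outer_le
  proof (intro allI impI)
    fix e :: real assume "e > 0"
    \<comment> \<open>The 44 is 40 + 4: the maximal inequality at height
      \<open>\<epsilon> / 4\<close> contributes the factor \<open>40 / \<epsilon>\<close>, Markov's
      inequality at the same height \<open>4 / \<epsilon>\<close>.\<close>
    then have "\<forall>\<^sub>F n in sequentially. (LINT s|lborel. u n s) < e * \<epsilon> / 44"
      using that ulim by (intro order_tendstoD(2)) auto
    then obtain n where n: "(LINT s|lborel. u n s) < e * \<epsilon> / 44"
      using eventually_happens by force
    obtain T1 where T1: "{\<theta>. \<exists>r>0. r \<le> b - a \<and> (LINT y:cball \<theta> r|lborel. u n y) > (\<epsilon> / 4) * r} \<subseteq> T1"
      "T1 \<in> lmeasurable" "measure lebesgue T1 \<le> 10 / (\<epsilon> / 4) * (LINT y|lborel. u n y)"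
      by (rule hardy_littlewood_maximal[where L = "\<epsilon> / 4" and B = "b - a", OF ui[of n] u0])
         (use ep in auto)
    define T2 where "T2 = {s. u n s \<ge> \<epsilon> / 4}"
    have T2s: "T2 \<in> sets lborel" unfolding T2_def using borel_measurable_integrable[OF ui[of n]] by measurable
    have "measure lborel T2 \<le> (LINT y|lborel. u n y) / (\<epsilon> / 4)"
      using integral_Markov_inequality_measure[OF ui[of n], of UNIV "\<epsilon> / 4"] that u0 unfolding T2_def by simp
    moreover have "emeasure lborel T2 < \<infinity>"
    proof -
      have "emeasure lborel T2 \<le> ennreal (1 / (\<epsilon> / 4) * (LINT y|lborel. u n y))"
        using integral_Markov_inequality[OF ui[of n], of "\<epsilon> / 4"] that u0 unfolding T2_def by simp
      also have "\<dots> < \<infinity>" by simp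
      finally show ?thesis .
    qed
    ultimately have T2: "T2 \<in> lmeasurable" "measure lebesgue T2 \<le> 4 / \<epsilon> * (LINT y|lborel. u n y)"
      using T2s by (auto intro!: fmeasurableI simp: divide_simps mult.commute)
    have "{\<theta>\<in>{a<..<b}. \<not> good \<epsilon> \<theta>} \<subseteq> T1 \<union> T2"
    proof (rule ccontr)
      assume "\<not> ?thesis"
      then obtain \<theta> where \<theta>: "\<theta> \<in> {a<..<b}" "\<not> good \<epsilon> \<theta>" "\<theta> \<notin> T1" "\<theta> \<notin> T2" by auto
      have "continuous (at \<theta>) (g n)"
        using g[of n] \<theta>(1) by (simp add: continuous_on_interior)
      then obtain d where d: "d > 0" "\<And>s. \<bar>s - \<theta>\<bar> < d \<Longrightarrow> norm (g n s - g n \<theta>) < \<epsilon> / 4"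
        unfolding continuous_at_eps_delta
      by (metis dist_norm dist_real_def divide_pos_pos ep zero_less_numeral)
      define \<delta> where "\<delta> = min d (min (\<theta> - a) (b - \<theta>))"
      have "\<delta> > 0" using d \<theta>(1) by (auto simp: \<delta>_def)
      have "(LINT s:{min \<theta> y..max \<theta> y}|lborel. norm (x s - x \<theta>)) \<le> \<epsilon> * \<bar>y - \<theta>\<bar>" if y: "\<bar>y - \<theta>\<bar> < \<delta>" for y
      proof (cases "y = \<theta>")
        case True
        have "(\<lambda>s. indicator {\<theta>} s * norm (x s - x \<theta>)) = (\<lambda>_. 0)" by (auto simp: indicator_def)
        with True show ?thesis by (simp add: set_lebesgue_integral_def)
      next
        case False
        let ?I = "{min \<theta> y..max \<theta> y}" and ?r = "\<bar>y - \<theta>\<bar>"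
        have sub: "?I \<subseteq> {a..b}" using y \<theta>(1) by (auto simp: \<delta>_def)
        have sub2: "?I \<subseteq> cball \<theta> ?r" by (auto simp: dist_real_def)
        have xI: "set_integrable lborel ?I x" by (rule set_integrable_subset[OF x _ sub]) auto
        have uI: "set_integrable lborel A (u n)" if "A \<in> sets lborel" for A
          unfolding set_integrable_def by (intro integrable_mult_indicator ui that)
        have cI: "set_integrable lborel ?I (\<lambda>s. c)" for c :: "'z::{banach,second_countable_topology}"
          using borel_integrable_atLeastAtMost'[OF continuous_on_const] by blast
        have m: "measure lborel ?I = ?r" by (simp add: min_def max_def)
        \<comment> \<open>The increment of \<open>x\<close> passes through \<open>g n s\<close> and
          \<open>g n \<theta>\<close>. Continuity of \<open>g n\<close> and
          \<open>\<theta> \<notin> T2\<close> cost \<epsilon>/4 each, and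
          \<open>\<theta> \<notin> T1\<close> bounds the integral of \<open>u n\<close> by another
          \<epsilon>/4 times the length.\<close>
        have "(LINT s:?I|lborel. norm (x s - x \<theta>)) \<le> (LINT s:?I|lborel. u n s + \<epsilon> / 2)"
        proof (rule set_integral_mono)
          show "set_integrable lborel ?I (\<lambda>s. norm (x s - x \<theta>))"
            by (intro set_integrable_norm set_integral_diff xI cI)
          show "set_integrable lborel ?I (\<lambda>s. u n s + \<epsilon> / 2)"
            by (intro set_integral_add uI cI) auto
          fix s assume s: "s \<in> ?I"
          then have s1: "s \<in> {a..b}" "\<bar>s - \<theta>\<bar> < d" using sub y by (auto simp: \<delta>_def)
          have "norm (x s - x \<theta>) \<le> norm (x s - g n s) + norm (g n s - g n \<theta>) + norm (x \<theta> - g n \<theta>)"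
            by (smt (verit) norm_minus_commute norm_triangle_ineq norm_diff_triangle_ineq norm_diff_triangle_le)
          also have "norm (x s - g n s) = u n s" using s1 by (simp add: u_def)
          also have "norm (x \<theta> - g n \<theta>) = u n \<theta>" using \<theta>(1) by (simp add: u_def)
          also have "\<dots> \<le> \<epsilon> / 4" using \<theta>(4) by (simp add: T2_def)
          finally show "norm (x s - x \<theta>) \<le> u n s + \<epsilon> / 2" using d(2)[OF s1(2)] by simp
        qed
        also have "\<dots> = (LINT s:?I|lborel. u n s) + \<epsilon> / 2 * ?r"
          using set_integral_const[of ?I lborel "\<epsilon> / 2"] m
          by (subst set_integral_add(2)) (auto intro!: uI cI)
        also have "(LINT s:?I|lborel. u n s) \<le> (LINT s:cball \<theta> ?r|lborel. u n s)"
          unfolding set_lebesgue_integral_def using sub2 u0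
          by (intro integral_mono uI[unfolded set_integrable_def]) (auto simp: indicator_def)
        also have "(LINT s:cball \<theta> ?r|lborel. u n s) \<le> \<epsilon> / 4 * ?r"
        proof -
          have "?r > 0" "?r \<le> b - a" using False y \<theta>(1) by (auto simp: \<delta>_def)
          then have "\<not> (LINT s:cball \<theta> ?r|lborel. u n s) > \<epsilon> / 4 * ?r" using T1(1) \<theta>(3) by blast
          then show ?thesis by (simp only: not_less)
        qed
        finally show ?thesis
          using mult_nonneg_nonneg[OF less_imp_le[OF ep] abs_ge_zero[of "y - \<theta>"]] by linarith
      qed
      with \<open>\<delta> > 0\<close> \<theta>(2) show False unfolding good_def by blast
    qed
    moreover have "measure lebesgue (T1 \<union> T2) \<le> e"
    proof -
      have "measure lebesgue (T1 \<union> T2) \<le> measure lebesgue T1 + measure lebesgue T2"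
        using T1 T2 by (intro measure_Un_le) auto
      also have "\<dots> \<le> 44 / \<epsilon> * (LINT y|lborel. u n y)"
        using T1(3) T2(2) that by (simp add: field_simps)
      also have "\<dots> \<le> 44 / \<epsilon> * (e * \<epsilon> / 44)"
        using n that by (intro mult_left_mono) auto
      also have "\<dots> = e" using that by simp
      finally show ?thesis .
    qed
    ultimately show "\<exists>T. {\<theta> \<in> {a<..<b}. \<not> good \<epsilon> \<theta>} \<subseteq> T \<and> T \<in> lmeasurable \<and> measure lebesgue T \<le> e"
      using T1(2) T2(1) by blast
  qed
  define N where "N = (\<Union>k. {\<theta>\<in>{a<..<b}. \<not> good (1 / real (Suc k)) \<theta>})"
  have "negligible N" unfolding N_def using E by (intro negligible_countable_Union) (auto simp: zero_less_divide_iff)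
  moreover have "good \<epsilon> \<theta>" if \<theta>: "\<theta> \<in> {a<..<b} - N" "\<epsilon> > 0" for \<theta> \<epsilon>
  proof -
    obtain k where k: "1 / real (Suc k) < \<epsilon>" using \<open>\<epsilon> > 0\<close> by (metis nat_approx_posE)
    have "good (1 / real (Suc k)) \<theta>" using \<theta>(1) unfolding N_def by auto
    then show ?thesis unfolding good_def using k
      by (meson abs_ge_zero less_imp_le mult_right_mono order_trans)
  qed
  ultimately show ?thesis using that unfolding good_def by blast
qed

section \<open>Unrestricted boundary derivatives\<close>

text \<open>A Phragmen-Lindelof argument: the first factor of the multiplier kills the a priori unbounded
  growth at w0, the second one localizes the boundary bound.\<close>

lemma boundary_derivative_unrestricted:
  fixes f :: "complex \<Rightarrow> complex"
  assumes cont: "continuous_on (cball 0 1) f" and hol: "f holomorphic_on ball 0 1"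
    and w0: "norm w0 = 1"
    and lim: "((\<lambda>w. (f w - f w0) / (w - w0)) \<longlongrightarrow> c) (at w0 within sphere 0 1)"
  shows "((\<lambda>w. (f w - f w0) / (w - w0)) \<longlongrightarrow> c) (at w0 within cball 0 1)"
proof (rule tendstoI)
  fix \<epsilon>0 :: real assume "\<epsilon>0 > 0"
  define \<epsilon> where "\<epsilon> = \<epsilon>0 / 3"
  have eps: "\<epsilon> > 0" using \<open>\<epsilon>0 > 0\<close> by (simp add: \<epsilon>_def)
  define H where "H w = f w - f w0 - c * (w - w0)" for w
  have contH: "continuous_on (cball 0 1) H" unfolding H_def by (intro continuous_intros cont)
  have holH: "H holomorphic_on ball 0 1" unfolding H_def by (intro holomorphic_intros hol)
  have w00: "w0 \<noteq> 0" using w0 by auto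
  have "eventually (\<lambda>w. dist ((f w - f w0) / (w - w0)) c < \<epsilon>) (at w0 within sphere 0 1)"
    using lim eps by (rule tendstoD)
  then obtain d where d: "d > 0" "\<And>w. norm w = 1 \<Longrightarrow> w \<noteq> w0 \<Longrightarrow> dist w w0 < d \<Longrightarrow> dist ((f w - f w0) / (w - w0)) c < \<epsilon>"
    unfolding eventually_at by auto
  have Hd: "norm (H w) \<le> \<epsilon> * norm (w - w0)" if "norm w = 1" "dist w w0 < d" for w
  proof (cases "w = w0")
    case False
    have "H w / (w - w0) = (f w - f w0) / (w - w0) - c" using False by (simp add: H_def field_simps)
    then have "norm (H w / (w - w0)) < \<epsilon>" using d(2)[OF that(1) False that(2)] by (simp add: dist_norm)
    then show ?thesis using False by (simp add: norm_divide field_simps)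
  qed (simp add: H_def)
  have "bounded (H ` cball 0 1)" by (intro compact_imp_bounded compact_continuous_image contH) auto
  then obtain K where K: "K > 0" "\<And>w. norm w \<le> 1 \<Longrightarrow> norm (H w) \<le> K"
    unfolding bounded_pos by auto
  \<comment> \<open>At boundary points outside the \<open>d\<close>-neighbourhood of
    \<open>w0\<close> the quotient is only bounded by \<open>K / d\<close>. There the exponent is at
    least \<open>M * (d\<^sup>2 / 2)\<close>, and \<open>M\<close> is so large that the exponential
    brings this below \<epsilon>.\<close>
  obtain M where M: "M > 0" "K / d * exp (- M * (d\<^sup>2 / 2)) \<le> \<epsilon>"
  proof -
    have "((\<lambda>M. K / d * exp (- M * (d\<^sup>2 / 2))) \<longlongrightarrow> 0) at_top"
      using d(1) K(1) by real_asymp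
    then have "eventually (\<lambda>M. K / d * exp (- M * (d\<^sup>2 / 2)) < \<epsilon>) at_top"
      using eps by (rule order_tendstoD(2))
    then have "eventually (\<lambda>M. K / d * exp (- M * (d\<^sup>2 / 2)) < \<epsilon> \<and> M > 0) at_top"
      by (intro eventually_conj eventually_gt_at_top)
    then obtain M where "K / d * exp (- M * (d\<^sup>2 / 2)) < \<epsilon> \<and> M > 0"
      using eventually_happens'[OF trivial_limit_at_top_linorder] by blast
    then show ?thesis using that by force
  qed
  have nsq: "(norm (1 - w / w0))\<^sup>2 = 1 - 2 * Re (w / w0) + (norm w)\<^sup>2" for w
  proof -
    have "(norm (1 - v))\<^sup>2 = 1 - 2 * Re v + (norm v)\<^sup>2" for v :: complex
      by (simp only: cmod_power2) (simp add: power2_eq_square algebra_simps)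
    from this[of "w / w0"] show ?thesis using w0 by (simp add: norm_divide)
  qed
  have nd: "norm (1 - w / w0) = norm (w - w0)" for w
  proof -
    have "1 - w / w0 = - ((w - w0) / w0)" using w00 by (simp add: field_simps)
    then show ?thesis using w0 by (simp add: norm_divide)
  qed
  \<comment> \<open>This quadratic lower bound makes \<open>exp (- M * (1 - w / w0))\<close> at most
    1 in modulus on the whole disk and small away from \<open>w0\<close>.\<close>
  have Re_ge: "Re (1 - w / w0) \<ge> (norm (w - w0))\<^sup>2 / 2" if "norm w \<le> 1" for w
  proof -
    have "(norm w)\<^sup>2 \<le> 1" using that by (simp add: power_le_one)
    then show ?thesis using nsq[of w] nd[of w] by simp
  qed
  have key: "norm (H w) * norm (exp (- of_real M * (1 - w / w0))) \<le> \<epsilon> * norm (w - w0)"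
    if w: "norm w < 1" for w
  proof -
    have wne: "w \<noteq> w0" using w w0 by auto
    \<comment> \<open>Since \<open>1 / (1 - w / w0)\<close> has positive real part, its square root
      has real part at least half its modulus. So \<open>?V \<eta>\<close> is at most 1 in modulus
      and decays at \<open>w0\<close> faster than every power of |w - w0|. This absorbs the
      denominator and makes \<open>?G \<eta>\<close> continuous at \<open>w0\<close> with value
      0.\<close>
    let ?V = "\<lambda>\<eta> w. exp (- of_real \<eta> * csqrt (1 / (1 - w / w0)))"
    let ?G = "\<lambda>\<eta> w. if w = w0 then 0 else H w / (w - w0) * exp (- of_real M * (1 - w / w0)) * ?V \<eta> w"
    have nz: "1 - w / w0 \<noteq> 0" if "w \<noteq> w0" for w using that w00 by auto
    have Rpos: "Re (1 / (1 - w / w0)) > 0" if "norm w \<le> 1" "w \<noteq> w0" for w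
    proof -
      have "Re (1 - w / w0) > 0"
        using Re_ge[OF that(1)] that(2) by (smt (verit) zero_less_norm_iff right_minus_eq zero_less_power half_gt_zero)
      moreover have "Re (1 / z) > 0" if "Re z > 0" for z :: complex
        using that by (auto simp: Re_divide intro!: divide_pos_pos add_pos_nonneg)
      ultimately show ?thesis by blast
    qed
    have Rc: "Re (csqrt z) \<ge> sqrt (norm z) / 2" if "Re z > 0" for z
    proof -
      have "Re (csqrt z) = sqrt ((norm z + Re z) / 2)" by simp
      also have "\<dots> \<ge> sqrt (norm z / 4)" using that by (intro real_sqrt_le_mono) simp
      finally show ?thesis by (simp add: real_sqrt_divide)
    qed
    have Vle: "norm (?V \<eta> w) \<le> exp (- \<eta> / 2 * sqrt (1 / norm (w - w0)))" if "norm w \<le> 1" "w \<noteq> w0" "\<eta> > 0" for w \<eta>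
    proof -
      have "Re (csqrt (1 / (1 - w / w0))) \<ge> sqrt (1 / norm (w - w0)) / 2"
        using Rc[OF Rpos[OF that(1,2)]] nd[of w] by (simp add: norm_divide)
      then show ?thesis using that(3) by (simp add: norm_exp_eq_Re del: csqrt.simps)
    qed
    have V1: "norm (?V \<eta> w) \<le> 1" if "norm w \<le> 1" "w \<noteq> w0" "\<eta> > 0" for w \<eta>
      using Vle[OF that] that(3) by (smt (verit) exp_le_one_iff mult_nonneg_nonneg real_sqrt_ge_zero divide_nonneg_nonneg norm_ge_zero minus_divide_left mult_minus_left)
    have bound: "norm (H w) * norm (exp (- of_real M * (1 - w / w0))) * norm (?V \<eta> w) \<le> \<epsilon> * norm (w - w0)"
      if eta: "\<eta> > 0" for \<eta>
    proof -
      have eM1: "norm (exp (- of_real M * (1 - z / w0))) \<le> 1" if "norm z \<le> 1" for z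
        using Re_ge[OF that] M(1) by (simp add: norm_exp_eq_Re del: minus_complex.simps)
           (smt (verit) mult_nonneg_nonneg zero_le_power2 divide_nonneg_nonneg)
      have "norm (?G \<eta> w) \<le> \<epsilon>"
      proof (rule maximum_modulus_frontier[of "?G \<eta>" "cball 0 1"])
        have nn: "1 - z / w0 \<notin> \<real>\<^sub>\<le>\<^sub>0 \<and> 1 / (1 - z / w0) \<notin> \<real>\<^sub>\<le>\<^sub>0" if "norm z \<le> 1" "z \<noteq> w0" for z
        proof -
          have "Re (1 - z / w0) > 0"
            using Re_ge[OF that(1)] that(2) by (smt (verit) zero_less_norm_iff right_minus_eq zero_less_power half_gt_zero)
          then show ?thesis using Rpos[OF that] by (auto simp: complex_nonpos_Reals_iff)
        qed
        have nin: "z - w0 \<noteq> 0 \<and> w0 \<noteq> 0 \<and> 1 - z / w0 \<noteq> 0 \<and> 1 / (1 - z / w0) \<notin> \<real>\<^sub>\<le>\<^sub>0" if "z \<in> ball 0 1" for z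
        proof -
          have "norm z \<le> 1" "z \<noteq> w0" using that w0 by auto
          then show ?thesis using w00 nz[of z] nn[of z] by auto
        qed
        have "(\<lambda>w. H w / (w - w0) * exp (- of_real M * (1 - w / w0)) * ?V \<eta> w) holomorphic_on ball 0 1"
          using nin by (intro holomorphic_intros holH) auto
        then have "?G \<eta> holomorphic_on ball 0 1"
          by (rule holomorphic_transform) (use w0 in auto)
        then show "?G \<eta> holomorphic_on interior (cball 0 1)" by simp
        have c1: "continuous_on (cball 0 1 - {w0}) (\<lambda>w. H w / (w - w0) * exp (- of_real M * (1 - w / w0)) * ?V \<eta> w)"
          using w00 nz nn by (intro continuous_intros continuous_on_subset[OF contH]
             continuous_on_compose2[OF continuous_on_csqrt]) auto
        have "continuous_on (cball 0 1 - {w0}) (?G \<eta>)"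
          by (rule continuous_on_eq[OF c1]) auto
        have lim0: "(?G \<eta> \<longlongrightarrow> 0) (at w0 within cball 0 1)"
        proof (rule Lim_null_comparison)
          show "\<forall>\<^sub>F w in at w0 within cball 0 1. norm (?G \<eta> w) \<le> K * (exp (- \<eta> / 2 * sqrt (1 / norm (w - w0))) / norm (w - w0))"
            unfolding eventually_at_filter
          proof (intro always_eventually allI impI)
            fix z assume z: "z \<noteq> w0" "z \<in> cball 0 1"
            have "norm (?G \<eta> z) = norm (H z) / norm (z - w0) * norm (exp (- of_real M * (1 - z / w0))) * norm (?V \<eta> z)"
              using z by (simp only: if_False norm_mult norm_divide)
            also have "\<dots> \<le> K / norm (z - w0) * 1 * exp (- \<eta> / 2 * sqrt (1 / norm (z - w0)))"
              using z K eM1[of z] Vle[of z \<eta>] eta by (intro mult_mono divide_right_mono) auto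
            finally show "norm (?G \<eta> z) \<le> K * (exp (- \<eta> / 2 * sqrt (1 / norm (z - w0))) / norm (z - w0))" by simp
          qed
          have "((\<lambda>t. K * (exp (- \<eta> / 2 * sqrt (1 / t)) / t)) \<longlongrightarrow> 0) (at_right 0)"
            using eta K(1) by real_asymp
          moreover have "filterlim (\<lambda>w. norm (w - w0)) (at_right 0) (at w0 within cball 0 1)"
            unfolding filterlim_at
          proof
            show "\<forall>\<^sub>F z in at w0 within cball 0 1. norm (z - w0) \<in> {0<..} \<and> norm (z - w0) \<noteq> 0"
              unfolding eventually_at_filter by simp
            show "((\<lambda>w. norm (w - w0)) \<longlongrightarrow> 0) (at w0 within cball 0 1)"
              by (intro tendsto_eq_intros) auto
          qed
          ultimately show "((\<lambda>w. K * (exp (- \<eta> / 2 * sqrt (1 / norm (w - w0))) / norm (w - w0))) \<longlongrightarrow> 0) (at w0 within cball 0 1)"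
            by (rule filterlim_compose)
        qed
        have "continuous_on (cball 0 1) (?G \<eta>)"
          unfolding continuous_on_def
        proof
          fix z :: complex assume z: "z \<in> cball 0 1"
          show "(?G \<eta> \<longlongrightarrow> ?G \<eta> z) (at z within cball 0 1)"
          proof (cases "z = w0")
            case True then show ?thesis using lim0 by simp
          next
            case False
            have "(?G \<eta> \<longlongrightarrow> ?G \<eta> z) (at z within cball 0 1 - {w0})"
              using \<open>continuous_on (cball 0 1 - {w0}) (?G \<eta>)\<close> z False unfolding continuous_on_def by blast
            moreover have "at z within cball 0 1 - {w0} = at z within cball 0 1"
              by (rule at_within_nhd[of z "-{w0}"]) (use False in auto)
            ultimately show ?thesis by simp
          qed
        qed
        then show "continuous_on (closure (cball 0 1)) (?G \<eta>)" by simp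
        show "bounded (cball 0 1 :: complex set)" by simp
        show "w \<in> cball 0 1" using w by simp
        fix z :: complex assume "z \<in> frontier (cball 0 1)"
        then have z: "norm z = 1" by simp
        show "norm (?G \<eta> z) \<le> \<epsilon>"
        proof (cases "z = w0")
          case False
          have "norm (?G \<eta> z) = norm (H z) / norm (z - w0) * norm (exp (- of_real M * (1 - z / w0))) * norm (?V \<eta> z)"
            using False by (simp only: if_False norm_mult norm_divide)
          also have "\<dots> \<le> norm (H z) / norm (z - w0) * norm (exp (- of_real M * (1 - z / w0))) * 1"
            using z False eta V1[of z \<eta>] by (intro mult_left_mono) auto
          also have "\<dots> \<le> \<epsilon>"
          proof (cases "dist z w0 < d")
            case True
            have "norm (H z) / norm (z - w0) \<le> \<epsilon>" using Hd[OF z True] False by (simp add: field_simps)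
            then have "norm (H z) / norm (z - w0) * norm (exp (- of_real M * (1 - z / w0))) \<le> \<epsilon> * 1"
              using eM1[of z] z eps by (intro mult_mono) auto
            then show ?thesis by simp
          next
            case far: False
            have "Re (1 - z / w0) \<ge> (norm (z - w0))\<^sup>2 / 2" using z by (intro Re_ge) simp
            moreover have "(norm (z - w0))\<^sup>2 \<ge> d\<^sup>2" using far d(1) by (intro power_mono) (auto simp: dist_norm)
            ultimately have "Re (1 - z / w0) \<ge> d\<^sup>2 / 2" by linarith
            then have e: "norm (exp (- of_real M * (1 - z / w0))) \<le> exp (- M * (d\<^sup>2 / 2))"
              using M(1) by (simp add: norm_exp_eq_Re del: minus_complex.simps)
            have "norm (H z) / norm (z - w0) \<le> K / d" using far d(1) K(2)[of z] K(1) z by (intro frac_le) (auto simp: dist_norm)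
            then have "norm (H z) / norm (z - w0) * norm (exp (- of_real M * (1 - z / w0))) \<le> K / d * exp (- M * (d\<^sup>2 / 2))"
              using e d(1) K(1) by (intro mult_mono) auto
            then show ?thesis using M(2) by simp
          qed
          finally show ?thesis .
        qed (use eps in simp)
      qed
      then have "norm (H w) / norm (w - w0) * norm (exp (- of_real M * (1 - w / w0))) * norm (?V \<eta> w) \<le> \<epsilon>"
        using wne by (simp only: if_False norm_mult norm_divide)
      then show ?thesis using wne by (simp add: field_simps)
    qed
    \<comment> \<open>The bound is uniform in \<eta>, and at the fixed interior point
      \<open>?V \<eta>\<close> tends to 1 as \<eta> tends to 0.\<close>
    have "((\<lambda>\<eta>. norm (H w) * norm (exp (- of_real M * (1 - w / w0))) * norm (?V \<eta> w)) \<longlongrightarrow>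
       norm (H w) * norm (exp (- of_real M * (1 - w / w0))) * norm (?V 0 w)) (at_right 0)"
      by (intro tendsto_intros)
    then have "norm (H w) * norm (exp (- of_real M * (1 - w / w0))) * norm (?V 0 w) \<le> \<epsilon> * norm (w - w0)"
      by (rule tendsto_upperbound) (use bound in \<open>auto simp: eventually_at_right_less intro: eventually_at_rightI[of 0 1]\<close>)
    then show ?thesis by simp
  qed
  \<comment> \<open>Within \<open>ln 2 / M\<close> of \<open>w0\<close> the remaining exponential
    has modulus at least 1/2, so removing it costs a factor 2; the total
    \<open>2 * \<epsilon>\<close> is below \<open>\<epsilon>0\<close>.\<close>
  define d' where "d' = min d (ln 2 / M)"
  have d': "d' > 0" using d(1) M(1) by (simp add: d'_def)
  have fin: "dist ((f w - f w0) / (w - w0)) c < \<epsilon>0" if w: "norm w \<le> 1" "w \<noteq> w0" "dist w w0 < d'" for w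
  proof -
    have "norm (H w) \<le> 2 * \<epsilon> * norm (w - w0)"
    proof (cases "norm w = 1")
      case True
      have "norm (H w) \<le> \<epsilon> * norm (w - w0)" using Hd[OF True] w by (simp add: d'_def)
      also have "\<dots> \<le> 2 * \<epsilon> * norm (w - w0)" using eps by (intro mult_right_mono) auto
      finally show ?thesis .
    next
      case False
      then have "norm w < 1" using w by simp
      have "M * Re (1 - w / w0) \<le> M * norm (w - w0)"
        using complex_Re_le_cmod[of "1 - w / w0"] nd[of w] M(1) by (intro mult_left_mono) auto
      also have "\<dots> \<le> ln 2" using w(3) M(1) by (simp add: d'_def dist_norm field_simps)
      finally have "norm (exp (- of_real M * (1 - w / w0))) \<ge> exp (- ln 2)"
        by (simp add: norm_exp_eq_Re del: minus_complex.simps)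
      then have "norm (exp (- of_real M * (1 - w / w0))) \<ge> 1/2" by (simp add: exp_minus)
      then have "norm (H w) * (1/2) \<le> norm (H w) * norm (exp (- of_real M * (1 - w / w0)))"
        by (intro mult_left_mono) auto
      then show ?thesis using key[OF \<open>norm w < 1\<close>] by simp
    qed
    then have "norm (H w / (w - w0)) \<le> 2 * \<epsilon>" using w(2) by (simp add: norm_divide field_simps)
    moreover have "H w / (w - w0) = (f w - f w0) / (w - w0) - c" using w(2) by (simp add: H_def field_simps)
    ultimately show ?thesis using eps by (simp add: dist_norm \<epsilon>_def)
  qed
  show "\<forall>\<^sub>F w in at w0 within cball 0 1. dist ((f w - f w0) / (w - w0)) c < \<epsilon>0"
    unfolding eventually_at using d' fin by auto
qed

section \<open>Boundary correspondence of a Jordan domain\<close>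

lemma norm_cis_diff_le: "norm (cis a - cis b) \<le> \<bar>a - b\<bar>"
proof -
  have "cis a - cis b = cis b * (cis (a - b) - 1)"
    by (simp add: algebra_simps cis_mult)
  then have "norm (cis a - cis b) = norm (exp (\<i> * of_real (a - b)) - 1)"
    by (simp add: norm_mult cis_conv_exp)
  also have "\<dots> = 2 * \<bar>sin ((a - b) / 2)\<bar>" by (rule dist_exp_i_1)
  also have "\<dots> \<le> 2 * \<bar>(a - b) / 2\<bar>" by (intro mult_left_mono abs_sin_x_le_abs_x) auto
  finally show ?thesis by simp
qed

text \<open>The rotated point takes n equally spaced positions; \<open>j\<close> is the floor of n
  times the angle from a to b, measured in turns modulo 1. Finitely many rotations thus suffice to
  bring any point of a circle close to a prescribed one.\<close>

lemma exists_close_root_rotation: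
  assumes "n > 0"
  obtains j where "j < n" "norm (cis (2 * pi * real j / real n) * cis a - cis b) \<le> 2 * pi / real n"
proof -
  define t where "t = (b - a) / (2 * pi)"
  define s where "s = frac t"
  define j where "j = nat \<lfloor>real n * s\<rfloor>"
  have s: "0 \<le> s" "s < 1" by (simp_all add: s_def frac_lt_1)
  have rj: "real j = of_int \<lfloor>real n * s\<rfloor>" unfolding j_def using s by simp
  have "real n * s < real n" using s assms by simp
  then have "real j < real n" unfolding rj using floor_correct[of "real n * s"] by linarith
  then have "j < n" by simp
  have "cis (2 * pi * real j / real n) * cis a - cis b = cis (a + 2 * pi * real j / real n) - cis (a + 2 * pi * s)"
  proof -
    have "b = a + 2 * pi * s + 2 * pi * of_int \<lfloor>t\<rfloor>"
      by (simp add: s_def t_def frac_def field_simps)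
    then have "cis b = cis (a + 2 * pi * s) * cis (2 * pi * of_int \<lfloor>t\<rfloor>)" by (metis cis_mult)
    also have "cis (2 * pi * of_int \<lfloor>t\<rfloor>) = 1" by (rule cis_multiple_2pi) auto
    finally show ?thesis by (simp add: cis_mult add.commute)
  qed
  also have "norm \<dots> \<le> \<bar>2 * pi * real j / real n - 2 * pi * s\<bar>"
    using norm_cis_diff_le[of "a + 2 * pi * real j / real n" "a + 2 * pi * s"] by simp
  also have "\<dots> = 2 * pi / real n * \<bar>real j - real n * s\<bar>"
  proof -
    have "2 * pi * real j / real n - 2 * pi * s = 2 * pi / real n * (real j - real n * s)"
      using assms by (simp add: field_simps)
    then show ?thesis using assms by (simp add: abs_mult)
  qed
  also have "\<dots> \<le> 2 * pi / real n * 1"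
  proof (intro mult_left_mono)
    show "\<bar>real j - real n * s\<bar> \<le> 1" unfolding rj using floor_correct[of "real n * s"] by linarith
  qed simp
  finally show ?thesis using that \<open>j < n\<close> by simp
qed

text \<open>The product of the rotated copies of f about an interior point near z1 vanishes on the whole
  frontier of the common domain, because some rotation of every far boundary point leaves S.\<close>

lemma holomorphic_zero_if_zero_near_frontier_point:
  fixes f :: "complex \<Rightarrow> complex"
  assumes S: "open S" and hol: "f holomorphic_on S" and cont: "continuous_on (closure S) f"
    and z1: "z1 \<in> closure S" "z1 \<in> closure (- closure S)"
    and d: "d > 0" and zero: "\<And>z. z \<in> frontier S \<Longrightarrow> dist z z1 < d \<Longrightarrow> f z = 0"
  obtains z where "z \<in> S" "f z = 0"
proof -
  obtain z2 where z2: "z2 \<in> S" "dist z2 z1 < d / 3"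
    using z1(1) d unfolding closure_approachable by (metis divide_pos_pos zero_less_numeral)
  obtain z3 where z3: "z3 \<notin> closure S" "dist z3 z1 < d / 3"
    using z1(2)[unfolded closure_approachable] d by (metis ComplD divide_pos_pos zero_less_numeral)
  \<comment> \<open>The circle about the interior point \<open>z2\<close> passes through the
    exterior point \<open>z3\<close>. Its radius is below \<open>2 * d / 3\<close>, so the disk
    stays within distance \<open>d\<close> of \<open>z1\<close>, where \<open>f\<close> vanishes on
    the frontier.\<close>
  define \<rho> where "\<rho> = dist z3 z2"
  have \<rho>: "\<rho> > 0" using z2(1) z3(1) closure_subset by (auto simp: \<rho>_def)
  have \<rho>d: "\<rho> < 2 * d / 3" unfolding \<rho>_def using z2(2) z3(2) dist_triangle[of z3 z2 z1] by (simp add: dist_commute)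
  obtain \<eta> where \<eta>: "\<eta> > 0" "ball z3 \<eta> \<inter> closure S = {}"
    using z3(1) by (metis closed_closure disjoint_iff open_Compl open_contains_ball_eq ComplI subset_Compl_self_eq compl_le_swap1 inf_commute disjoint_eq_subset_Compl)
  \<comment> \<open>The rotations by multiples of \<open>2 * pi / n\<close> are so dense that every
    point of the circle has a rotated copy in the ball about \<open>z3\<close> that misses
    \<open>closure S\<close>.\<close>
  obtain n :: nat where n: "n > 0" "2 * pi * \<rho> / real n < \<eta>"
  proof -
    obtain n where "2 * pi * \<rho> / \<eta> < real n" using reals_Archimedean2 by blast
    moreover have "0 < 2 * pi * \<rho> / \<eta>" using \<rho> \<eta> by simp
    ultimately have "2 * pi * \<rho> / \<eta> < real n \<and> n > 0" by (metis less_trans of_nat_0_less_iff)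
    then show ?thesis using that[of n] \<eta> by (simp add: field_simps)
  qed
  define T where "T j z = z2 + cis (2 * pi * real j / real n) * (z - z2)" for j z
  define U where "U = ball z2 \<rho> \<inter> (\<Inter>j\<in>{..<n}. T j -` S)"
  define P where "P z = (\<Prod>j<n. f (T j z))" for z
  have Tc: "continuous_on A (T j)" for A j unfolding T_def by (intro continuous_intros)
  have Td: "dist (T j z) z2 = dist z z2" for j z by (simp add: T_def dist_norm norm_mult)
  have "open U" unfolding U_def
    by (intro open_Int open_INT open_ball finite_lessThan ballI open_vimage S Tc)
  have z2U: "z2 \<in> U" using z2 \<rho> by (auto simp: U_def T_def)
  define K where "K = cball z2 \<rho> \<inter> (\<Inter>j\<in>{..<n}. T j -` closure S)"
  have "closed K" unfolding K_def
    by (intro closed_Int closed_INT closed_cball ballI closed_vimage closed_closure Tc)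
  moreover have "U \<subseteq> K" unfolding U_def K_def using closure_subset[of S] by (auto simp: less_imp_le)
  ultimately have clU: "closure U \<subseteq> K" by (simp add: closure_minimal)
  have "norm (P z2) \<le> 0"
  proof (rule maximum_modulus_frontier[of P U])
    show "P holomorphic_on interior U"
    proof -
      have "(\<lambda>z. f (T j z)) holomorphic_on U" if "j < n" for j
      proof -
        have "(f \<circ> T j) holomorphic_on U"
          by (rule holomorphic_on_compose_gen[OF _ hol]) (use that in \<open>auto simp: T_def[abs_def] U_def intro!: holomorphic_intros\<close>)
        then show ?thesis by (simp add: o_def)
      qed
      then have "P holomorphic_on U" unfolding P_def by (intro holomorphic_on_prod) auto
      then show ?thesis using \<open>open U\<close> by (simp add: interior_open)
    qed
    show "continuous_on (closure U) P" unfolding P_def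
      by (intro continuous_on_prod continuous_on_compose2[OF cont] Tc) (use clU in \<open>auto simp: K_def\<close>)
    show "bounded U" unfolding U_def by (intro bounded_Int) auto
    show "z2 \<in> U" by fact
    fix z assume "z \<in> frontier U"
    then have z: "z \<in> K" "z \<notin> U" using clU \<open>open U\<close> by (auto simp: frontier_def interior_open)
    \<comment> \<open>A point of \<open>K\<close> keeps all its rotated copies in
      \<open>closure S\<close>, so it cannot lie on the circle itself. A frontier point of
      \<open>U\<close> is therefore strictly inside the disk and fails to be in \<open>U\<close>
      only because some copy lies on the frontier of \<open>S\<close>.\<close>
    have "dist z z2 < \<rho>"
    proof (rule ccontr)
      assume "\<not> dist z z2 < \<rho>"
      then have zr: "norm (z - z2) = \<rho>" using z(1) by (auto simp: K_def dist_norm norm_minus_commute)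
      obtain j where j: "j < n" "norm (cis (2 * pi * real j / real n) * cis (Arg (z - z2)) - cis (Arg (z3 - z2))) \<le> 2 * pi / real n"
        using exists_close_root_rotation[OF n(1)] by blast
      have e1: "z - z2 = of_real \<rho> * cis (Arg (z - z2))" by (metis zr rcis_cmod_Arg rcis_def)
      have e2: "z3 - z2 = of_real \<rho> * cis (Arg (z3 - z2))" unfolding \<rho>_def dist_norm by (metis rcis_cmod_Arg rcis_def)
      have "T j z - z3 = cis (2 * pi * real j / real n) * (z - z2) - (z3 - z2)" by (simp add: T_def)
      also have "\<dots> = of_real \<rho> * (cis (2 * pi * real j / real n) * cis (Arg (z - z2)) - cis (Arg (z3 - z2)))"
        by (subst e1, subst e2) (simp add: algebra_simps)
      finally have "norm (T j z - z3) = \<rho> * norm (cis (2 * pi * real j / real n) * cis (Arg (z - z2)) - cis (Arg (z3 - z2)))"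
        using \<rho> by (simp add: norm_mult)
      also have "\<dots> \<le> \<rho> * (2 * pi / real n)" using j(2) \<rho> by (intro mult_left_mono) auto
      also have "\<dots> < \<eta>" using n(2) by (simp add: mult_ac)
      finally have "T j z \<in> ball z3 \<eta>" by (simp add: dist_norm norm_minus_commute)
      moreover have "T j z \<in> closure S" using z(1) j(1) by (auto simp: K_def)
      ultimately show False using \<eta>(2) by auto
    qed
    then obtain j where j: "j < n" "T j z \<notin> S" "T j z \<in> closure S"
      using z by (auto simp: U_def K_def dist_commute)
    then have "T j z \<in> frontier S" using S by (simp add: frontier_def interior_open)
    moreover have "dist (T j z) z1 < d"
      using dist_triangle[of "T j z" z1 z2] Td[of j z] \<open>dist z z2 < \<rho>\<close> \<rho>d z2(2) by linarith
    ultimately have "f (T j z) = 0" using zero by blast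
    then show "norm (P z) \<le> 0" using j(1) unfolding P_def by (auto simp: prod_zero_iff)
  qed
  \<comment> \<open>All rotations fix the centre, so \<open>P z2\<close> is a power of
    \<open>f z2\<close>.\<close>
  then have "f z2 ^ n = 0" by (simp add: P_def T_def)
  then show ?thesis using that z2(1) n(1) by auto
qed

text \<open>If there were no such arc, every parameter interval would contain parameters outside
  \<open>Z\<close>. Two of them, one from each of the two arcs between \<open>a\<close> and
  \<open>b\<close>, cut the loop into closed arcs that share no point of \<open>Z\<close>, and this
  disconnects \<open>Z\<close>.\<close>

lemma connected_subset_simple_loop_contains_arc:
  fixes \<gamma> :: "real \<Rightarrow> complex"
  assumes \<gamma>: "simple_path \<gamma>" "pathfinish \<gamma> = pathstart \<gamma>"
    and Z: "connected Z" "closed Z" "Z \<subseteq> path_image \<gamma>" and ab: "a \<in> Z" "b \<in> Z" "a \<noteq> b"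
  obtains p q where "0 \<le> p" "p < q" "q \<le> 1" "\<gamma> ` {p..q} \<subseteq> Z"
proof (rule ccontr)
  assume no: "\<not> thesis"
  note witness = that
  have free: "\<And>x y. x \<in> {0..1} \<Longrightarrow> y \<in> {0..1} \<Longrightarrow> \<gamma> x = \<gamma> y \<Longrightarrow> x = y \<or> x = 0 \<and> y = 1 \<or> x = 1 \<and> y = 0"
    and path: "path \<gamma>"
    using \<gamma>(1) by (auto simp: simple_path_def loop_free_def)
  have contg: "continuous_on {0..1} \<gamma>" using path by (simp add: path_def)
  have gap: "\<exists>u. p < u \<and> u < q \<and> \<gamma> u \<notin> Z" if "0 \<le> p" "p < q" "q \<le> 1" for p q
  proof (rule ccontr)
    assume *: "\<nexists>u. p < u \<and> u < q \<and> \<gamma> u \<notin> Z"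
    \<comment> \<open>The middle third turns the open interval that is assumed to map into
      \<open>Z\<close> into a closed one.\<close>
    define p' where "p' = p + (q - p) / 3"
    define q' where "q' = p + 2 * (q - p) / 3"
    have "0 \<le> p'" "p' < q'" "q' \<le> 1" "p < p'" "q' < q" using that by (auto simp: p'_def q'_def field_simps)
    moreover from this have "\<gamma> ` {p'..q'} \<subseteq> Z" using * by force
    ultimately show False using no witness[of p' q'] by blast
  qed
  have compact_arc: "closed (\<gamma> ` {x..y})" if "0 \<le> x" "y \<le> 1" for x y
    using that by (intro compact_imp_closed compact_continuous_image continuous_on_subset[OF contg]) auto
  have key: False if uv: "0 \<le> u" "u < v" "v \<le> 1" "\<gamma> u \<notin> Z" "\<gamma> v \<notin> Z"
      and x: "x \<in> {u..v}" "\<gamma> x \<in> Z" and y: "y \<in> {0..u} \<union> {v..1}" "\<gamma> y \<in> Z" for u v x y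
  proof -
    let ?A = "\<gamma> ` {u..v}" and ?B = "\<gamma> ` {0..u} \<union> \<gamma> ` {v..1}"
    have "closed ?A" "closed ?B" using uv by (auto intro!: closed_Un compact_arc)
    moreover have "Z \<subseteq> ?A \<union> ?B" using Z(3) uv unfolding path_image_def by force
    moreover have "?A \<inter> Z \<noteq> {}" using x by blast
    moreover have "?B \<inter> Z \<noteq> {}" using y by blast
    moreover have "?A \<inter> ?B \<inter> Z = {}"
    proof (rule ccontr)
      assume "?A \<inter> ?B \<inter> Z \<noteq> {}"
      then obtain s t where st: "s \<in> {u..v}" "t \<in> {0..u} \<union> {v..1}" "\<gamma> s = \<gamma> t" "\<gamma> s \<in> Z" by force
      then have "s = t \<or> s = 0 \<and> t = 1 \<or> s = 1 \<and> t = 0" using free[of s t] uv by auto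
      then have "s = u \<or> s = v" using st uv by auto
      then show False using st(4) uv by auto
    qed
    ultimately show False using connected_closedD[OF Z(1)] by metis
  qed
  obtain s0 t0 where st0: "s0 \<in> {0..1}" "t0 \<in> {0..1}" "\<gamma> s0 = a" "\<gamma> t0 = b"
    using ab Z(3) unfolding path_image_def by blast
  define s where "s = min s0 t0"
  define t where "t = max s0 t0"
  have "s0 \<noteq> t0" using st0 ab(3) by auto
  then have st: "0 \<le> s" "s < t" "t \<le> 1" "\<gamma> s \<in> Z" "\<gamma> t \<in> Z" "\<gamma> s \<noteq> \<gamma> t"
    using st0 ab by (auto simp: s_def t_def min_def max_def)
  \<comment> \<open>The two parameters are not both endpoints, since these give the same point;
    hence a second cut point exists before \<open>s\<close> or after \<open>t\<close>.\<close>
  have n01: "\<not> (s = 0 \<and> t = 1)" using st(6) \<gamma>(2) by (auto simp: pathfinish_def pathstart_def)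
  obtain u where u: "s < u" "u < t" "\<gamma> u \<notin> Z" using gap[of s t] st by auto
  show False
  proof (cases "s = 0")
    case True
    then have "t < 1" using n01 st by auto
    then obtain v where v: "t < v" "v < 1" "\<gamma> v \<notin> Z" using gap[of t 1] st by auto
    show False using key[of u v t s] u v st by auto
  next
    case False
    then obtain v where v: "0 < v" "v < s" "\<gamma> v \<notin> Z" using gap[of 0 s] st by auto
    show False using key[of v u s t] u v st by auto
  qed
qed

section \<open>Extension of the conformal map to a bijection of the closures\<close>

locale jordan_conformal =
  fixes G :: "complex set" and \<gamma> :: "real \<Rightarrow> complex" and \<phi> :: "complex \<Rightarrow> complex" and R :: real
  assumes jordan: "jordan_domain_bounded_by G \<gamma>"
    and hol_phi: "\<phi> holomorphic_on G" and bij_phi: "bij_betw \<phi> G (ball 0 R)"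
    and cont_phi: "continuous_on (closure G) \<phi>"
begin

lemma simple: "simple_path \<gamma>" and loop: "pathfinish \<gamma> = pathstart \<gamma>"
  and G_inside: "G = inside (path_image \<gamma>)"
  using jordan unfolding jordan_domain_bounded_by_def by auto

lemma open_G: "open G" and bounded_G: "bounded G" and nonempty_G: "G \<noteq> {}" and connected_G: "connected G"
  and frontier_G: "frontier G = path_image \<gamma>" and closure_G: "closure G = G \<union> path_image \<gamma>"
  and G_disjoint: "G \<inter> path_image \<gamma> = {}"
proof -
  note J = Jordan_inside_outside[OF simple loop]
  show "open G" "bounded G" "G \<noteq> {}" "connected G" "frontier G = path_image \<gamma>" unfolding G_inside using J by auto
  then show "closure G = G \<union> path_image \<gamma>" using closure_Un_frontier by metis
  show "G \<inter> path_image \<gamma> = {}" unfolding G_inside using inside_no_overlap by blast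
qed

text \<open>The unbounded component of the complement misses the closure of \<open>G\<close> and has
  the whole curve as its frontier. It supplies the exterior point at which the rotation argument
  aims.\<close>

lemma frontier_G_outside: "z \<in> path_image \<gamma> \<Longrightarrow> z \<in> closure (- closure G)"
proof -
  assume z: "z \<in> path_image \<gamma>"
  note J = Jordan_inside_outside[OF simple loop]
  have "outside (path_image \<gamma>) \<subseteq> - closure G"
    using closure_G G_inside outside_no_overlap inside_Int_outside by blast
  moreover have "z \<in> closure (outside (path_image \<gamma>))" using z J by (metis Un_iff closure_Un_frontier)
  ultimately show ?thesis using closure_mono by blast
qed

lemma R_pos: "R > 0"
  using bij_phi nonempty_G by (metis bij_betw_empty2 ball_eq_empty not_le)

lemma inverse_on_disk:
  obtains \<psi> where "\<psi> holomorphic_on ball 0 R" "\<And>z. z \<in> G \<Longrightarrow> \<psi> (\<phi> z) = z"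
    "\<And>w. w \<in> ball 0 R \<Longrightarrow> \<psi> w \<in> G \<and> \<phi> (\<psi> w) = w"
proof -
  have inj: "inj_on \<phi> G" and im: "\<phi> ` G = ball 0 R" using bij_phi by (auto simp: bij_betw_def)
  obtain g where g: "g holomorphic_on (\<phi> ` G)" "\<And>z. z \<in> G \<Longrightarrow> g (\<phi> z) = z"
    using holomorphic_has_inverse[OF hol_phi open_G inj] by metis
  have "g w \<in> G \<and> \<phi> (g w) = w" if "w \<in> ball 0 R" for w
    using that g(2) im by (metis imageE)
  then show ?thesis using that g im by auto
qed

text \<open>Were the value inside the disk, the inverse map would be continuous there. Applied to
  the images of points of \<open>G\<close> that converge to \<open>z\<close>, it would give back
  these points, so their limit \<open>z\<close> would lie in \<open>G\<close>.\<close>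

lemma phi_frontier: "z \<in> path_image \<gamma> \<Longrightarrow> norm (\<phi> z) = R"
proof (rule ccontr)
  assume z: "z \<in> path_image \<gamma>" and ne: "norm (\<phi> z) \<noteq> R"
  obtain \<psi> where \<psi>: "\<psi> holomorphic_on ball 0 R" "\<And>z. z \<in> G \<Longrightarrow> \<psi> (\<phi> z) = z"
    "\<And>w. w \<in> ball 0 R \<Longrightarrow> \<psi> w \<in> G \<and> \<phi> (\<psi> w) = w" using inverse_on_disk by metis
  have zc: "z \<in> closure G" using z closure_G by auto
  have "\<phi> ` closure G \<subseteq> closure (\<phi> ` G)" using cont_phi by (simp add: image_closure_subset closure_subset)
  then have "\<phi> z \<in> cball 0 R" using zc bij_phi R_pos by (auto simp: bij_betw_def)
  then have w: "\<phi> z \<in> ball 0 R" using ne by auto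
  obtain X where X: "\<And>n. X n \<in> G" "X \<longlonglongrightarrow> z" using zc unfolding closure_sequential by auto
  have "(\<lambda>n. \<phi> (X n)) \<longlonglongrightarrow> \<phi> z"
    by (rule continuous_on_tendsto_compose[OF cont_phi X(2) zc]) (use X(1) closure_subset[of G] in \<open>auto intro!: always_eventually\<close>)
  moreover have "isCont \<psi> (\<phi> z)"
    using \<psi>(1) w by (meson continuous_on_interior holomorphic_on_imp_continuous_on interior_ball continuous_on_eq_continuous_at open_ball)
  ultimately have "(\<lambda>n. \<psi> (\<phi> (X n))) \<longlonglongrightarrow> \<psi> (\<phi> z)" by (rule isCont_tendsto_compose[rotated])
  then have "X \<longlonglongrightarrow> \<psi> (\<phi> z)" using X(1) \<psi>(2) by simp
  then have "z = \<psi> (\<phi> z)" using X(2) LIMSEQ_unique by blast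
  then show False using \<psi>(3)[OF w] z G_disjoint by auto
qed

text \<open>The fibre is the intersection of a decreasing sequence of compact connected sets: the
  closures of the images under the inverse map of the convex sets \<open>B n\<close>, which shrink
  to the point \<open>w0\<close> of the circle.\<close>

lemma connected_fibre: "norm w0 = R \<Longrightarrow> connected {z \<in> closure G. \<phi> z = w0}"
proof -
  assume w0: "norm w0 = R"
  obtain \<psi> where \<psi>: "\<psi> holomorphic_on ball 0 R" "\<And>z. z \<in> G \<Longrightarrow> \<psi> (\<phi> z) = z"
    "\<And>w. w \<in> ball 0 R \<Longrightarrow> \<psi> w \<in> G \<and> \<phi> (\<psi> w) = w" using inverse_on_disk by metis
  define B where "B n = ball 0 R \<inter> ball w0 (1 / real (Suc n))" for n :: nat
  define K where "K n = closure (\<psi> ` B n)" for n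
  have sub: "\<psi> ` B n \<subseteq> G" for n using \<psi>(3) by (auto simp: B_def)
  have "connected (\<Inter>(range K))"
  proof (rule connected_nest)
    show "compact (K n)" for n unfolding K_def compact_closure using bounded_subset[OF bounded_G sub] .
    show "connected (K n)" for n unfolding K_def
      by (intro connected_imp_connected_closure connected_continuous_image holomorphic_on_imp_continuous_on
          holomorphic_on_subset[OF \<psi>(1)] convex_connected) (auto simp: B_def intro!: convex_Int)
    show "K n \<subseteq> K m" if "m \<le> n" for m n
      unfolding K_def B_def using that
      by (intro closure_mono image_mono Int_mono subset_ball order_refl) (auto simp: field_simps)
  qed
  moreover have "\<Inter>(range K) = {z \<in> closure G. \<phi> z = w0}"
  proof (intro equalityI subsetI)
    fix z assume z: "z \<in> \<Inter>(range K)"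
    then have zc: "z \<in> closure G" using sub[of 0] closure_mono unfolding K_def by blast
    have "dist (\<phi> z) w0 \<le> 1 / real (Suc n)" for n
    proof -
      have "closure (\<psi> ` B n) \<subseteq> closure G" using sub closure_mono by blast
      then have "\<phi> ` closure (\<psi> ` B n) \<subseteq> closure (\<phi> ` \<psi> ` B n)"
        by (intro continuous_image_closure_subset[OF cont_phi])
      also have "\<phi> ` \<psi> ` B n \<subseteq> cball w0 (1 / real (Suc n))" using \<psi>(3) by (force simp: B_def)
      then have "closure (\<phi> ` \<psi> ` B n) \<subseteq> cball w0 (1 / real (Suc n))" by (simp add: closure_minimal)
      finally have "\<phi> ` closure (\<psi> ` B n) \<subseteq> cball w0 (1 / real (Suc n))" .
      moreover have "z \<in> closure (\<psi> ` B n)" using z by (auto simp: K_def)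
      ultimately have "\<phi> z \<in> cball w0 (1 / real (Suc n))" by blast
      then show ?thesis by (simp add: dist_commute)
    qed
    then have "dist (\<phi> z) w0 \<le> 0"
      by (intro LIMSEQ_le_const[OF LIMSEQ_inverse_real_of_nat]) (auto simp: inverse_eq_divide)
    then show "z \<in> {z \<in> closure G. \<phi> z = w0}" using zc by simp
  next
    fix z assume z: "z \<in> {z \<in> closure G. \<phi> z = w0}"
    obtain X where X: "\<And>n. X n \<in> G" "X \<longlonglongrightarrow> z" using z unfolding closure_sequential by auto
    have lim: "(\<lambda>n. \<phi> (X n)) \<longlonglongrightarrow> w0"
      using continuous_on_tendsto_compose[OF cont_phi X(2)] z X(1) closure_subset[of G]
      by (auto intro!: always_eventually)
    show "z \<in> \<Inter>(range K)"
    proof (rule InterI)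
      fix A assume "A \<in> range K"
      then obtain n where A: "A = K n" by auto
      have "\<forall>\<^sub>F m in sequentially. dist (\<phi> (X m)) w0 < 1 / real (Suc n)" using lim by (rule tendstoD) simp
      then have "\<forall>\<^sub>F m in sequentially. X m \<in> K n"
      proof eventually_elim
        case (elim m)
        have "\<phi> (X m) \<in> ball 0 R" using X(1) bij_phi by (auto simp: bij_betw_def)
        then have "\<phi> (X m) \<in> B n" using elim by (auto simp: B_def dist_commute)
        then have "\<psi> (\<phi> (X m)) \<in> \<psi> ` B n" by (rule imageI)
        then have "X m \<in> \<psi> ` B n" using \<psi>(2)[OF X(1)] by simp
        then show ?case unfolding K_def by (rule subsetD[OF closure_subset])
      qed
      then show "z \<in> A" unfolding A K_def by (intro Lim_in_closed_set[OF closed_closure _ _ X(2)]) auto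
    qed
  qed
  ultimately show ?thesis by simp
qed

text \<open>The modulus separates \<open>G\<close> from the curve and \<phi> is injective in
  \<open>G\<close>, so a coincidence can only concern two points of the curve. Their fibre contains
  an arc, and \<phi> minus its constant value there vanishes on the frontier near an inner point of
  the arc. This would force a zero in \<open>G\<close>, where the modulus of \<phi> is below
  \<open>R\<close>.\<close>

lemma inj_phi_closure: "inj_on \<phi> (closure G)"
proof (rule inj_onI, rule ccontr)
  fix a b assume ab: "a \<in> closure G" "b \<in> closure G" "\<phi> a = \<phi> b" "a \<noteq> b"
  have inG: "norm (\<phi> z) < R" if "z \<in> G" for z using that bij_phi by (auto simp: bij_betw_def)
  have "a \<in> path_image \<gamma> \<and> b \<in> path_image \<gamma>"
    using ab closure_G inG phi_frontier bij_phi unfolding bij_betw_def inj_on_def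
    by (metis Un_iff less_irrefl)
  then have w0: "norm (\<phi> a) = R" and ap: "a \<in> path_image \<gamma>" using phi_frontier by auto
  define Z where "Z = {z \<in> closure G. \<phi> z = \<phi> a}"
  have "closed Z" unfolding Z_def
    by (intro continuous_closed_preimage_constant cont_phi) auto
  moreover have "Z \<subseteq> path_image \<gamma>" unfolding Z_def using closure_G inG w0 by force
  moreover have "connected Z" "a \<in> Z" "b \<in> Z" using connected_fibre[OF w0] ab by (simp_all add: Z_def)
  ultimately obtain p q where pq: "0 \<le> p" "p < q" "q \<le> 1" "\<gamma> ` {p..q} \<subseteq> Z"
    using ab(4) by (metis connected_subset_simple_loop_contains_arc[OF simple loop])
  define m where "m = (p + q) / 2"
  have m: "p < m" "m < q" using pq by (auto simp: m_def)
  have contg: "continuous_on {0..1} \<gamma>" using simple by (simp add: simple_path_def path_def)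
  \<comment> \<open>\<open>?C\<close> is the rest of the curve. It is closed and misses the point
    \<open>\<gamma> m\<close>, so near that point the frontier of \<open>G\<close> consists of
    points of the arc only.\<close>
  let ?C = "\<gamma> ` {0..p} \<union> \<gamma> ` {q..1}"
  have "closed ?C"
    using pq by (intro closed_Un compact_imp_closed compact_continuous_image continuous_on_subset[OF contg]) auto
  moreover have "\<gamma> m \<notin> ?C"
  proof
    assume "\<gamma> m \<in> ?C"
    then obtain x where x: "x \<in> {0..p} \<union> {q..1}" "\<gamma> m = \<gamma> x" by blast
    have "m \<in> {0..1}" "x \<in> {0..1}" using x(1) m pq by auto
    then have "m = x \<or> m = 0 \<or> m = 1"
      using simple x(2) unfolding simple_path_def loop_free_def by blast
    then show False using x(1) m pq by auto
  qed
  ultimately obtain d where d: "d > 0" "ball (\<gamma> m) d \<inter> ?C = {}"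
    by (metis ComplI Compl_disjoint2 disjoint_eq_subset_Compl open_Compl open_contains_ball_eq)
  have mL: "\<gamma> m \<in> path_image \<gamma>" using m pq by (auto simp: path_image_def)
  obtain z where z: "z \<in> G" "\<phi> z - \<phi> a = 0"
  proof (rule holomorphic_zero_if_zero_near_frontier_point[of G "\<lambda>z. \<phi> z - \<phi> a" "\<gamma> m" d])
    show "open G" by (rule open_G)
    show "(\<lambda>z. \<phi> z - \<phi> a) holomorphic_on G" by (intro holomorphic_intros hol_phi)
    show "continuous_on (closure G) (\<lambda>z. \<phi> z - \<phi> a)" by (intro continuous_intros cont_phi)
    show "\<gamma> m \<in> closure G" using mL closure_G by auto
    show "\<gamma> m \<in> closure (- closure G)" using mL by (rule frontier_G_outside)
    show "0 < d" by fact
    fix z assume "z \<in> frontier G" "dist z (\<gamma> m) < d"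
    then have "z \<in> path_image \<gamma>" "z \<in> ball (\<gamma> m) d" using frontier_G by (auto simp: dist_commute)
    moreover from this(2) have "z \<notin> ?C" using d(2) by blast
    ultimately have "z \<in> \<gamma> ` {p..q}" unfolding path_image_def by force
    then show "\<phi> z - \<phi> a = 0" using pq(4) by (auto simp: Z_def)
  qed
  then show False using inG[OF z(1)] w0 by simp
qed

text \<open>The factor e is a rotation that makes the starting points of the two boundary curves agree.\<close>

lemma disk_parametrization:
  obtains \<Psi> e where "norm e = 1" "continuous_on (cball 0 1) \<Psi>" "\<Psi> holomorphic_on ball 0 1"
    "bij_betw \<Psi> (cball 0 1) (closure G)" "bij_betw \<Psi> (ball 0 1) G"
    "bij_betw \<Psi> (sphere 0 1) (path_image \<gamma>)"
    "\<And>w. w \<in> cball 0 1 \<Longrightarrow> \<phi> (\<Psi> w) = of_real R * e * w" "\<Psi> 1 = \<gamma> 0"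
proof -
  have imc: "\<phi> ` closure G = cball 0 R"
  proof
    have "\<phi> ` closure G \<subseteq> closure (\<phi> ` G)" using cont_phi by (simp add: image_closure_subset closure_subset)
    then show "\<phi> ` closure G \<subseteq> cball 0 R" using bij_phi R_pos by (simp add: bij_betw_def)
    have "compact (\<phi> ` closure G)" using cont_phi bounded_G by (intro compact_continuous_image) (auto simp: compact_closure)
    then have "closure (\<phi> ` G) \<subseteq> \<phi> ` closure G" by (intro closure_minimal image_mono closure_subset compact_imp_closed)
    then show "cball 0 R \<subseteq> \<phi> ` closure G" using bij_phi R_pos by (simp add: bij_betw_def)
  qed
  define \<psi> where "\<psi> = inv_into (closure G) \<phi>"
  have \<psi>1: "\<psi> (\<phi> z) = z" if "z \<in> closure G" for z using that inj_phi_closure by (simp add: \<psi>_def)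
  have \<psi>2: "\<psi> w \<in> closure G \<and> \<phi> (\<psi> w) = w" if "w \<in> cball 0 R" for w
    unfolding \<psi>_def using that imc by (metis f_inv_into_f inv_into_into)
  have contp: "continuous_on (cball 0 R) \<psi>"
    using continuous_on_inv[OF cont_phi _, of \<psi>] \<psi>1 imc bounded_G by (simp add: compact_closure)
  have holp: "\<psi> holomorphic_on ball 0 R"
  proof -
    obtain g where g: "g holomorphic_on ball 0 R" "\<And>z. z \<in> G \<Longrightarrow> g (\<phi> z) = z"
      "\<And>w. w \<in> ball 0 R \<Longrightarrow> g w \<in> G \<and> \<phi> (g w) = w" using inverse_on_disk by metis
    have "g w = \<psi> w" if "w \<in> ball 0 R" for w using g(3)[OF that] \<psi>1 closure_subset by (metis subsetD)
    then show ?thesis by (rule holomorphic_transform[OF g(1)])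
  qed
  have g0: "\<gamma> 0 \<in> path_image \<gamma>" by (auto simp: path_image_def)
  define e where "e = \<phi> (\<gamma> 0) / of_real R"
  have e: "norm e = 1" using phi_frontier[OF g0] R_pos by (simp add: e_def norm_divide)
  have e0: "e \<noteq> 0" using e by auto
  define \<Psi> where "\<Psi> w = \<psi> (of_real R * e * w)" for w
  have nrm: "norm (of_real R * e * w) = R * norm w" for w using e R_pos by (simp add: norm_mult)
  have Pphi: "\<phi> (\<Psi> w) = of_real R * e * w" if "w \<in> cball 0 1" for w
    unfolding \<Psi>_def using \<psi>2[of "of_real R * e * w"] nrm[of w] that R_pos by (simp add: mult_left_le)
  have Pin: "\<Psi> w \<in> closure G" if "w \<in> cball 0 1" for w
    unfolding \<Psi>_def using \<psi>2[of "of_real R * e * w"] nrm[of w] that R_pos by (simp add: mult_left_le)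
  have inv: "\<Psi> (\<phi> z / (of_real R * e)) = z" "norm (\<phi> z / (of_real R * e)) = norm (\<phi> z) / R" if "z \<in> closure G" for z
    using \<psi>1[OF that] e0 R_pos e by (auto simp: \<Psi>_def norm_divide norm_mult)
  have inj: "inj_on \<Psi> (cball 0 1)"
    by (rule inj_on_inverseI[where g = "\<lambda>z. \<phi> z / (of_real R * e)"]) (use Pphi e0 R_pos in auto)
  \<comment> \<open>One statement for all sets \<open>A\<close> of moduli: everything for the closed
    disk, \<open>{..<1}\<close> for the open disk, \<open>{1}\<close> for the circle.\<close>
  have surj: "\<Psi> ` {w \<in> cball 0 1. norm w \<in> A} = {z \<in> closure G. norm (\<phi> z) / R \<in> A}" for A
  proof (intro equalityI subsetI)
    fix z assume z: "z \<in> {z \<in> closure G. norm (\<phi> z) / R \<in> A}"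
    then have "norm (\<phi> z) / R \<le> 1" using imc R_pos by (auto simp: divide_simps)
    then show "z \<in> \<Psi> ` {w \<in> cball 0 1. norm w \<in> A}"
      using inv[of z] z by (intro image_eqI[of z \<Psi> "\<phi> z / (of_real R * e)"]) auto
  qed (use Pphi Pin nrm R_pos in auto)
  have Gc: "{z \<in> closure G. norm (\<phi> z) / R \<in> {..<1}} = G"
    using closure_G phi_frontier bij_phi R_pos by (fastforce simp: bij_betw_def)
  have Lc: "{z \<in> closure G. norm (\<phi> z) / R \<in> {1}} = path_image \<gamma>"
    using closure_G phi_frontier bij_phi R_pos by (fastforce simp: bij_betw_def)
  show ?thesis
  proof (rule that[of e \<Psi>])
    show "norm e = 1" by fact
    show "continuous_on (cball 0 1) \<Psi>" unfolding \<Psi>_def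
      by (intro continuous_on_compose2[OF contp] continuous_intros) (use nrm R_pos in \<open>auto simp: mult_left_le\<close>)
    show "\<Psi> holomorphic_on ball 0 1"
    proof -
      have "(\<psi> \<circ> (\<lambda>w. of_real R * e * w)) holomorphic_on ball 0 1"
        by (rule holomorphic_on_compose_gen[OF _ holp]) (use nrm R_pos in \<open>auto intro!: holomorphic_intros\<close>)
      then show ?thesis by (simp add: o_def \<Psi>_def[abs_def])
    qed
    show "bij_betw \<Psi> (cball 0 1) (closure G)"
    proof -
      have "{w \<in> cball 0 1. norm w \<in> UNIV} = (cball 0 1 :: complex set)" by auto
      then show ?thesis using inj surj[of UNIV] by (simp add: bij_betw_def)
    qed
    have "{w \<in> cball 0 1. norm w \<in> {..<1}} = (ball 0 1 :: complex set)" by auto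
    then show "bij_betw \<Psi> (ball 0 1) G"
      using inj surj[of "{..<1}"] Gc by (auto simp: bij_betw_def intro: inj_on_subset)
    have "{w \<in> cball 0 1. norm w \<in> {1}} = (sphere 0 1 :: complex set)" by auto
    then show "bij_betw \<Psi> (sphere 0 1) (path_image \<gamma>)"
      using inj surj[of "{1}"] Lc by (auto simp: bij_betw_def intro: inj_on_subset)
    show "\<phi> (\<Psi> w) = of_real R * e * w" if "w \<in> cball 0 1" for w using Pphi[OF that] .
    show "\<Psi> 1 = \<gamma> 0" using g0 closure_G \<psi>1 R_pos by (simp add: \<Psi>_def e_def)
  qed
qed

end

section \<open>Curve length\<close>

lemma inscribed_lengthsI:
  "mono t \<Longrightarrow> (\<And>i. t i \<in> {a..b}) \<Longrightarrow> (\<Sum>i<n. dist (\<gamma> (t i)) (\<gamma> (t (Suc i)))) \<in> inscribed_lengths \<gamma> a b"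
  unfolding inscribed_lengths_def by blast

lemma inscribed_lengthsE:
  assumes "s \<in> inscribed_lengths \<gamma> a b"
  obtains n t where "mono t" "\<And>i. t i \<in> {a..b}" "s = (\<Sum>i<n. dist (\<gamma> (t i)) (\<gamma> (t (Suc i))))"
  using assms unfolding inscribed_lengths_def by blast

lemma zero_in_inscribed_lengths: "a \<le> b \<Longrightarrow> 0 \<in> inscribed_lengths \<gamma> a b"
  unfolding inscribed_lengths_def
  by (rule CollectI, rule exI[of _ 0], rule exI[of _ "\<lambda>_. a"]) (auto simp: mono_def)

lemma inscribed_lengths_cong:
  assumes "\<And>t. t \<in> {a..b} \<Longrightarrow> \<gamma> t = \<gamma>' t"
  shows "inscribed_lengths \<gamma> a b = inscribed_lengths \<gamma>' a b"
proof -
  have "s \<in> inscribed_lengths \<delta>' a b"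
    if "s \<in> inscribed_lengths \<delta> a b" "\<And>t. t \<in> {a..b} \<Longrightarrow> \<delta> t = \<delta>' t" for s and \<delta> \<delta>' :: "real \<Rightarrow> complex"
    using that(1)
  proof (rule inscribed_lengthsE)
    fix n :: nat and t :: "nat \<Rightarrow> real"
    assume "mono t" "\<And>i. t i \<in> {a..b}" "s = (\<Sum>i<n. dist (\<delta> (t i)) (\<delta> (t (Suc i))))"
    then show ?thesis using that(2) inscribed_lengthsI[where t = t and a = a and b = b and n = n and \<gamma> = \<delta>'] by simp
  qed
  then show ?thesis using assms by (metis subsetI subset_antisym)
qed

lemma inscribed_lengths_compose:
  assumes im: "T ` {c..d} \<subseteq> {a..b}" and mono: "mono_on {c..d} T \<or> antimono_on {c..d} T"
  shows "inscribed_lengths (\<lambda>t. \<gamma> (T t)) c d \<subseteq> inscribed_lengths \<gamma> a b"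
proof
  fix s assume "s \<in> inscribed_lengths (\<lambda>t. \<gamma> (T t)) c d"
  then obtain n :: nat and t :: "nat \<Rightarrow> real" where t: "mono t" "\<And>i. t i \<in> {c..d}" "s = (\<Sum>i<n. dist (\<gamma> (T (t i))) (\<gamma> (T (t (Suc i)))))"
    by (blast elim: inscribed_lengthsE)
  note tin = t(2)
  have tm: "t i \<le> t j" if "i \<le> j" for i j using t(1) that by (simp add: monoD)
  from mono show "s \<in> inscribed_lengths \<gamma> a b"
  proof
    assume m: "mono_on {c..d} T"
    have "mono (\<lambda>i. T (t i))" using m tin tm by (intro monoI) (auto intro: mono_onD)
    moreover have "T (t i) \<in> {a..b}" for i using im tin by blast
    ultimately show ?thesis unfolding t(3) by (rule inscribed_lengthsI)
  next
    assume m: "antimono_on {c..d} T"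
    \<comment> \<open>Truncated subtraction makes \<open>u\<close> constant from index
      \<open>n\<close> on, so the reversed partition is again monotone over all natural
      numbers.\<close>
    define u where "u i = T (t (n - i))" for i
    have "mono u" unfolding u_def using m tin tm by (intro monoI) (auto intro: monotone_onD)
    moreover have "u i \<in> {a..b}" for i using im tin unfolding u_def by blast
    moreover have "s = (\<Sum>i<n. dist (\<gamma> (u i)) (\<gamma> (u (Suc i))))"
    proof -
      have "(\<Sum>i<n. dist (\<gamma> (u i)) (\<gamma> (u (Suc i)))) = (\<Sum>i<n. dist (\<gamma> (T (t (Suc (n - Suc i))))) (\<gamma> (T (t (n - Suc i)))))"
        unfolding u_def by (intro sum.cong refl) (simp add: Suc_diff_Suc)
      also have "\<dots> = (\<Sum>i<n. dist (\<gamma> (T (t (Suc i)))) (\<gamma> (T (t i))))" by (rule sum.nat_diff_reindex)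
      finally show ?thesis unfolding t(3) by (simp add: dist_commute)
    qed
    ultimately show ?thesis using inscribed_lengthsI[of u] by simp
  qed
qed

lemma inscribed_lengths_reparametrize:
  assumes bij: "bij_betw T {c..d} {a..b}" and mono: "mono_on {c..d} T \<or> antimono_on {c..d} T"
  shows "inscribed_lengths (\<lambda>t. \<gamma> (T t)) c d = inscribed_lengths \<gamma> a b"
proof
  show "inscribed_lengths (\<lambda>t. \<gamma> (T t)) c d \<subseteq> inscribed_lengths \<gamma> a b"
    using bij mono by (intro inscribed_lengths_compose) (auto simp: bij_betw_def)
  define S where "S = inv_into {c..d} T"
  have S: "S y \<in> {c..d} \<and> T (S y) = y" if "y \<in> {a..b}" for y
    unfolding S_def using bij that by (metis bij_betw_imp_surj_on f_inv_into_f inv_into_into)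
  have S2: "S (T x) = x" if "x \<in> {c..d}" for x
    unfolding S_def using bij that by (simp add: bij_betw_inv_into_left)
  have "mono_on {a..b} S \<or> antimono_on {a..b} S"
    using mono
  proof
    assume m: "mono_on {c..d} T"
    have "S x \<le> S y" if "x \<in> {a..b}" "y \<in> {a..b}" "x \<le> y" for x y
    proof (rule ccontr)
      assume "\<not> S x \<le> S y"
      then have "T (S y) \<le> T (S x)" using m S that by (intro mono_onD[OF m]) auto
      then have "x = y" using S that by auto
      then show False using \<open>\<not> S x \<le> S y\<close> by simp
    qed
    then show ?thesis by (auto intro!: mono_onI)
  next
    assume m: "antimono_on {c..d} T"
    have "S y \<le> S x" if "x \<in> {a..b}" "y \<in> {a..b}" "x \<le> y" for x y
    proof (rule ccontr)
      assume "\<not> S y \<le> S x"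
      then have "T (S y) \<le> T (S x)" using S that by (intro monotone_onD[OF m]) auto
      then have "x = y" using S that by auto
      then show False using \<open>\<not> S y \<le> S x\<close> by simp
    qed
    then show ?thesis by (auto intro!: monotone_onI)
  qed
  then have "inscribed_lengths (\<lambda>t. \<gamma> (T (S t))) a b \<subseteq> inscribed_lengths (\<lambda>t. \<gamma> (T t)) c d"
    using S by (intro inscribed_lengths_compose) auto
  moreover have "inscribed_lengths (\<lambda>t. \<gamma> (T (S t))) a b = inscribed_lengths \<gamma> a b"
    using S by (intro inscribed_lengths_cong) simp
  ultimately show "inscribed_lengths \<gamma> a b \<subseteq> inscribed_lengths (\<lambda>t. \<gamma> (T t)) c d" by simp
qed

lemma inscribed_lengths_concat:
  assumes "s1 \<in> inscribed_lengths \<gamma> a b" "s2 \<in> inscribed_lengths \<gamma> b c"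
  obtains s where "s \<in> inscribed_lengths \<gamma> a c" "s1 + s2 \<le> s"
proof -
  obtain n1 :: nat and t1 :: "nat \<Rightarrow> real" where t1: "mono t1" "\<And>i. t1 i \<in> {a..b}" "s1 = (\<Sum>i<n1. dist (\<gamma> (t1 i)) (\<gamma> (t1 (Suc i))))"
    using assms(1) by (blast elim: inscribed_lengthsE)
  obtain n2 :: nat and t2 :: "nat \<Rightarrow> real" where t2: "mono t2" "\<And>i. t2 i \<in> {b..c}" "s2 = (\<Sum>i<n2. dist (\<gamma> (t2 i)) (\<gamma> (t2 (Suc i))))"
    using assms(2) by (blast elim: inscribed_lengthsE)
  have i1: "a \<le> t1 i" "t1 i \<le> b" for i using t1(2) by auto
  have i2: "b \<le> t2 i" "t2 i \<le> c" for i using t2(2) by auto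
  \<comment> \<open>The second partition starts at index \<open>Suc n1\<close>. The segment that
    joins the last point of the first partition to the first point of the second only adds length,
    whence the inequality in the conclusion.\<close>
  define t where "t i = (if i \<le> n1 then t1 i else t2 (i - Suc n1))" for i
  have "mono t"
  proof (rule monoI)
    fix i j :: nat assume "i \<le> j"
    then show "t i \<le> t j"
      using monoD[OF t1(1), of i j] monoD[OF t2(1), of "i - Suc n1" "j - Suc n1"] i1(2)[of i] i2(1)[of "j - Suc n1"]
      by (auto simp: t_def diff_le_mono)
  qed
  moreover have "t i \<in> {a..c}" for i
    using i1[of i] i2[of "i - Suc n1"] i1[of 0] i2[of 0] by (auto simp: t_def)
  ultimately have "(\<Sum>i<Suc n1 + n2. dist (\<gamma> (t i)) (\<gamma> (t (Suc i)))) \<in> inscribed_lengths \<gamma> a c"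
    by (intro inscribed_lengthsI) blast+
  moreover have "s1 + s2 \<le> (\<Sum>i<Suc n1 + n2. dist (\<gamma> (t i)) (\<gamma> (t (Suc i))))"
  proof -
    have "(\<Sum>i<Suc n1 + n2. dist (\<gamma> (t i)) (\<gamma> (t (Suc i)))) =
        (\<Sum>i<Suc n1. dist (\<gamma> (t i)) (\<gamma> (t (Suc i)))) + (\<Sum>i<n2. dist (\<gamma> (t (Suc n1 + i))) (\<gamma> (t (Suc (Suc n1 + i)))))"
      by (induction n2) (simp_all add: algebra_simps)
    also have "(\<Sum>i<n2. dist (\<gamma> (t (Suc n1 + i))) (\<gamma> (t (Suc (Suc n1 + i))))) = s2"
      unfolding t2(3) by (intro sum.cong refl) (simp add: t_def)
    also have "(\<Sum>i<Suc n1. dist (\<gamma> (t i)) (\<gamma> (t (Suc i)))) = s1 + dist (\<gamma> (t n1)) (\<gamma> (t (Suc n1)))"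
      unfolding t1(3) by (simp add: t_def)
    finally show ?thesis by simp
  qed
  ultimately show ?thesis using that by blast
qed

lemma inscribed_lengths_split:
  assumes "s \<in> inscribed_lengths \<gamma> a c" "a \<le> b" "b \<le> c"
  obtains s1 s2 where "s1 \<in> inscribed_lengths \<gamma> a b" "s2 \<in> inscribed_lengths \<gamma> b c" "s \<le> s1 + s2"
proof -
  obtain n :: nat and t :: "nat \<Rightarrow> real" where t: "mono t" "\<And>i. t i \<in> {a..c}" "s = (\<Sum>i<n. dist (\<gamma> (t i)) (\<gamma> (t (Suc i))))"
    using assms(1) by (blast elim: inscribed_lengthsE)
  have i: "a \<le> t i" "t i \<le> c" for i using t(2) by auto
  have m: "t i \<le> t j" if "i \<le> j" for i j using t(1) that by (simp add: monoD)
  \<comment> \<open>The partition is clamped to each half. A segment that straddles \<open>b\<close>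
    is replaced by the two segments through \<open>\<gamma> b\<close>; every other segment survives
    in one half and degenerates in the other.\<close>
  let ?u = "\<lambda>i. min (t i) b" and ?v = "\<lambda>i. max (t i) b"
  have "mono ?u" "mono ?v" using m by (auto intro!: monoI min.mono max.mono)
  moreover have "?u i \<in> {a..b}" "?v i \<in> {b..c}" for i using i[of i] assms by auto
  ultimately have "(\<Sum>i<n. dist (\<gamma> (?u i)) (\<gamma> (?u (Suc i)))) \<in> inscribed_lengths \<gamma> a b"
    "(\<Sum>i<n. dist (\<gamma> (?v i)) (\<gamma> (?v (Suc i)))) \<in> inscribed_lengths \<gamma> b c"
    by (intro inscribed_lengthsI; blast)+
  moreover have "s \<le> (\<Sum>i<n. dist (\<gamma> (?u i)) (\<gamma> (?u (Suc i)))) + (\<Sum>i<n. dist (\<gamma> (?v i)) (\<gamma> (?v (Suc i))))"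
    unfolding t(3) sum.distrib[symmetric]
  proof (rule sum_mono)
    fix i
    show "dist (\<gamma> (t i)) (\<gamma> (t (Suc i))) \<le> dist (\<gamma> (?u i)) (\<gamma> (?u (Suc i))) + dist (\<gamma> (?v i)) (\<gamma> (?v (Suc i)))"
      using m[of i "Suc i"] dist_triangle[of "\<gamma> (t i)" "\<gamma> (t (Suc i))" "\<gamma> b"]
      by (cases "t (Suc i) \<le> b"; cases "t i \<le> b") auto
  qed
  ultimately show ?thesis using that by blast
qed

text \<open>The polygon is cut at \<open>P\<close>; the part beyond is translated back by one period
  and put in front of the rest. Polygons that start anywhere on a closed curve are thus bounded by
  the length measured from 0.\<close>

lemma inscribed_length_periodic:
  assumes per: "\<And>\<theta>. X (\<theta> + P) = X \<theta>" and \<alpha>: "0 \<le> \<alpha>" "\<alpha> \<le> P"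
    and s: "s \<in> inscribed_lengths X \<alpha> (\<alpha> + P)" and bdd: "bdd_above (inscribed_lengths X 0 P)"
  shows "s \<le> curve_length X 0 P"
proof -
  obtain s1 s2 where s12: "s1 \<in> inscribed_lengths X \<alpha> P" "s2 \<in> inscribed_lengths X P (\<alpha> + P)" "s \<le> s1 + s2"
    by (rule inscribed_lengths_split[OF s, of P]) (use \<alpha> in auto)
  have "inscribed_lengths (\<lambda>t. X (t - P)) P (\<alpha> + P) \<subseteq> inscribed_lengths X 0 \<alpha>"
    by (intro inscribed_lengths_compose) (auto intro!: mono_onI)
  moreover have "(\<lambda>t. X (t - P)) = X"
  proof
    show "X (t - P) = X t" for t using per[of "t - P"] by simp
  qed
  ultimately have s2: "s2 \<in> inscribed_lengths X 0 \<alpha>" using s12(2) by auto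
  obtain s' where "s' \<in> inscribed_lengths X 0 P" "s2 + s1 \<le> s'"
    using inscribed_lengths_concat[OF s2 s12(1)] by blast
  moreover from this(1) have "s' \<le> curve_length X 0 P" unfolding curve_length_def by (intro cSup_upper bdd)
  ultimately show ?thesis using s12(3) by linarith
qed

text \<open>Multiplying each function by the constant that makes its value at the fixed point
  \<open>w\<close> real and nonnegative turns the sum of moduli at \<open>w\<close> into the value
  of one holomorphic function, to which the maximum principle applies.\<close>

lemma sum_norm_maximum_principle:
  fixes f :: "'i \<Rightarrow> complex \<Rightarrow> complex"
  assumes hol: "\<And>i. i \<in> I \<Longrightarrow> f i holomorphic_on ball 0 1" and cont: "\<And>i. i \<in> I \<Longrightarrow> continuous_on (cball 0 1) (f i)"
    and bound: "\<And>w. norm w = 1 \<Longrightarrow> (\<Sum>i\<in>I. norm (f i w)) \<le> B" and w: "norm w \<le> 1"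
  shows "(\<Sum>i\<in>I. norm (f i w)) \<le> B"
proof -
  define c where "c i = cnj (sgn (f i w))" for i
  have c1: "norm (c i) \<le> 1" for i by (simp add: c_def norm_sgn)
  have "c i * f i w = of_real (norm (f i w))" for i
  proof (cases "f i w = 0")
    case False
    have "c i * f i w = cnj (f i w) * f i w / of_real (norm (f i w))"
      by (simp add: c_def sgn_eq)
    also have "cnj (f i w) * f i w = of_real (norm (f i w)) * of_real (norm (f i w))"
      using complex_norm_square[of "f i w"] by (simp add: power2_eq_square mult.commute)
    finally show ?thesis using False by simp
  qed simp
  then have e: "(\<Sum>i\<in>I. c i * f i w) = of_real (\<Sum>i\<in>I. norm (f i w))" by simp
  have "(\<Sum>i\<in>I. norm (f i w)) = norm (\<Sum>i\<in>I. c i * f i w)"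
    unfolding e norm_of_real by (simp add: sum_nonneg)
  also have "\<dots> \<le> B"
  proof (rule maximum_modulus_frontier[of "\<lambda>w. \<Sum>i\<in>I. c i * f i w" "cball 0 1"])
    show "(\<lambda>w. \<Sum>i\<in>I. c i * f i w) holomorphic_on interior (cball 0 1)"
      using hol by (auto intro!: holomorphic_intros)
    show "continuous_on (closure (cball 0 1)) (\<lambda>w. \<Sum>i\<in>I. c i * f i w)"
      using cont by (auto intro!: continuous_intros)
    show "bounded (cball 0 1 :: complex set)" "w \<in> cball 0 1" using w by auto
    fix z :: complex assume "z \<in> frontier (cball 0 1)"
    then have z: "norm z = 1" by simp
    have "norm (\<Sum>i\<in>I. c i * f i z) \<le> (\<Sum>i\<in>I. 1 * norm (f i z))"
      by (rule sum_norm_le) (auto simp: norm_mult intro!: mult_left_le_one_le c1)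
    then show "norm (\<Sum>i\<in>I. c i * f i z) \<le> B" using bound[OF z] by simp
  qed
  finally show ?thesis .
qed

section \<open>Length of an absolutely continuous curve\<close>

lemma set_integral_combine:
  fixes f :: "real \<Rightarrow> 'a :: euclidean_space"
  assumes f: "set_integrable lborel {a..c} f" and "a \<le> b" "b \<le> c"
  shows "(LINT s:{a..c}|lborel. f s) = (LINT s:{a..b}|lborel. f s) + (LINT s:{b..c}|lborel. f s)"
proof -
  have "set_integrable lborel {a..b} f" "set_integrable lborel {b..c} f"
    using assms by (auto intro: set_integrable_subset[OF f])
  then show ?thesis using assms set_borel_integral_eq_integral[OF f]
    by (simp add: set_borel_integral_eq_integral(2) Henstock_Kurzweil_Integration.integral_combine)
qed

lemma set_integral_sum_partition:
  fixes f :: "real \<Rightarrow> 'a :: euclidean_space"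
  assumes f: "set_integrable lborel {c..d} f" and t: "mono t" "\<And>i. t i \<in> {c..d}"
  shows "(\<Sum>i<n. LINT s:{t i..t (Suc i)}|lborel. f s) = (LINT s:{t 0..t n}|lborel. f s)"
proof (induction n)
  case 0
  have "(\<lambda>s. indicator {t 0} s *\<^sub>R f s) = (\<lambda>s. indicator {t 0} s *\<^sub>R f (t 0))" by (auto simp: indicator_def)
  then show ?case by (simp add: set_lebesgue_integral_def)
next
  case (Suc n)
  have "set_integrable lborel {t 0..t (Suc n)} f"
    by (rule set_integrable_subset[OF f]) (use t(2)[of 0] t(2)[of "Suc n"] in auto)
  then show ?case using Suc set_integral_combine[of "t 0" "t (Suc n)" f "t n"] t(1) by (simp add: monoD)
qed

text \<open>Each chord is at most the integral of \<open>norm (y s)\<close> over its piece.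
  Conversely, on a fine partition \<open>y\<close> is close in the mean to a step function, for
  which the chord and the integral agree.\<close>

lemma absolutely_continuous_curve_length:
  fixes X y :: "real \<Rightarrow> complex"
  assumes cd: "c \<le> d" and y: "set_integrable lborel {c..d} y"
    and X: "\<And>u v. c \<le> u \<Longrightarrow> u \<le> v \<Longrightarrow> v \<le> d \<Longrightarrow> X v - X u = (LINT s:{u..v}|lborel. y s)"
    and approx: "\<And>\<epsilon>. \<epsilon> > 0 \<Longrightarrow> \<exists>g. continuous_on {c..d} g \<and> (LINT s:{c..d}|lborel. norm (y s - g s)) < \<epsilon>"
  shows "bdd_above (inscribed_lengths X c d)"
    and "curve_length X c d = (LINT s:{c..d}|lborel. norm (y s))"
proof -
  define L where "L = (LINT s:{c..d}|lborel. norm (y s))"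
  have yI: "set_integrable lborel {u..v} y" if "c \<le> u" "v \<le> d" for u v
    using that by (intro set_integrable_subset[OF y]) auto
  have ub: "s \<le> L" if s: "s \<in> inscribed_lengths X c d" for s
  proof -
    obtain n :: nat and t :: "nat \<Rightarrow> real" where t: "mono t" "\<And>i. t i \<in> {c..d}" "s = (\<Sum>i<n. dist (X (t i)) (X (t (Suc i))))"
      using s by (blast elim: inscribed_lengthsE)
    have i: "c \<le> t i" "t i \<le> d" for i using t(2)[of i] by auto
    have "s \<le> (\<Sum>i<n. LINT s:{t i..t (Suc i)}|lborel. norm (y s))"
      unfolding t(3)
    proof (rule sum_mono)
      fix j
      have "dist (X (t j)) (X (t (Suc j))) = norm (LINT s:{t j..t (Suc j)}|lborel. y s)"
        using X[of "t j" "t (Suc j)"] i t(1) by (metis dist_commute dist_norm incseq_SucD)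
      also have "\<dots> \<le> (LINT s:{t j..t (Suc j)}|lborel. norm (y s))"
        by (rule set_integral_norm_bound) (simp add: yI i)
      finally show "dist (X (t j)) (X (t (Suc j))) \<le> (LINT s:{t j..t (Suc j)}|lborel. norm (y s))" .
    qed
    also have "\<dots> = (LINT s:{t 0..t n}|lborel. norm (y s))"
      by (rule set_integral_sum_partition[OF set_integrable_norm[OF y] t(1,2)])
    also have "\<dots> \<le> L"
      unfolding L_def set_lebesgue_integral_def
      using set_integrable_norm[OF yI[OF i(1) i(2)], of 0 n] set_integrable_norm[OF y] i
      by (intro integral_mono) (auto simp: set_integrable_def indicator_def intro: order_trans)
    finally show ?thesis .
  qed
  then show bdd: "bdd_above (inscribed_lengths X c d)" by (auto simp: bdd_above_def)
  have le: "curve_length X c d \<le> L"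
    unfolding curve_length_def using ub zero_in_inscribed_lengths[OF cd] by (intro cSup_least) auto
  have "L \<le> curve_length X c d + \<epsilon>" if "\<epsilon> > 0" for \<epsilon>
  proof -
    \<comment> \<open>The total loss is \<open>2 * \<eta>\<close> from the mean distance to
      \<open>g\<close> and \<open>2 * \<eta> * (d - c)\<close> from the oscillation of
      \<open>g\<close> on the pieces; the denominator makes this \<epsilon>.\<close>
    define \<eta> where "\<eta> = \<epsilon> / (2 * (1 + (d - c)))"
    have eta: "\<eta> > 0" using that cd by (simp add: \<eta>_def)
    obtain g where g: "continuous_on {c..d} g" "(LINT s:{c..d}|lborel. norm (y s - g s)) < \<eta>"
      using approx[OF eta] by blast
    have "uniformly_continuous_on {c..d} g" using g(1) by (intro compact_uniformly_continuous) auto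
    then obtain \<delta> where \<delta>: "\<delta> > 0" "\<And>u v. u \<in> {c..d} \<Longrightarrow> v \<in> {c..d} \<Longrightarrow> dist v u < \<delta> \<Longrightarrow> dist (g v) (g u) < \<eta>"
      using eta unfolding uniformly_continuous_on_def by metis
    obtain N :: nat where N: "(d - c) / \<delta> < real N" using reals_Archimedean2 by blast
    then have "real N > 0" using cd \<delta>(1) by (smt (verit) divide_nonneg_pos)
    then have N0: "N > 0" by simp
    \<comment> \<open>\<open>min i N\<close> continues the equidistant partition by the constant
      \<open>d\<close>, since a partition is a monotone sequence over all natural numbers.\<close>
    define t where "t i = c + (d - c) * real (min i N) / real N" for i
    have tm: "mono t" unfolding t_def using cd by (intro monoI) (auto intro!: divide_right_mono mult_left_mono)
    have tr: "t i \<in> {c..d}" for i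
    proof -
      have "(d - c) * (real (min i N) / real N) \<le> (d - c) * 1" using cd N0 by (intro mult_left_mono) auto
      then show ?thesis using cd by (auto simp: t_def)
    qed
    have t0: "t 0 = c" "t N = d" using N0 by (simp_all add: t_def)
    have step: "t (Suc i) - t i < \<delta>" for i
    proof -
      have "t (Suc i) - t i = (d - c) / real N * (real (min (Suc i) N) - real (min i N))"
        using N0 by (simp add: t_def field_simps)
      also have "\<dots> \<le> (d - c) / real N * 1" using cd by (intro mult_left_mono) auto
      also have "\<dots> < \<delta>" using N \<delta>(1) N0 by (simp add: field_simps)
      finally show ?thesis .
    qed
    have gI: "set_integrable lborel {c..d} g" by (rule borel_integrable_atLeastAtMost'[OF g(1)])
    have gI': "set_integrable lborel {u..v} g" if "c \<le> u" "v \<le> d" for u v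
      using that by (intro set_integrable_subset[OF gI]) auto
    have cI: "set_integrable lborel {u..v} (\<lambda>s. k)" for u v :: real and k :: "'z::{banach,second_countable_topology}"
      using borel_integrable_atLeastAtMost'[OF continuous_on_const] by blast
    \<comment> \<open>With the constant \<open>g (t i)\<close> as intermediary, passing from
      \<open>y\<close> to the constant and from the constant to the chord of \<open>X\<close> costs
      the mean distance between \<open>y\<close> and the constant each time; hence the factors
      2.\<close>
    have key: "(LINT s:{t i..t (Suc i)}|lborel. norm (y s)) \<le> dist (X (t i)) (X (t (Suc i)))
        + 2 * (LINT s:{t i..t (Suc i)}|lborel. norm (y s - g s)) + 2 * \<eta> * (t (Suc i) - t i)" for i
    proof -
      let ?I = "{t i..t (Suc i)}" and ?k = "g (t i)"
      have tt: "c \<le> t i" "t i \<le> t (Suc i)" "t (Suc i) \<le> d" using tr[of i] tr[of "Suc i"] tm by (auto simp: monoD)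
      note I = yI[OF tt(1,3)] gI'[OF tt(1,3)] cI[of "t i" "t (Suc i)"]
      have m: "measure lborel ?I = t (Suc i) - t i" using tt by simp
      have A: "(LINT s:?I|lborel. norm (y s - ?k)) \<le> (LINT s:?I|lborel. norm (y s - g s)) + \<eta> * (t (Suc i) - t i)"
      proof -
        have "(LINT s:?I|lborel. norm (y s - ?k)) \<le> (LINT s:?I|lborel. norm (y s - g s) + \<eta>)"
        proof (rule set_integral_mono)
          show "set_integrable lborel ?I (\<lambda>s. norm (y s - ?k))" by (intro set_integrable_norm set_integral_diff I)
          show "set_integrable lborel ?I (\<lambda>s. norm (y s - g s) + \<eta>)" by (intro set_integral_add set_integrable_norm set_integral_diff I)
          fix s assume s: "s \<in> ?I"
          have "dist (g s) ?k < \<eta>" using s tt step[of i] by (intro \<delta>(2)) (auto simp: dist_real_def)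
          moreover have "norm (y s - ?k) \<le> norm (y s - g s) + norm (g s - ?k)" by (rule norm_triangle_sub[of "y s - ?k" "y s - g s", simplified, THEN order_trans]) (simp add: norm_minus_commute)
          ultimately show "norm (y s - ?k) \<le> norm (y s - g s) + \<eta>" by (simp add: dist_norm)
        qed
        also have "\<dots> = (LINT s:?I|lborel. norm (y s - g s)) + (LINT s:?I|lborel. \<eta>)"
          by (intro set_integral_add set_integrable_norm set_integral_diff I)
        also have "(LINT s:?I|lborel. \<eta>) = \<eta> * (t (Suc i) - t i)"
          using tt by (simp add: set_integral_const mult.commute)
        finally show ?thesis .
      qed
      have B: "(LINT s:?I|lborel. norm (y s)) \<le> (LINT s:?I|lborel. norm (y s - ?k)) + norm ?k * (t (Suc i) - t i)"
      proof -
        have "(LINT s:?I|lborel. norm (y s)) \<le> (LINT s:?I|lborel. norm (y s - ?k) + norm ?k)"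
        proof (rule set_integral_mono)
          show "set_integrable lborel ?I (\<lambda>s. norm (y s - ?k) + norm ?k)" by (intro set_integral_add set_integrable_norm set_integral_diff I)
          show "norm (y s) \<le> norm (y s - ?k) + norm ?k" for s by (metis diff_add_cancel norm_triangle_ineq)
        qed (intro set_integrable_norm I)
        also have "\<dots> = (LINT s:?I|lborel. norm (y s - ?k)) + (LINT s:?I|lborel. norm ?k)"
          by (intro set_integral_add set_integrable_norm set_integral_diff I)
        also have "(LINT s:?I|lborel. norm ?k) = norm ?k * (t (Suc i) - t i)"
          using tt by (simp add: set_integral_const mult.commute)
        finally show ?thesis .
      qed
      have C: "norm ?k * (t (Suc i) - t i) \<le> dist (X (t i)) (X (t (Suc i))) + (LINT s:?I|lborel. norm (y s - ?k))"
      proof -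
        have "(LINT s:?I|lborel. y s - ?k) = (LINT s:?I|lborel. y s) - (LINT s:?I|lborel. ?k)"
          by (intro set_integral_diff I)
        also have "(LINT s:?I|lborel. ?k) = (t (Suc i) - t i) *\<^sub>R ?k"
          using tt by (simp add: set_integral_const)
        finally have e: "(t (Suc i) - t i) *\<^sub>R ?k = (X (t (Suc i)) - X (t i)) - (LINT s:?I|lborel. y s - ?k)"
          using X[OF tt] by simp
        have "norm ?k * (t (Suc i) - t i) = norm ((t (Suc i) - t i) *\<^sub>R ?k)" using tt by simp
        also have "\<dots> \<le> norm (X (t (Suc i)) - X (t i)) + norm (LINT s:?I|lborel. y s - ?k)"
          unfolding e by (rule norm_triangle_ineq4)
        also have "norm (LINT s:?I|lborel. y s - ?k) \<le> (LINT s:?I|lborel. norm (y s - ?k))"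
          by (rule set_integral_norm_bound) (intro set_integral_diff I)
        finally show ?thesis by (simp add: dist_norm norm_minus_commute)
      qed
      from A B C show ?thesis by (simp add: algebra_simps)
    qed
    have "L = (\<Sum>i<N. LINT s:{t i..t (Suc i)}|lborel. norm (y s))"
      using set_integral_sum_partition[OF set_integrable_norm[OF y] tm tr, of N] t0 by (simp add: L_def)
    also have "\<dots> \<le> (\<Sum>i<N. dist (X (t i)) (X (t (Suc i)))
        + 2 * (LINT s:{t i..t (Suc i)}|lborel. norm (y s - g s)) + 2 * \<eta> * (t (Suc i) - t i))"
      by (intro sum_mono key)
    also have "\<dots> = (\<Sum>i<N. dist (X (t i)) (X (t (Suc i))))
        + 2 * (\<Sum>i<N. LINT s:{t i..t (Suc i)}|lborel. norm (y s - g s)) + 2 * \<eta> * (\<Sum>i<N. t (Suc i) - t i)"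
      by (simp add: sum.distrib sum_distrib_left)
    also have "(\<Sum>i<N. t (Suc i) - t i) = d - c" using sum_lessThan_telescope[of t N] t0 by simp
    also have "(\<Sum>i<N. LINT s:{t i..t (Suc i)}|lborel. norm (y s - g s)) = (LINT s:{c..d}|lborel. norm (y s - g s))"
      using set_integral_sum_partition[OF set_integrable_norm[OF set_integral_diff(1)[OF y gI]] tm tr, of N] t0 by simp
    also have "(\<Sum>i<N. dist (X (t i)) (X (t (Suc i)))) \<le> curve_length X c d"
      unfolding curve_length_def using tm tr by (intro cSup_upper bdd inscribed_lengthsI)
    also have "(LINT s:{c..d}|lborel. norm (y s - g s)) \<le> \<eta>" using g(2) by simp
    also have "curve_length X c d + 2 * \<eta> + 2 * \<eta> * (d - c) = curve_length X c d + \<epsilon>"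
    proof -
      have "2 * \<eta> + 2 * \<eta> * (d - c) = \<eta> * (2 * (1 + (d - c)))" by (simp add: algebra_simps)
      also have "\<dots> = \<epsilon>" unfolding \<eta>_def using cd by simp
      finally show ?thesis by simp
    qed
    finally show ?thesis by simp
  qed
  then have "L \<le> curve_length X c d" by (rule field_le_epsilon)
  with le show "curve_length X c d = (LINT s:{c..d}|lborel. norm (y s))" by (simp add: L_def)
qed

section \<open>Lengths of the images of concentric circles\<close>

lemma circle_increment:
  fixes \<Psi> :: "complex \<Rightarrow> complex"
  assumes hol: "\<Psi> holomorphic_on ball 0 1" and r: "0 \<le> r" "r < 1" and uv: "u \<le> v"
  shows "\<Psi> (of_real r * cis v) - \<Psi> (of_real r * cis u)
      = (LINT s:{u..v}|lborel. deriv \<Psi> (of_real r * cis s) * (of_real r * (\<i> * cis s)))"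
    and "continuous_on A (\<lambda>s. deriv \<Psi> (of_real r * cis s))"
proof -
  have inb: "of_real r * cis s \<in> ball 0 1" for s using r by (simp add: norm_mult)
  have hd: "deriv \<Psi> holomorphic_on ball 0 1" using hol by (intro holomorphic_deriv) auto
  show c: "continuous_on A (\<lambda>s. deriv \<Psi> (of_real r * cis s))" for A
    by (intro continuous_on_compose2[OF holomorphic_on_imp_continuous_on[OF hd]] continuous_intros) (use inb in auto)
  have "((\<lambda>s. \<Psi> (of_real r * cis s)) has_vector_derivative deriv \<Psi> (of_real r * cis s) * (of_real r * (\<i> * cis s))) (at s within {u..v})" for s
  proof -
    have d: "(\<Psi> has_field_derivative deriv \<Psi> (of_real r * cis s)) (at (of_real r * cis s))"
      using hol inb by (intro holomorphic_derivI) auto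
    have "((\<lambda>s. of_real r * exp (\<i> * of_real s)) has_vector_derivative of_real r * (\<i> * exp (\<i> * of_real s))) (at s within {u..v})"
    proof -
      have "((\<lambda>z. of_real r * exp (\<i> * z)) has_field_derivative of_real r * (\<i> * exp (\<i> * of_real s))) (at (of_real s))"
        by (auto intro!: derivative_eq_intros)
      then show ?thesis by (intro has_vector_derivative_real_field)
    qed
    then have "((\<lambda>s. of_real r * cis s) has_vector_derivative of_real r * (\<i> * cis s)) (at s within {u..v})"
      by (simp add: cis_conv_exp)
    from field_vector_diff_chain_within[OF this has_field_derivative_at_within[OF d]]
    show ?thesis by (simp add: o_def mult.commute)
  qed
  then have "((\<lambda>s. deriv \<Psi> (of_real r * cis s) * (of_real r * (\<i> * cis s))) has_integral
      \<Psi> (of_real r * cis v) - \<Psi> (of_real r * cis u)) {u..v}"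
    by (intro fundamental_theorem_of_calculus uv)
  moreover have "set_integrable lborel {u..v} (\<lambda>s. deriv \<Psi> (of_real r * cis s) * (of_real r * (\<i> * cis s)))"
    by (intro borel_integrable_atLeastAtMost' continuous_intros c)
  ultimately show "\<Psi> (of_real r * cis v) - \<Psi> (of_real r * cis u)
      = (LINT s:{u..v}|lborel. deriv \<Psi> (of_real r * cis s) * (of_real r * (\<i> * cis s)))"
    by (simp add: set_borel_integral_eq_integral(2) integral_unique)
qed

lemma cis_add_2pi: "cis (\<theta> + 2 * pi) = cis \<theta>"
  by (metis cis_2pi cis_mult mult_1_right)

text \<open>The length of a polygon inscribed in the image of the circle of radius \<open>r\<close>
  is a sum of moduli of functions that stay holomorphic when \<open>r\<close> is replaced by a
  complex \<open>w\<close>. The maximum principle moves the estimate to |w| = 1, where the polygon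
  is inscribed in the boundary curve, only with a rotated starting point.\<close>

lemma derivative_circle_mean_le_length:
  fixes \<Psi> :: "complex \<Rightarrow> complex"
  assumes cont: "continuous_on (cball 0 1) \<Psi>" and hol: "\<Psi> holomorphic_on ball 0 1"
    and bdd: "bdd_above (inscribed_lengths (\<lambda>\<theta>. \<Psi> (cis \<theta>)) 0 (2 * pi))" and r: "0 \<le> r" "r < 1"
  shows "r * (LINT s:{0..2*pi}|lborel. norm (deriv \<Psi> (of_real r * cis s))) \<le> curve_length (\<lambda>\<theta>. \<Psi> (cis \<theta>)) 0 (2 * pi)"
proof -
  let ?L = "curve_length (\<lambda>\<theta>. \<Psi> (cis \<theta>)) 0 (2 * pi)"
  let ?X = "\<lambda>\<theta>. \<Psi> (of_real r * cis \<theta>)"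
  let ?y = "\<lambda>s. deriv \<Psi> (of_real r * cis s) * (of_real r * (\<i> * cis s))"
  have yc: "continuous_on A ?y" for A by (intro continuous_intros circle_increment(2)[OF hol r order_refl])
  have yI: "set_integrable lborel {0..2*pi} ?y" by (intro borel_integrable_atLeastAtMost' yc)
  have ub: "s \<le> ?L" if s: "s \<in> inscribed_lengths ?X 0 (2 * pi)" for s
  proof -
    obtain n :: nat and t :: "nat \<Rightarrow> real" where t: "mono t" "\<And>i. t i \<in> {0..2*pi}" "s = (\<Sum>i<n. dist (?X (t i)) (?X (t (Suc i))))"
      using s by (blast elim: inscribed_lengthsE)
    define f where "f i w = \<Psi> (w * cis (t i)) - \<Psi> (w * cis (t (Suc i)))" for i w
    have P: "(\<lambda>w. \<Psi> (w * cis \<tau>)) holomorphic_on ball 0 1" "continuous_on (cball 0 1) (\<lambda>w. \<Psi> (w * cis \<tau>))" for \<tau>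
    proof -
      have "(\<Psi> \<circ> (\<lambda>w. w * cis \<tau>)) holomorphic_on ball 0 1"
        by (rule holomorphic_on_compose_gen[OF _ hol]) (auto simp: norm_mult intro!: holomorphic_intros)
      then show "(\<lambda>w. \<Psi> (w * cis \<tau>)) holomorphic_on ball 0 1" by (simp add: o_def)
      show "continuous_on (cball 0 1) (\<lambda>w. \<Psi> (w * cis \<tau>))"
        by (intro continuous_on_compose2[OF cont] continuous_intros) (auto simp: norm_mult)
    qed
    have "(\<Sum>i<n. norm (f i (of_real r))) \<le> ?L"
    proof (rule sum_norm_maximum_principle)
      show "f i holomorphic_on ball 0 1" for i unfolding f_def by (intro holomorphic_intros P)
      show "continuous_on (cball 0 1) (f i)" for i unfolding f_def by (intro continuous_intros P)
      show "norm (of_real r :: complex) \<le> 1" using r by simp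
      fix w :: complex assume w: "norm w = 1"
      define \<alpha> where "\<alpha> = Arg2pi w"
      have \<alpha>: "0 \<le> \<alpha>" "\<alpha> \<le> 2 * pi" "w = cis \<alpha>"
        using Arg2pi[of w] w by (auto simp: \<alpha>_def cis_conv_exp is_Arg_def)
      have "(\<Sum>i<n. norm (f i w)) = (\<Sum>i<n. dist (\<Psi> (cis (\<alpha> + t i))) (\<Psi> (cis (\<alpha> + t (Suc i)))))"
        by (simp add: f_def dist_norm \<alpha>(3) cis_mult)
      also have "\<dots> \<in> inscribed_lengths (\<lambda>\<theta>. \<Psi> (cis \<theta>)) \<alpha> (\<alpha> + 2 * pi)"
        by (rule inscribed_lengthsI) (use t(1,2) in \<open>auto simp: mono_def\<close>)
      finally show "(\<Sum>i<n. norm (f i w)) \<le> ?L"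
        using \<alpha> by (intro inscribed_length_periodic[OF _ _ _ _ bdd]) (auto simp: cis_add_2pi)
    qed
    then show ?thesis unfolding t(3) f_def dist_norm .
  qed
  have "(LINT s:{0..2*pi}|lborel. norm (?y s)) = curve_length ?X 0 (2 * pi)"
  proof (rule absolutely_continuous_curve_length(2)[symmetric])
    show "?X v - ?X u = (LINT s:{u..v}|lborel. ?y s)" if "u \<le> v" for u v by (rule circle_increment(1)[OF hol r that])
    show "\<exists>g. continuous_on {0..2 * pi} g \<and> (LINT s:{0..2 * pi}|lborel. norm (?y s - g s)) < \<epsilon>" if "\<epsilon> > 0" for \<epsilon>
      using yc[of "{0..2*pi}"] that by (intro exI[of _ ?y]) (simp add: set_lebesgue_integral_def)
  qed (use yI in auto)
  also have "\<dots> \<le> ?L"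
    unfolding curve_length_def[of ?X] using ub zero_in_inscribed_lengths[of 0 "2 * pi"] by (intro cSup_least) auto
  also have "(LINT s:{0..2*pi}|lborel. norm (?y s)) = r * (LINT s:{0..2*pi}|lborel. norm (deriv \<Psi> (of_real r * cis s)))"
    using r by (simp add: norm_mult set_lebesgue_integral_def mult_ac flip: integral_mult_right_zero)
  finally show ?thesis .
qed

section \<open>Boundary density of the derivative\<close>

lemma sums_set_integral_dominated:
  fixes f :: "nat \<Rightarrow> real \<Rightarrow> complex"
  assumes cont: "\<And>n. continuous_on {a..b} (f n)" and bound: "\<And>n s. s \<in> {a..b} \<Longrightarrow> norm (f n s) \<le> B n"
    and B: "summable B"
  shows "(\<lambda>n. LINT s:{a..b}|lborel. f n s) sums (LINT s:{a..b}|lborel. (\<Sum>n. f n s))"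
proof -
  let ?F = "\<lambda>n s. indicator {a..b} s *\<^sub>R f n s"
  have I: "integrable lborel (?F n)" for n
    using borel_integrable_atLeastAtMost'[OF cont[of n]] by (simp add: set_integrable_def)
  have nb: "norm (?F n s) \<le> norm (B n)" for n s
  proof (cases "s \<in> {a..b}")
    case True then show ?thesis using bound[OF True, of n] by simp
  qed simp
  have B0: "B n \<ge> 0" if "a \<le> b" for n using bound[of a n] that norm_ge_zero[of "f n a"] by (simp del: norm_ge_zero)
  have sm: "summable (\<lambda>n. norm (?F n s))" for s
  proof (cases "s \<in> {a..b}")
    case True
    then show ?thesis using bound[OF True] by (intro summable_comparison_test'[OF B, of 0]) simp
  qed simp
  have "(\<lambda>n. integral\<^sup>L lborel (?F n)) sums (\<integral>s. (\<Sum>n. ?F n s) \<partial>lborel)"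
  proof (rule sums_integral[OF I])
    show "AE s in lborel. summable (\<lambda>n. norm (?F n s))" using sm by simp
    show "summable (\<lambda>n. \<integral>s. norm (?F n s) \<partial>lborel)"
    proof (cases "a \<le> b")
      case True
      have le: "norm (\<integral>s. norm (?F n s) \<partial>lborel) \<le> B n * (b - a)" for n
      proof -
        have "norm (\<integral>s. norm (?F n s) \<partial>lborel) = (\<integral>s. norm (?F n s) \<partial>lborel)" by (simp add: integral_nonneg)
        also have "\<dots> \<le> (\<integral>s. indicator {a..b} s * B n \<partial>lborel)"
        proof (rule integral_mono)
          show "integrable lborel (\<lambda>s. norm (?F n s))" by (rule integrable_norm[OF I])
          show "integrable lborel (\<lambda>s. indicator {a..b} s * B n)"
            by (intro integrable_mult_left integrable_real_indicator) (auto simp: True)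
          show "norm (?F n s) \<le> indicator {a..b} s * B n" for s
            using bound[of s n] by (cases "s \<in> {a..b}") auto
        qed
        also have "\<dots> = B n * (b - a)" using True by simp
        finally show ?thesis .
      qed
      have "summable (\<lambda>n. B n * (b - a))" using B by (rule summable_mult2)
      then show ?thesis by (rule summable_comparison_test'[where N = 0]) (rule le)
    qed simp
  qed
  moreover have "(\<Sum>n. ?F n s) = indicator {a..b} s *\<^sub>R (\<Sum>n. f n s)" for s
    by (cases "s \<in> {a..b}") (simp_all add: indicator_def)
  ultimately show ?thesis by (simp add: set_lebesgue_integral_def)
qed

lemma set_integral_cis_multiple:
  "(LINT s:{0..2*pi}|lborel. cis (of_int k * s)) = (if k = 0 then of_real (2 * pi) else 0)"
proof (cases "k = 0")
  case True
  then show ?thesis by (simp add: set_integral_const scaleR_conv_of_real)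
next
  case False
  have "((\<lambda>s. cis (of_int k * s) / (\<i> * of_int k)) has_vector_derivative cis (of_int k * s)) (at s within {0..2*pi})" for s
  proof -
    have "((\<lambda>z. exp (\<i> * (of_int k * z)) / (\<i> * of_int k)) has_field_derivative exp (\<i> * (of_int k * of_real s))) (at (of_real s))"
      using False by (auto intro!: derivative_eq_intros) (simp add: mult.left_commute[of \<i> _ \<i>])
    then have "((\<lambda>s. exp (\<i> * (of_int k * of_real s)) / (\<i> * of_int k)) has_vector_derivative exp (\<i> * (of_int k * of_real s))) (at s within {0..2*pi})"
      by (intro has_vector_derivative_real_field)
    then show ?thesis by (simp add: cis_conv_exp)
  qed
  then have "((\<lambda>s. cis (of_int k * s)) has_integral
      cis (of_int k * (2 * pi)) / (\<i> * of_int k) - cis (of_int k * 0) / (\<i> * of_int k)) {0..2*pi}"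
    by (intro fundamental_theorem_of_calculus) auto
  moreover have "cis (of_int k * (2 * pi)) = 1"
    using cis_multiple_2pi[of "of_int k"] by (simp add: mult_ac)
  moreover have "set_integrable lborel {0..2*pi} (\<lambda>s. cis (of_int k * s))"
    by (intro borel_integrable_atLeastAtMost' continuous_intros)
  ultimately show ?thesis using False by (simp add: set_borel_integral_eq_integral(2) integral_unique)
qed

lemma fourier_coefficient:
  fixes c :: "nat \<Rightarrow> complex"
  assumes c: "summable (\<lambda>n. norm (c n))"
  shows "(LINT s:{0..2*pi}|lborel. cis (- (real m * s)) * (\<Sum>n. c n * cis (real n * s))) = of_real (2 * pi) * c m"
proof -
  let ?f = "\<lambda>n s. cis (- (real m * s)) * (c n * cis (real n * s))"
  have "(\<lambda>n. LINT s:{0..2*pi}|lborel. ?f n s) sums (LINT s:{0..2*pi}|lborel. (\<Sum>n. ?f n s))"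
    by (rule sums_set_integral_dominated[OF _ _ c]) (auto intro!: continuous_intros simp: norm_mult)
  moreover have "(LINT s:{0..2*pi}|lborel. ?f n s) = (if n = m then of_real (2 * pi) * c m else 0)" for n
  proof -
    have "?f n s = c n * cis (of_int (int n - int m) * s)" for s
      by (simp add: cis_mult algebra_simps)
    then have "(LINT s:{0..2*pi}|lborel. ?f n s) = c n * (LINT s:{0..2*pi}|lborel. cis (of_int (int n - int m) * s))"
      by (simp only: set_integral_mult_right)
    then show ?thesis unfolding set_integral_cis_multiple by simp
  qed
  ultimately have "(\<lambda>n. if n = m then of_real (2 * pi) * c m else 0) sums (LINT s:{0..2*pi}|lborel. (\<Sum>n. ?f n s))"
    by simp
  moreover have "(\<lambda>n. if n = m then of_real (2 * pi) * c m else 0) sums (of_real (2 * pi) * c m)"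
    using sums_single[of m "\<lambda>_. of_real (2 * pi) * c m"] by simp
  ultimately have e: "(LINT s:{0..2*pi}|lborel. (\<Sum>n. ?f n s)) = of_real (2 * pi) * c m" by (rule sums_unique2)
  have "summable (\<lambda>n. c n * cis (real n * s))" for s
    by (rule summable_norm_cancel) (use c in \<open>simp add: norm_mult\<close>)
  then have "(\<Sum>n. ?f n s) = cis (- (real m * s)) * (\<Sum>n. c n * cis (real n * s))" for s
    using suminf_mult[of "\<lambda>n. c n * cis (real n * s)" "cis (- (real m * s))"] by simp
  then show ?thesis using e by simp
qed

text \<open>Expanding the conjugate factor of |f|^2 and integrating termwise reduces the identity to
  the Fourier coefficients. It is applied on circles of radius below 1, where the coefficients are
  absolutely summable.\<close>

lemma parseval_disk:
  fixes c :: "nat \<Rightarrow> complex"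
  assumes c: "summable (\<lambda>n. norm (c n))"
  shows "(\<lambda>n. (norm (c n))\<^sup>2) sums ((LINT s:{0..2*pi}|lborel. (norm (\<Sum>n. c n * cis (real n * s)))\<^sup>2) / (2 * pi))"
proof -
  define f where "f s = (\<Sum>n. c n * cis (real n * s))" for s
  have sc2: "summable (\<lambda>n. norm (c n * cis (real n * s)))" for s
    using c by (simp add: norm_mult)
  note sc = summable_norm_cancel[OF sc2] sc2
  have fb: "norm (f s) \<le> (\<Sum>n. norm (c n))" for s
    unfolding f_def using summable_norm[OF sc(2)[of s]] by (simp add: norm_mult)
  have fc: "continuous_on A f" for A
  proof -
    have "uniform_limit A (\<lambda>n s. \<Sum>i<n. c i * cis (real i * s)) (\<lambda>s. \<Sum>i. c i * cis (real i * s)) sequentially"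
      by (rule Weierstrass_m_test[OF _ c]) (simp add: norm_mult)
    then show ?thesis unfolding f_def
      by (rule uniform_limit_theorem[rotated]) (auto intro!: always_eventually continuous_intros)
  qed
  let ?g = "\<lambda>n s. cnj (c n) * (cis (- (real n * s)) * f s)"
  have "(\<lambda>n. LINT s:{0..2*pi}|lborel. ?g n s) sums (LINT s:{0..2*pi}|lborel. (\<Sum>n. ?g n s))"
  proof (rule sums_set_integral_dominated)
    show "summable (\<lambda>n. norm (c n) * (\<Sum>n. norm (c n)))" using c by (rule summable_mult2)
    show "norm (?g n s) \<le> norm (c n) * (\<Sum>n. norm (c n))" for n s
      using fb[of s] by (simp add: norm_mult mult_left_mono)
  qed (intro continuous_intros fc)
  moreover have "(LINT s:{0..2*pi}|lborel. ?g n s) = of_real (2 * pi * (norm (c n))\<^sup>2)" for n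
  proof -
    have "(LINT s:{0..2*pi}|lborel. ?g n s) = cnj (c n) * (of_real (2 * pi) * c n)"
      using fourier_coefficient[OF c, of n] by (simp only: set_integral_mult_right f_def)
    also have "\<dots> = of_real (2 * pi) * (c n * cnj (c n))" by (simp only: mult_ac)
    finally show ?thesis by (simp only: complex_norm_square[symmetric] of_real_mult)
  qed
  moreover have "(\<Sum>n. ?g n s) = of_real ((norm (f s))\<^sup>2)" for s
  proof -
    have "(\<lambda>n. c n * cis (real n * s)) sums f s" unfolding f_def using sc(1) by (rule summable_sums)
    then have "(\<lambda>n. cnj (c n * cis (real n * s)) * f s) sums (cnj (f s) * f s)"
      by (intro sums_mult2) (simp only: sums_cnj)
    moreover have "cnj (c n * cis (real n * s)) * f s = ?g n s" for n
      by (simp only: complex_cnj_mult cis_cnj mult.assoc)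
    ultimately have "(\<lambda>n. ?g n s) sums (cnj (f s) * f s)" by (simp only:)
    then have "(\<Sum>n. ?g n s) = cnj (f s) * f s" by (rule sums_unique[symmetric])
    then show ?thesis by (simp only: complex_norm_square mult.commute)
  qed
  ultimately have "(\<lambda>n. complex_of_real (2 * pi * (norm (c n))\<^sup>2)) sums (LINT s:{0..2*pi}|lborel. complex_of_real ((norm (f s))\<^sup>2))"
    by simp
  also have "(LINT s:{0..2*pi}|lborel. complex_of_real ((norm (f s))\<^sup>2)) = of_real (LINT s:{0..2*pi}|lborel. (norm (f s))\<^sup>2)"
    by (rule set_integral_complex_of_real)
  finally have "(\<lambda>n. 2 * pi * (norm (c n))\<^sup>2) sums (LINT s:{0..2*pi}|lborel. (norm (f s))\<^sup>2)"
    by (simp only: sums_of_real_iff)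
  from sums_divide[OF this, of "2 * pi"] show ?thesis by (simp add: f_def)
qed

lemma disk_power_series:
  assumes "q holomorphic_on ball 0 1"
  obtains a :: "nat \<Rightarrow> complex" where "\<And>r. 0 \<le> r \<Longrightarrow> r < 1 \<Longrightarrow> summable (\<lambda>n. norm (a n * of_real (r ^ n)))"
    "\<And>r s. 0 \<le> r \<Longrightarrow> r < 1 \<Longrightarrow> q (of_real r * cis s) = (\<Sum>n. a n * of_real (r ^ n) * cis (real n * s))"
    "a 0 = q 0"
proof -
  define a where "a n = (deriv ^^ n) q 0 / fact n" for n
  have s: "(\<lambda>n. a n * w ^ n) sums q w" if "w \<in> ball 0 1" for w
    using holomorphic_power_series[OF assms that] by (simp add: a_def)
  show ?thesis
  proof (rule that[of a])
    fix r s :: real assume r: "0 \<le> r" "r < 1"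
    \<comment> \<open>Convergence at a radius strictly between \<open>r\<close> and 1 gives absolute
      convergence at \<open>r\<close>.\<close>
    have "of_real ((r + 1) / 2) \<in> (ball 0 1 :: complex set)" using r by (simp add: norm_divide)
    then have "summable (\<lambda>n. a n * of_real ((r + 1) / 2) ^ n)" using s sums_summable by blast
    then have "summable (\<lambda>n. norm (a n * of_real r ^ n))"
      by (rule powser_insidea) (use r in simp)
    then show "summable (\<lambda>n. norm (a n * of_real (r ^ n)))" by simp
    have "of_real r * cis s \<in> ball 0 1" using r by (simp add: norm_mult)
    from sums_unique[OF s[OF this]] show "q (of_real r * cis s) = (\<Sum>n. a n * of_real (r ^ n) * cis (real n * s))"
      by (simp only: power_mult_distrib of_real_power Complex.DeMoivre mult.assoc)
  next
    show "a 0 = q 0" by (simp add: a_def)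
  qed
qed

text \<open>By Parseval the bound on the means makes the squares of the Taylor coefficients
  summable. The difference of two circle restrictions has coefficients
  \<open>a n * (r ^ n - \<rho> ^ n)\<close>: their tail is small by summability, and the finitely
  many others are small because both powers are close to 1.\<close>

lemma hardy2_cauchy:
  assumes q: "q holomorphic_on ball 0 1"
    and bound: "\<And>r. 1 / 2 \<le> r \<Longrightarrow> r < 1 \<Longrightarrow> (LINT s:{0..2*pi}|lborel. (norm (q (of_real r * cis s)))\<^sup>2) \<le> B"
    and eps: "\<epsilon> > 0"
  obtains r0 where "1 / 2 \<le> r0" "r0 < 1" "\<And>r \<rho>. r0 < r \<Longrightarrow> r < 1 \<Longrightarrow> r0 < \<rho> \<Longrightarrow> \<rho> < 1 \<Longrightarrow>
     (LINT s:{0..2*pi}|lborel. (norm (q (of_real r * cis s) - q (of_real \<rho> * cis s)))\<^sup>2) \<le> \<epsilon>"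
proof -
  obtain a :: "nat \<Rightarrow> complex" where a: "\<And>r. 0 \<le> r \<Longrightarrow> r < 1 \<Longrightarrow> summable (\<lambda>n. norm (a n * of_real (r ^ n)))"
    "\<And>r s. 0 \<le> r \<Longrightarrow> r < 1 \<Longrightarrow> q (of_real r * cis s) = (\<Sum>n. a n * of_real (r ^ n) * cis (real n * s))"
    by (rule disk_power_series[OF q]) blast
  have part: "(\<Sum>n<N. (norm (a n))\<^sup>2) \<le> B / (2 * pi)" for N
  proof -
    have "(\<Sum>n<N. (norm (a n * of_real (r ^ n)))\<^sup>2) \<le> B / (2 * pi)" if r: "1 / 2 \<le> r" "r < 1" for r
    proof -
      have "(\<lambda>n. (norm (a n * of_real (r ^ n)))\<^sup>2) sums ((LINT s:{0..2*pi}|lborel. (norm (q (of_real r * cis s)))\<^sup>2) / (2 * pi))"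
        using parseval_disk[OF a(1)[of r]] a(2)[of r] r by simp
      then have "(\<Sum>n<N. (norm (a n * of_real (r ^ n)))\<^sup>2) \<le> (LINT s:{0..2*pi}|lborel. (norm (q (of_real r * cis s)))\<^sup>2) / (2 * pi)"
        by (metis (no_types, lifting) finite_lessThan sum_le_suminf sums_summable sums_unique zero_le_power2)
      also have "\<dots> \<le> B / (2 * pi)" using bound[OF r] by (intro divide_right_mono) auto
      finally show ?thesis .
    qed
    then have ev: "eventually (\<lambda>r. (\<Sum>n<N. (norm (a n * of_real (r ^ n)))\<^sup>2) \<le> B / (2 * pi)) (at_left 1)"
      using eventually_at_left[of "1/2" "1::real"] by (auto intro!: exI[of _ "1/2"])
    have "((\<lambda>r. \<Sum>n<N. (norm (a n * complex_of_real (r ^ n)))\<^sup>2) \<longlongrightarrow> (\<Sum>n<N. (norm (a n * complex_of_real (1 ^ n)))\<^sup>2)) (at_left 1)"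
      by (intro tendsto_intros)
    then have "(\<Sum>n<N. (norm (a n * complex_of_real (1 ^ n)))\<^sup>2) \<le> B / (2 * pi)"
      by (rule tendsto_upperbound[OF _ ev]) simp
    then show ?thesis by simp
  qed
  have sa: "summable (\<lambda>n. (norm (a n))\<^sup>2)"
    by (rule summableI_nonneg_bounded[of _ "B / (2 * pi)"]) (use part in auto)
  define S where "S = (\<Sum>n. (norm (a n))\<^sup>2)"
  have S0: "S \<ge> 0" unfolding S_def by (rule suminf_nonneg[OF sa]) simp
  \<comment> \<open>Head and tail get \<open>\<epsilon> / (4 * pi)\<close> each; Parseval's factor
    \<open>2 * pi\<close> turns their sum into \<epsilon>.\<close>
  obtain N where N: "norm (\<Sum>i. (norm (a (i + N)))\<^sup>2) < \<epsilon> / (4 * pi)"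
    using suminf_exist_split[OF _ sa, of "\<epsilon> / (4 * pi)"] eps by auto
  have "((\<lambda>r. S * (1 - r ^ N)\<^sup>2) \<longlongrightarrow> S * (1 - 1 ^ N)\<^sup>2) (at_left (1::real))" by (intro tendsto_intros)
  then have "eventually (\<lambda>r. S * (1 - r ^ N)\<^sup>2 < \<epsilon> / (4 * pi)) (at_left (1::real))"
    using eps by (intro order_tendstoD(2)) auto
  then obtain b where b: "b < 1" "\<And>r. b < r \<Longrightarrow> r < 1 \<Longrightarrow> S * (1 - r ^ N)\<^sup>2 < \<epsilon> / (4 * pi)"
    unfolding eventually_at_left[of 0 "1::real", OF zero_less_one] by auto
  define r0 where "r0 = max (1 / 2) ((b + 1) / 2)"
  have r0: "1 / 2 \<le> r0" "r0 < 1" "b < r0" using b(1) by (auto simp: r0_def less_max_iff_disj)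
  show ?thesis
  proof (rule that[OF r0(1,2)])
    fix r \<rho> assume r: "r0 < r" "r < 1" "r0 < \<rho>" "\<rho> < 1"
    then have r': "0 \<le> r" "0 \<le> \<rho>" using r0 by auto
    let ?c = "\<lambda>n. a n * of_real (r ^ n - \<rho> ^ n)"
    have ce: "?c n = a n * of_real (r ^ n) - a n * of_real (\<rho> ^ n)" for n by (simp add: algebra_simps)
    have sc: "summable (\<lambda>n. norm (?c n))"
      by (rule summable_comparison_test'[OF summable_add[OF a(1)[OF r'(1) r(2)] a(1)[OF r'(2) r(4)]], of 0])
         (simp only: ce real_norm_def abs_norm_cancel norm_triangle_ineq4)
    have qe: "q (of_real r * cis s) - q (of_real \<rho> * cis s) = (\<Sum>n. ?c n * cis (real n * s))" for s
    proof -
      have sm: "summable (\<lambda>n. a n * of_real (t ^ n) * cis (real n * s))" if "0 \<le> t" "t < 1" for t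
        by (rule summable_norm_cancel) (use a(1)[OF that] in \<open>simp add: norm_mult\<close>)
      show ?thesis unfolding a(2)[OF r'(1) r(2)] a(2)[OF r'(2) r(4)] ce
        by (subst suminf_diff[OF sm sm]) (use r r' in \<open>auto simp: algebra_simps\<close>)
    qed
    have sums: "(\<lambda>n. (norm (?c n))\<^sup>2) sums ((LINT s:{0..2*pi}|lborel. (norm (q (of_real r * cis s) - q (of_real \<rho> * cis s)))\<^sup>2) / (2 * pi))"
      using parseval_disk[OF sc] unfolding qe .
    have le1: "\<bar>r ^ n - \<rho> ^ n\<bar> \<le> 1" for n
      using power_le_one[OF r'(1), of n] power_le_one[OF r'(2), of n] r r' by (simp add: abs_le_iff) (smt (verit) zero_le_power)
    have leN: "\<bar>r ^ n - \<rho> ^ n\<bar> \<le> 1 - r0 ^ N" if "n < N" for n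
    proof -
      have "r0 ^ N \<le> r0 ^ n" using r0 that by (intro power_decreasing) auto
      moreover have "r0 ^ n \<le> r ^ n" "r0 ^ n \<le> \<rho> ^ n" using r r0 by (auto intro!: power_mono)
      moreover have "r ^ n \<le> 1" "\<rho> ^ n \<le> 1" using r r' by (auto intro!: power_le_one)
      ultimately show ?thesis by linarith
    qed
    have sumc: "summable (\<lambda>n. (norm (?c n))\<^sup>2)" using sums sums_summable by blast
    have "(\<Sum>n. (norm (?c n))\<^sup>2) = (\<Sum>n. (norm (?c (n + N)))\<^sup>2) + (\<Sum>n<N. (norm (?c n))\<^sup>2)"
      by (rule suminf_split_initial_segment[OF sumc])
    also have "(\<Sum>n. (norm (?c (n + N)))\<^sup>2) \<le> (\<Sum>n. (norm (a (n + N)))\<^sup>2)"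
    proof (rule suminf_le)
      fix n
      have "norm (?c (n + N)) \<le> norm (a (n + N))"
        using le1[of "n + N"] by (simp only: norm_mult norm_of_real) (simp add: mult_left_le)
      then show "(norm (?c (n + N)))\<^sup>2 \<le> (norm (a (n + N)))\<^sup>2" by (intro power_mono) auto
    qed (use summable_ignore_initial_segment[OF sumc, of N] summable_ignore_initial_segment[OF sa, of N] in auto)
    also have "\<dots> \<le> \<epsilon> / (4 * pi)" using N by simp
    also have "(\<Sum>n<N. (norm (?c n))\<^sup>2) \<le> (\<Sum>n<N. (norm (a n))\<^sup>2 * (1 - r0 ^ N)\<^sup>2)"
    proof (rule sum_mono)
      fix n assume "n \<in> {..<N}"
      then have "norm (?c n) \<le> norm (a n) * (1 - r0 ^ N)"
        using leN[of n] by (simp only: norm_mult norm_of_real) (simp add: mult_left_mono)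
      then have "(norm (?c n))\<^sup>2 \<le> (norm (a n) * (1 - r0 ^ N))\<^sup>2" by (intro power_mono) auto
      then show "(norm (?c n))\<^sup>2 \<le> (norm (a n))\<^sup>2 * (1 - r0 ^ N)\<^sup>2" by (simp only: power_mult_distrib)
    qed
    also have "\<dots> = (\<Sum>n<N. (norm (a n))\<^sup>2) * (1 - r0 ^ N)\<^sup>2" by (simp add: sum_distrib_right)
    also have "\<dots> \<le> S * (1 - r0 ^ N)\<^sup>2"
      unfolding S_def by (intro mult_right_mono sum_le_suminf sa) auto
    also have "\<dots> \<le> \<epsilon> / (4 * pi)" using b(2)[OF r0(3,2)] by simp
    finally have "(\<Sum>n. (norm (?c n))\<^sup>2) \<le> \<epsilon> / (2 * pi)" by simp
    then have "(LINT s:{0..2*pi}|lborel. (norm (q (of_real r * cis s) - q (of_real \<rho> * cis s)))\<^sup>2) / (2 * pi) \<le> \<epsilon> / (2 * pi)"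
      using sums_unique[OF sums] by simp
    then show "(LINT s:{0..2*pi}|lborel. (norm (q (of_real r * cis s) - q (of_real \<rho> * cis s)))\<^sup>2) \<le> \<epsilon>"
      by (simp add: divide_le_cancel)
  qed
qed

text \<open>The limit is \<open>u 0\<close> plus the telescoping series. Summable means of the
  increments make this series absolutely convergent almost everywhere, so the sequence itself
  converges pointwise, and the sum of the moduli dominates the remainders.\<close>

lemma L1_limit_of_fast_cauchy:
  fixes u :: "nat \<Rightarrow> 'a \<Rightarrow> complex"
  assumes u: "\<And>n. integrable M (u n)" and fast: "summable (\<lambda>n. \<integral>s. norm (u (Suc n) s - u n s) \<partial>M)"
  obtains x where "integrable M x" "AE s in M. (\<lambda>n. u n s) \<longlonglongrightarrow> x s" "(\<lambda>n. \<integral>s. norm (x s - u n s) \<partial>M) \<longlonglongrightarrow> 0"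
proof -
  let ?d = "\<lambda>n s. u (Suc n) s - u n s"
  have dI: "integrable M (?d n)" for n using u by simp
  have [measurable]: "?d n \<in> borel_measurable M" "u n \<in> borel_measurable M" for n using dI u by auto
  have "(\<integral>\<^sup>+ s. (\<Sum>n. ennreal (norm (?d n s))) \<partial>M) = (\<Sum>n. \<integral>\<^sup>+ s. ennreal (norm (?d n s)) \<partial>M)"
    by (intro nn_integral_suminf) auto
  also have "\<dots> = (\<Sum>n. ennreal (\<integral>s. norm (?d n s) \<partial>M))"
    by (intro suminf_cong nn_integral_eq_integral integrable_norm dI) auto
  also have "\<dots> = ennreal (\<Sum>n. \<integral>s. norm (?d n s) \<partial>M)"
    using fast by (intro suminf_ennreal2) auto
  finally have fin: "(\<integral>\<^sup>+ s. (\<Sum>n. ennreal (norm (?d n s))) \<partial>M) \<noteq> \<infinity>" by simp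
  have "AE s in M. (\<Sum>n. ennreal (norm (?d n s))) \<noteq> \<infinity>"
    by (rule nn_integral_PInf_AE[OF _ fin]) measurable
  then have AEs: "AE s in M. summable (\<lambda>n. norm (?d n s))"
    by eventually_elim (auto intro!: summable_suminf_not_top)
  define x where "x s = u 0 s + (\<Sum>n. ?d n s)" for s
  have AEs': "AE s in M. summable (\<lambda>n. norm (norm (?d n s)))" using AEs by simp
  have Wi: "integrable M (\<lambda>s. \<Sum>n. norm (?d n s))"
    using integrable_suminf[of M "\<lambda>n s. norm (?d n s)", OF _ AEs'] dI fast by simp
  have xI: "integrable M x" unfolding x_def
    by (intro Bochner_Integration.integrable_add u integrable_suminf[OF dI AEs fast])
  have tel: "u n s = u 0 s + (\<Sum>i<n. ?d i s)" for n s
    using sum_lessThan_telescope[of "\<lambda>i. u i s" n] by simp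
  have AEl: "AE s in M. (\<lambda>n. u n s) \<longlonglongrightarrow> x s"
    using AEs
  proof eventually_elim
    case (elim s)
    then have "(\<lambda>n. \<Sum>i<n. ?d i s) \<longlonglongrightarrow> (\<Sum>n. ?d n s)" by (rule summable_LIMSEQ[OF summable_norm_cancel])
    then have "(\<lambda>n. u 0 s + (\<Sum>i<n. ?d i s)) \<longlonglongrightarrow> x s" unfolding x_def by (intro tendsto_intros)
    then show ?case by (simp only: tel[symmetric])
  qed
  have "(\<lambda>n. \<integral>s. norm (x s - u n s) \<partial>M) \<longlonglongrightarrow> (\<integral>s. 0 \<partial>M)"
  proof (rule integral_dominated_convergence[where w = "\<lambda>s. \<Sum>n. norm (?d n s)"])
    show "integrable M (\<lambda>s. \<Sum>n. norm (?d n s))" by (rule Wi)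
    show "(\<lambda>s. norm (x s - u n s)) \<in> borel_measurable M" for n using xI by measurable
    show "AE s in M. (\<lambda>n. norm (x s - u n s)) \<longlonglongrightarrow> 0"
      using AEl by eventually_elim (auto intro!: tendsto_eq_intros)
    show "AE s in M. norm (norm (x s - u n s)) \<le> (\<Sum>n. norm (?d n s))" for n
      using AEs
    proof eventually_elim
      case (elim s)
      have sd: "summable (\<lambda>n. ?d n s)" using elim by (rule summable_norm_cancel)
      have "x s - u n s = (\<Sum>i. ?d (i + n) s)"
        using suminf_split_initial_segment[OF sd, of n] tel[of n s] by (simp add: x_def)
      also have "norm \<dots> \<le> (\<Sum>i. norm (?d (i + n) s))"
        using summable_ignore_initial_segment[OF elim, of n] by (intro summable_norm) simp
      also have "\<dots> \<le> (\<Sum>i. norm (?d i s))"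
        using suminf_split_initial_segment[OF elim, of n] by (simp add: sum_nonneg)
      finally show ?case by simp
    qed
  qed simp
  then show ?thesis using that xI AEl by simp
qed

text \<open>On the circle \<open>Ln (w / cis \<theta>)\<close> is \<i> times the signed angle
  \<open>\<tau> w\<close> from \<open>cis \<theta>\<close> to \<open>w\<close>. The quotient splits
  into the difference quotient of \<open>f\<close> in the angle and that of the logarithm;
  \<open>\<i> * cis \<theta>\<close> is the derivative of \<open>cis\<close> at \<theta>.\<close>

lemma has_vector_derivative_circle_imp_quotient:
  fixes f :: "complex \<Rightarrow> complex"
  assumes D: "((\<lambda>s. f (cis s)) has_vector_derivative D) (at \<theta>)"
  shows "((\<lambda>w. (f w - f (cis \<theta>)) / (w - cis \<theta>)) \<longlongrightarrow> D / (\<i> * cis \<theta>)) (at (cis \<theta>) within sphere 0 1)"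
proof -
  let ?w = "cis \<theta>" and ?F = "at (cis \<theta>) within sphere 0 1"
  define \<tau> where "\<tau> w = Im (Ln (w / ?w))" for w
  have nz: "?w \<noteq> 0" by simp
  have DL: "((\<lambda>w. Ln (w / ?w)) has_field_derivative 1 / ?w) (at ?w)"
    by (auto intro!: derivative_eq_intros)
  then have "((\<lambda>w. (Ln (w / ?w) - Ln (?w / ?w)) / (w - ?w)) \<longlongrightarrow> 1 / ?w) (at ?w)"
    by (simp add: has_field_derivative_iff)
  then have "((\<lambda>w. Ln (w / ?w) / (w - ?w)) \<longlongrightarrow> 1 / ?w) (at ?w)" by simp
  then have L: "((\<lambda>w. Ln (w / ?w) / (w - ?w)) \<longlongrightarrow> 1 / ?w) ?F"
    by (rule tendsto_within_subset[OF _ subset_UNIV])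
  have unit: "Ln (w / ?w) = \<i> * of_real (\<tau> w) \<and> w = cis (\<theta> + \<tau> w)" if "norm w = 1" for w
  proof -
    have n: "norm (w / ?w) = 1" "w / ?w \<noteq> 0" using that by (auto simp: norm_divide)
    then have "Re (Ln (w / ?w)) = 0" by (simp add: Re_Ln)
    then have l: "Ln (w / ?w) = \<i> * of_real (\<tau> w)" by (simp add: complex_eq_iff \<tau>_def)
    have "exp (Ln (w / ?w)) = w / ?w" using n(2) by simp
    then have "cis (\<tau> w) = w / ?w" unfolding l by (simp add: cis_conv_exp)
    then have "w = cis (\<theta> + \<tau> w)" by (simp add: cis_mult[symmetric] field_simps)
    with l show ?thesis by blast
  qed
  have "((\<lambda>w. Im (Ln (w / ?w))) \<longlongrightarrow> Im (Ln (?w / ?w))) (at ?w)"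
    using DERIV_isCont[OF DL] unfolding isCont_def by (rule tendsto_Im)
  then have "(\<tau> \<longlongrightarrow> 0) ?F"
    unfolding \<tau>_def using tendsto_within_subset[OF _ subset_UNIV] by fastforce
  then have "((\<lambda>w. \<theta> + \<tau> w) \<longlongrightarrow> \<theta>) ?F" by (auto intro!: tendsto_eq_intros)
  moreover have "\<forall>\<^sub>F w in ?F. \<theta> + \<tau> w \<noteq> \<theta>"
    unfolding eventually_at_filter
  proof (intro always_eventually allI impI)
    fix w assume w: "w \<noteq> ?w" "w \<in> sphere 0 1"
    then have "w = cis (\<theta> + \<tau> w)" using unit[of w] by simp
    then show "\<theta> + \<tau> w \<noteq> \<theta>" using w(1) by (metis add_cancel_left_right)
  qed
  ultimately have flt: "filterlim (\<lambda>w. \<theta> + \<tau> w) (at \<theta>) ?F" by (simp add: filterlim_at)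
  have "((\<lambda>y. (f (cis y) - f (cis \<theta>)) /\<^sub>R (y - \<theta>) - D) \<longlongrightarrow> 0) (at \<theta>)"
  proof (rule tendsto_norm_zero_cancel, rule Lim_transform_eventually)
    show "((\<lambda>y. norm (f (cis y) - f (cis \<theta>) - (y - \<theta>) *\<^sub>R D) / norm (y - \<theta>)) \<longlongrightarrow> 0) (at \<theta>)"
      using D unfolding has_vector_derivative_def has_derivative_iff_norm by blast
    show "\<forall>\<^sub>F y in at \<theta>. norm (f (cis y) - f (cis \<theta>) - (y - \<theta>) *\<^sub>R D) / norm (y - \<theta>)
        = norm ((f (cis y) - f (cis \<theta>)) /\<^sub>R (y - \<theta>) - D)"
      unfolding eventually_at_filter
    proof (intro always_eventually allI impI)
      fix y assume y: "y \<noteq> \<theta>"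
      then have "f (cis y) - f (cis \<theta>) - (y - \<theta>) *\<^sub>R D = (y - \<theta>) *\<^sub>R ((f (cis y) - f (cis \<theta>)) /\<^sub>R (y - \<theta>) - D)"
        by (simp add: scaleR_diff_right)
      then show "norm (f (cis y) - f (cis \<theta>) - (y - \<theta>) *\<^sub>R D) / norm (y - \<theta>)
          = norm ((f (cis y) - f (cis \<theta>)) /\<^sub>R (y - \<theta>) - D)" using y by simp
    qed
  qed
  then have "((\<lambda>y. (f (cis y) - f (cis \<theta>)) /\<^sub>R (y - \<theta>)) \<longlongrightarrow> D) (at \<theta>)" by (rule LIM_zero_cancel)
  from filterlim_compose[OF this flt]
  have "((\<lambda>w. (f (cis (\<theta> + \<tau> w)) - f (cis \<theta>)) /\<^sub>R \<tau> w) \<longlongrightarrow> D) ?F" by simp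
  from tendsto_divide[OF tendsto_mult[OF this L] tendsto_const complex_i_not_zero]
  have "((\<lambda>w. (f (cis (\<theta> + \<tau> w)) - f (cis \<theta>)) /\<^sub>R \<tau> w * (Ln (w / ?w) / (w - ?w)) / \<i>) \<longlongrightarrow> D * (1 / ?w) / \<i>) ?F" .
  moreover have "\<forall>\<^sub>F w in ?F. (f (cis (\<theta> + \<tau> w)) - f (cis \<theta>)) /\<^sub>R \<tau> w * (Ln (w / ?w) / (w - ?w)) / \<i> = (f w - f ?w) / (w - ?w)"
    unfolding eventually_at_filter
  proof (intro always_eventually allI impI)
    fix w assume w: "w \<noteq> ?w" "w \<in> sphere 0 1"
    then have "norm w = 1" by simp
    note u = unit[OF this]
    have t: "\<tau> w \<noteq> 0" using u w(1) by auto
    have gen: "(A /\<^sub>R t) * (\<i> * of_real t / B) / \<i> = A / B" if "t \<noteq> 0" for A B :: complex and t :: real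
      using that by (simp add: scaleR_conv_of_real divide_simps) (simp add: mult.left_commute[of \<i> _ \<i>])
    have "f (cis (\<theta> + \<tau> w)) = f w" using u by metis
    then show "(f (cis (\<theta> + \<tau> w)) - f (cis \<theta>)) /\<^sub>R \<tau> w * (Ln (w / ?w) / (w - ?w)) / \<i> = (f w - f ?w) / (w - ?w)"
      using gen[OF t, of "f w - f ?w" "w - ?w"] u by simp
  qed
  ultimately have "((\<lambda>w. (f w - f ?w) / (w - ?w)) \<longlongrightarrow> D * (1 / ?w) / \<i>) ?F"
    by (rule Lim_transform_eventually)
  moreover have "D * (1 / ?w) / \<i> = D / (\<i> * ?w)"
    by (simp only: times_divide_eq_right mult_1_right divide_divide_eq_left mult.commute)
  ultimately show ?thesis by simp
qed

text \<open>At a Lebesgue point the error of the linear approximation is the integral of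
  \<open>y s - y \<theta>\<close>, which is small relative to the increment. \<open>min\<close> and
  \<open>max\<close> treat increments to both sides at once.\<close>

lemma set_integral_signed_derivative:
  fixes X :: "real \<Rightarrow> complex"
  assumes y: "set_integrable lborel {a..b} y"
    and X: "\<And>u v. a \<le> u \<Longrightarrow> u \<le> v \<Longrightarrow> v \<le> b \<Longrightarrow> X v - X u = (LINT s:{u..v}|lborel. y s)"
    and \<theta>: "a < \<theta>" "\<theta> < b"
    and leb: "\<And>\<epsilon>. \<epsilon> > 0 \<Longrightarrow> \<exists>\<delta>>0. \<forall>v. \<bar>v - \<theta>\<bar> < \<delta> \<longrightarrow>
        (LINT s:{min \<theta> v..max \<theta> v}|lborel. norm (y s - y \<theta>)) \<le> \<epsilon> * \<bar>v - \<theta>\<bar>"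
  shows "(X has_vector_derivative y \<theta>) (at \<theta>)"
  unfolding has_vector_derivative_def has_derivative_at_alt
proof (intro conjI allI impI)
  show "bounded_linear (\<lambda>x. x *\<^sub>R y \<theta>)" by (rule bounded_linear_scaleR_left)
  fix e :: real assume "0 < e"
  then obtain \<delta> where \<delta>: "\<delta> > 0" "\<And>v. \<bar>v - \<theta>\<bar> < \<delta> \<Longrightarrow>
        (LINT s:{min \<theta> v..max \<theta> v}|lborel. norm (y s - y \<theta>)) \<le> e * \<bar>v - \<theta>\<bar>" using leb by blast
  define d where "d = min \<delta> (min (\<theta> - a) (b - \<theta>))"
  have "d > 0" using \<delta>(1) \<theta> by (simp add: d_def)
  moreover have "norm (X v - X \<theta> - (v - \<theta>) *\<^sub>R y \<theta>) \<le> e * norm (v - \<theta>)" if v: "norm (v - \<theta>) < d" for v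
  proof -
    let ?I = "{min \<theta> v..max \<theta> v}"
    have ab: "a \<le> min \<theta> v" "max \<theta> v \<le> b" using v \<theta> by (auto simp: d_def)
    have yI: "set_integrable lborel ?I y" using ab by (intro set_integrable_subset[OF y]) auto
    have cI: "set_integrable lborel ?I (\<lambda>s. y \<theta>)" using borel_integrable_atLeastAtMost'[OF continuous_on_const] by blast
    have "X (max \<theta> v) - X (min \<theta> v) - (max \<theta> v - min \<theta> v) *\<^sub>R y \<theta> = (LINT s:?I|lborel. y s) - (LINT s:?I|lborel. y \<theta>)"
      using X[of "min \<theta> v" "max \<theta> v"] ab by (simp add: set_integral_const)
    also have "\<dots> = (LINT s:?I|lborel. y s - y \<theta>)" by (rule set_integral_diff(2)[symmetric, OF yI cI])
    finally have e: "X (max \<theta> v) - X (min \<theta> v) - (max \<theta> v - min \<theta> v) *\<^sub>R y \<theta> = (LINT s:?I|lborel. y s - y \<theta>)" .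
    have "norm (X v - X \<theta> - (v - \<theta>) *\<^sub>R y \<theta>) = norm (X (max \<theta> v) - X (min \<theta> v) - (max \<theta> v - min \<theta> v) *\<^sub>R y \<theta>)"
    proof (cases "\<theta> \<le> v")
      case False
      have "X v - X \<theta> - (v - \<theta>) *\<^sub>R y \<theta> = - (X \<theta> - X v - (\<theta> - v) *\<^sub>R y \<theta>)" by (simp add: algebra_simps)
      then show ?thesis using False by (simp only: norm_minus_cancel max_def min_def if_False if_True)
    qed (simp add: max_def min_def)
    also have "\<dots> \<le> (LINT s:?I|lborel. norm (y s - y \<theta>))"
      unfolding e by (rule set_integral_norm_bound) (intro set_integral_diff yI cI)
    also have "\<dots> \<le> e * \<bar>v - \<theta>\<bar>" using v by (intro \<delta>(2)) (simp add: d_def)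
    finally show ?thesis by simp
  qed
  ultimately show "\<exists>d>0. \<forall>v. norm (v - \<theta>) < d \<longrightarrow> norm (X v - X \<theta> - (v - \<theta>) *\<^sub>R y \<theta>) \<le> e * norm (v - \<theta>)" by blast
qed

text \<open>Fatou's lemma makes the lower limit of \<open>u n\<close> integrable, hence finite
  almost everywhere. It is meant for the modulus of log |\<Psi>'|, to show that the boundary density
  of \<Psi>' is almost nowhere zero.\<close>

lemma finite_nn_bound_imp_AE_not_tendsto_infinity:
  fixes u :: "nat \<Rightarrow> 'a \<Rightarrow> real"
  assumes u: "\<And>n. integrable M (u n)" "\<And>n s. u n s \<ge> 0" and bound: "\<And>n. (\<integral>s. u n s \<partial>M) \<le> C"
  shows "AE s in M. \<not> filterlim (\<lambda>n. u n s) at_top sequentially"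
proof -
  have [measurable]: "u n \<in> borel_measurable M" for n using u(1) by auto
  have "(\<integral>\<^sup>+ s. liminf (\<lambda>n. ennreal (u n s)) \<partial>M) \<le> liminf (\<lambda>n. \<integral>\<^sup>+ s. ennreal (u n s) \<partial>M)"
    by (rule nn_integral_liminf) measurable
  also have "\<dots> \<le> liminf (\<lambda>n. ennreal C)"
    using bound u by (intro Liminf_mono always_eventually allI) (simp add: nn_integral_eq_integral ennreal_leI)
  also have "\<dots> = ennreal C" by (simp add: Liminf_const)
  finally have "(\<integral>\<^sup>+ s. liminf (\<lambda>n. ennreal (u n s)) \<partial>M) < \<infinity>"
    by (rule le_less_trans) simp
  then have "(\<integral>\<^sup>+ s. liminf (\<lambda>n. ennreal (u n s)) \<partial>M) \<noteq> \<infinity>" by simp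
  then have "AE s in M. liminf (\<lambda>n. ennreal (u n s)) \<noteq> \<infinity>"
    by (intro nn_integral_PInf_AE) measurable
  then show ?thesis
  proof eventually_elim
    case (elim s)
    show ?case
    proof
      assume "filterlim (\<lambda>n. u n s) at_top sequentially"
      then have "(\<lambda>n. ennreal (u n s)) \<longlonglongrightarrow> \<infinity>" by (simp add: ennreal_tendsto_top_eq_at_top)
      then have "liminf (\<lambda>n. ennreal (u n s)) = \<infinity>" by (intro lim_imp_Liminf) auto
      then show False using elim by simp
    qed
  qed
qed

lemma holomorphic_circle_mean:
  assumes "q holomorphic_on ball 0 1" "0 \<le> r" "r < 1"
  shows "(LINT s:{0..2*pi}|lborel. q (of_real r * cis s)) = of_real (2 * pi) * q 0"
proof -
  obtain a :: "nat \<Rightarrow> complex" where a: "\<And>r. 0 \<le> r \<Longrightarrow> r < 1 \<Longrightarrow> summable (\<lambda>n. norm (a n * of_real (r ^ n)))"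
    "\<And>r s. 0 \<le> r \<Longrightarrow> r < 1 \<Longrightarrow> q (of_real r * cis s) = (\<Sum>n. a n * of_real (r ^ n) * cis (real n * s))" "a 0 = q 0"
    by (rule disk_power_series[OF assms(1)]) blast
  show ?thesis using fourier_coefficient[OF a(1)[OF assms(2,3)], of 0] a(2)[OF assms(2,3)] a(3) by simp
qed

text \<open>Since the derivative has no zeros it is the square of a function in the Hardy class with
  exponent 2, whose circle restrictions converge in the mean by Parseval. Hence the restrictions
  of the derivative itself converge in the mean, without any appeal to the theory of the class
  with exponent 1. The limit is almost everywhere nonzero because the means of
  the logarithm of its modulus are constant.\<close>

lemma derivative_boundary_density:
  fixes \<Psi> k :: "complex \<Rightarrow> complex"
  assumes cont: "continuous_on (cball 0 1) \<Psi>" and hol: "\<Psi> holomorphic_on ball 0 1"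
    and k: "k holomorphic_on ball 0 1" "\<And>w. w \<in> ball 0 1 \<Longrightarrow> deriv \<Psi> w = exp (k w)"
    and bdd: "bdd_above (inscribed_lengths (\<lambda>\<theta>. \<Psi> (cis \<theta>)) 0 (2 * pi))"
  obtains x :: "real \<Rightarrow> complex" and r :: "nat \<Rightarrow> real" where
    "\<And>n. 0 \<le> r n" "\<And>n. r n < 1" "r \<longlonglongrightarrow> 1" "integrable lborel x" "\<And>s. s \<notin> {0..2*pi} \<Longrightarrow> x s = 0"
    "(\<lambda>n. LINT s:{0..2*pi}|lborel. norm (x s - deriv \<Psi> (of_real (r n) * cis s))) \<longlonglongrightarrow> 0"
    "AE s in lborel. s \<in> {0..2*pi} \<longrightarrow> (\<lambda>n. deriv \<Psi> (of_real (r n) * cis s)) \<longlonglongrightarrow> x s"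
    "AE s in lborel. s \<in> {0..2*pi} \<longrightarrow> x s \<noteq> 0"
    "\<And>u v. 0 \<le> u \<Longrightarrow> u \<le> v \<Longrightarrow> v \<le> 2 * pi \<Longrightarrow> \<Psi> (cis v) - \<Psi> (cis u) = (LINT s:{u..v}|lborel. x s * (\<i> * cis s))"
proof -
  define L where "L = curve_length (\<lambda>\<theta>. \<Psi> (cis \<theta>)) 0 (2 * pi)"
  let ?D = "\<lambda>r s. deriv \<Psi> (of_real r * cis s)"
  define q where "q w = exp (k w / 2)" for w
  let ?q = "\<lambda>r s. q (of_real r * cis s)"
  have qhol: "q holomorphic_on ball 0 1" unfolding q_def by (intro holomorphic_intros k) auto
  have inb: "of_real r * cis s \<in> ball 0 1" if "0 \<le> r" "r < 1" for r s using that by (simp add: norm_mult)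
  have qD: "?D r s = (?q r s)\<^sup>2" if "0 \<le> r" "r < 1" for r s
    using k(2)[OF inb[OF that]] by (simp add: q_def exp_double[symmetric])
  have Dc: "continuous_on A (?D r)" if "0 \<le> r" "r < 1" for r A by (rule circle_increment(2)[OF hol that order_refl])
  have qc: "continuous_on A (?q r)" if "0 \<le> r" "r < 1" for r A
    by (intro continuous_on_compose2[OF holomorphic_on_imp_continuous_on[OF qhol]] continuous_intros) (use inb that in auto)
  have L0: "L \<ge> 0" unfolding L_def curve_length_def
    by (rule cSup_upper[OF zero_in_inscribed_lengths bdd]) simp
  have B: "(LINT s:{0..2*pi}|lborel. norm (?D r s)) \<le> 2 * L" if r: "1 / 2 \<le> r" "r < 1" for r
  proof -
    let ?J = "LINT s:{0..2*pi}|lborel. norm (?D r s)"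
    have "r * ?J \<le> L" unfolding L_def by (rule derivative_circle_mean_le_length[OF cont hol bdd]) (use r in auto)
    moreover have "?J \<ge> 0" unfolding set_lebesgue_integral_def by (simp add: integral_nonneg)
    then have "1 / 2 * ?J \<le> r * ?J" using r by (intro mult_right_mono) auto
    ultimately show ?thesis by simp
  qed
  have Bq: "(LINT s:{0..2*pi}|lborel. (norm (?q r s))\<^sup>2) \<le> 2 * L" if r: "1 / 2 \<le> r" "r < 1" for r
    using B[OF r] qD[of r] r by (simp add: norm_power)
  have cI: "set_integrable lborel {0..2*pi} f" if "continuous_on {0..2*pi} f" for f :: "real \<Rightarrow> 'z::euclidean_space"
    using that by (rule borel_integrable_atLeastAtMost')
  have cauchy: "\<exists>r0. 1 / 2 \<le> r0 \<and> r0 < 1 \<and> (\<forall>r \<rho>. r0 < r \<longrightarrow> r < 1 \<longrightarrow> r0 < \<rho> \<longrightarrow> \<rho> < 1 \<longrightarrow>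
      (LINT s:{0..2*pi}|lborel. norm (?D r s - ?D \<rho> s)) \<le> \<epsilon>)" if eps: "\<epsilon> > 0" for \<epsilon>
  proof -
    \<comment> \<open>|q^2 - q'^2| = |q - q'| |q + q'| is split by the weighted inequality between
      the arithmetic and geometric mean with weight \<eta>. The tolerance
      \<open>\<eta> * \<epsilon>\<close> for the squared difference makes the first part at most
      \<epsilon>/2, and this \<eta> does the same for the second. The summand 1 keeps the
      denominator positive when \<open>L\<close> is 0.\<close>
    define \<eta> where "\<eta> = \<epsilon> / (8 * (L + 1))"
    have eta: "\<eta> > 0" using eps L0 by (simp add: \<eta>_def)
    have "\<exists>r0. 1 / 2 \<le> r0 \<and> r0 < 1 \<and> (\<forall>r \<rho>. r0 < r \<longrightarrow> r < 1 \<longrightarrow> r0 < \<rho> \<longrightarrow> \<rho> < 1 \<longrightarrow>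
        (LINT s:{0..2*pi}|lborel. (norm (?q r s - ?q \<rho> s))\<^sup>2) \<le> \<eta> * \<epsilon>)"
      by (rule hardy2_cauchy[OF qhol Bq mult_pos_pos[OF eta eps]]) blast+
    then obtain r0 where r0: "1 / 2 \<le> r0" "r0 < 1" "\<And>r \<rho>. r0 < r \<Longrightarrow> r < 1 \<Longrightarrow> r0 < \<rho> \<Longrightarrow> \<rho> < 1 \<Longrightarrow>
        (LINT s:{0..2*pi}|lborel. (norm (?q r s - ?q \<rho> s))\<^sup>2) \<le> \<eta> * \<epsilon>" by blast
    have "(LINT s:{0..2*pi}|lborel. norm (?D r s - ?D \<rho> s)) \<le> \<epsilon>" if r: "r0 < r" "r < 1" "r0 < \<rho>" "\<rho> < 1" for r \<rho>
    proof -
      have r': "0 \<le> r" "0 \<le> \<rho>" "1 / 2 \<le> r" "1 / 2 \<le> \<rho>" using r r0 by auto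
      let ?I1 = "LINT s:{0..2*pi}|lborel. (norm (?q r s - ?q \<rho> s))\<^sup>2"
      have "(LINT s:{0..2*pi}|lborel. norm (?D r s - ?D \<rho> s))
        \<le> (LINT s:{0..2*pi}|lborel. 1 / (2 * \<eta>) * (norm (?q r s - ?q \<rho> s))\<^sup>2 + \<eta> * ((norm (?q r s))\<^sup>2 + (norm (?q \<rho> s))\<^sup>2))"
      proof (rule set_integral_mono)
        show "set_integrable lborel {0..2*pi} (\<lambda>s. norm (?D r s - ?D \<rho> s))"
          by (intro cI continuous_intros Dc r' r)
        show "set_integrable lborel {0..2*pi} (\<lambda>s. 1 / (2 * \<eta>) * (norm (?q r s - ?q \<rho> s))\<^sup>2 + \<eta> * ((norm (?q r s))\<^sup>2 + (norm (?q \<rho> s))\<^sup>2))"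
          by (intro cI continuous_intros qc r' r)
        fix s
        let ?a = "norm (?q r s - ?q \<rho> s)" and ?b = "norm (?q r s + ?q \<rho> s)" and ?A = "norm (?q r s)" and ?B = "norm (?q \<rho> s)"
        have "norm (?D r s - ?D \<rho> s) = ?a * ?b"
          unfolding qD[OF r'(1) r(2)] qD[OF r'(2) r(4)] norm_mult[symmetric] by (simp add: power2_eq_square algebra_simps)
        also have "\<dots> \<le> ?a\<^sup>2 / (2 * \<eta>) + \<eta> / 2 * ?b\<^sup>2"
        proof -
          have "0 \<le> (?a - \<eta> * ?b)\<^sup>2 / (2 * \<eta>)" using eta by simp
          also have "\<dots> = ?a\<^sup>2 / (2 * \<eta>) + \<eta> / 2 * ?b\<^sup>2 - ?a * ?b"
            using eta by (simp add: power2_eq_square field_simps)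
          finally show ?thesis by simp
        qed
        also have "?b\<^sup>2 \<le> 2 * (?A\<^sup>2 + ?B\<^sup>2)"
        proof -
          have "?b\<^sup>2 \<le> (?A + ?B)\<^sup>2" by (intro power_mono norm_triangle_ineq) auto
          also have "\<dots> \<le> 2 * (?A\<^sup>2 + ?B\<^sup>2)" using zero_le_power2[of "?A - ?B"] by (simp add: power2_eq_square algebra_simps)
          finally show ?thesis .
        qed
        finally show "norm (?D r s - ?D \<rho> s) \<le> 1 / (2 * \<eta>) * ?a\<^sup>2 + \<eta> * (?A\<^sup>2 + ?B\<^sup>2)"
          using eta by (simp add: algebra_simps add_divide_distrib)
      qed
      also have "\<dots> = 1 / (2 * \<eta>) * ?I1 + \<eta> * ((LINT s:{0..2*pi}|lborel. (norm (?q r s))\<^sup>2) + (LINT s:{0..2*pi}|lborel. (norm (?q \<rho> s))\<^sup>2))"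
      proof -
        have i: "set_integrable lborel {0..2*pi} (\<lambda>s. (norm (?q r s - ?q \<rho> s))\<^sup>2)"
          "set_integrable lborel {0..2*pi} (\<lambda>s. (norm (?q r s))\<^sup>2)" "set_integrable lborel {0..2*pi} (\<lambda>s. (norm (?q \<rho> s))\<^sup>2)"
          by (intro cI continuous_intros qc r' r)+
        show ?thesis using i by (simp add: set_integral_add)
      qed
      also have "\<dots> \<le> 1 / (2 * \<eta>) * (\<eta> * \<epsilon>) + \<eta> * (2 * L + 2 * L)"
        using r0(3)[OF r] Bq[OF r'(3) r(2)] Bq[OF r'(4) r(4)] eta by (intro add_mono mult_left_mono) auto
      also have "\<dots> \<le> \<epsilon> / 2 + \<epsilon> / 2"
      proof (intro add_mono)
        have "\<eta> * (2 * L + 2 * L) \<le> \<eta> * (4 * (L + 1))" using eta by (intro mult_left_mono) auto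
        also have "\<dots> = \<epsilon> / 2" using L0 by (simp add: \<eta>_def field_simps)
        finally show "\<eta> * (2 * L + 2 * L) \<le> \<epsilon> / 2" .
      qed (use eta in simp)
      finally show ?thesis by simp
    qed
    then show ?thesis using r0(1,2) by blast
  qed
  then have "\<forall>n. \<exists>r0. 1 / 2 \<le> r0 \<and> r0 < 1 \<and> (\<forall>r \<rho>. r0 < r \<longrightarrow> r < 1 \<longrightarrow> r0 < \<rho> \<longrightarrow> \<rho> < 1 \<longrightarrow>
      (LINT s:{0..2*pi}|lborel. norm (?D r s - ?D \<rho> s)) \<le> (1 / 2) ^ n)" by simp
  from choice[OF this] obtain R0 where "\<forall>n. 1 / 2 \<le> R0 n \<and> R0 n < 1 \<and> (\<forall>r \<rho>. R0 n < r \<longrightarrow> r < 1 \<longrightarrow> R0 n < \<rho> \<longrightarrow> \<rho> < 1 \<longrightarrow>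
      (LINT s:{0..2*pi}|lborel. norm (?D r s - ?D \<rho> s)) \<le> (1 / 2) ^ n)" ..
  then have R0: "\<And>n. 1 / 2 \<le> R0 n" "\<And>n. R0 n < 1" "\<And>n r \<rho>. R0 n < r \<Longrightarrow> r < 1 \<Longrightarrow> R0 n < \<rho> \<Longrightarrow> \<rho> < 1 \<Longrightarrow>
      (LINT s:{0..2*pi}|lborel. norm (?D r s - ?D \<rho> s)) \<le> (1 / 2) ^ n"
    by blast+
  \<comment> \<open>The midpoint \<open>r n\<close> of \<open>m n\<close> and 1 lies above all the
    thresholds up to \<open>R0 n\<close>, so both \<open>r n\<close> and \<open>r (Suc n)\<close>
    are past \<open>R0 n\<close>. The second entry of the maximum forces convergence to 1.\<close>
  define m where "m n = max (Max (R0 ` {..n})) (1 - 1 / real (n + 2))" for n :: nat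
  define r where "r n = (1 + m n) / 2" for n
  have m1: "m n < 1" for n using R0(2) by (auto simp: m_def)
  have mR: "R0 i \<le> m n" if "i \<le> n" for i n
    unfolding m_def using that by (intro max.coboundedI1 Max_ge) auto
  have r1: "r n < 1" "m n < r n" for n using m1[of n] by (auto simp: r_def)
  have rh: "1 / 2 \<le> r n" for n using mR[of 0 n] R0(1)[of 0] r1(2)[of n] by simp
  have r0: "0 \<le> r n" for n using rh[of n] by simp
  have rlim: "r \<longlonglongrightarrow> 1"
  proof (rule tendsto_sandwich)
    show "\<forall>\<^sub>F n in sequentially. 1 - 1 / real (n + 2) \<le> r n"
      using r1(2) by (intro always_eventually allI) (smt (verit) m_def max.cobounded2)
    show "\<forall>\<^sub>F n in sequentially. r n \<le> 1" using r1(1) by (intro always_eventually allI less_imp_le)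
    show "(\<lambda>n. 1 - 1 / real (n + 2)) \<longlonglongrightarrow> 1" by real_asymp
  qed simp
  let ?M = "restrict_space lborel {0..2*pi}"
  have MI: "integrable ?M f \<longleftrightarrow> set_integrable lborel {0..2*pi} f" for f :: "real \<Rightarrow> 'z::euclidean_space"
    unfolding set_integrable_def by (rule integrable_restrict_space) simp
  have Mi: "integral\<^sup>L ?M f = (LINT s:{0..2*pi}|lborel. f s)" for f :: "real \<Rightarrow> 'z::euclidean_space"
    unfolding set_lebesgue_integral_def by (rule integral_restrict_space) simp
  have AEM: "(AE s in ?M. P s) \<longleftrightarrow> (AE s in lborel. s \<in> {0..2*pi} \<longrightarrow> P s)" for P
    by (rule AE_restrict_space_iff) simp
  have DI: "integrable ?M (?D (r n))" for n unfolding MI by (intro cI Dc r0 r1)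
  have "summable (\<lambda>n. \<integral>s. norm (?D (r (Suc n)) s - ?D (r n) s) \<partial>?M)"
  proof (rule summable_comparison_test'[of "\<lambda>n. (1/2::real) ^ n" 0])
    fix n :: nat
    have "R0 n < r n" "R0 n < r (Suc n)" using mR[of n n] mR[of n "Suc n"] r1(2)[of n] r1(2)[of "Suc n"] by auto
    then have "(\<integral>s. norm (?D (r (Suc n)) s - ?D (r n) s) \<partial>?M) \<le> (1/2) ^ n" unfolding Mi by (intro R0(3) r1)
    then show "norm (\<integral>s. norm (?D (r (Suc n)) s - ?D (r n) s) \<partial>?M) \<le> (1/2) ^ n" by (simp add: integral_nonneg)
  qed (simp add: summable_geometric)
  from L1_limit_of_fast_cauchy[OF DI this] obtain x0 where x0: "integrable ?M x0"
    "AE s in ?M. (\<lambda>n. ?D (r n) s) \<longlonglongrightarrow> x0 s" "(\<lambda>n. \<integral>s. norm (x0 s - ?D (r n) s) \<partial>?M) \<longlonglongrightarrow> 0" by blast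
  define x where "x s = indicator {0..2*pi} s *\<^sub>R x0 s" for s
  have xin: "x s = x0 s" if "s \<in> {0..2*pi}" for s using that by (simp add: x_def)
  have xI: "integrable lborel x" using x0(1) unfolding MI set_integrable_def x_def .
  have xsI: "set_integrable lborel {0..2*pi} x"
    unfolding set_integrable_def by (intro integrable_mult_indicator xI) simp
  have xlim: "(\<lambda>n. LINT s:{0..2*pi}|lborel. norm (x s - ?D (r n) s)) \<longlonglongrightarrow> 0"
  proof -
    have "(LINT s:{0..2*pi}|lborel. norm (x s - ?D (r n) s)) = (LINT s:{0..2*pi}|lborel. norm (x0 s - ?D (r n) s))" for n
      by (intro set_lebesgue_integral_cong) (auto simp: xin)
    then show ?thesis using x0(3) unfolding Mi by simp
  qed
  have xAE: "AE s in lborel. s \<in> {0..2*pi} \<longrightarrow> (\<lambda>n. ?D (r n) s) \<longlonglongrightarrow> x s"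
    using x0(2) unfolding AEM by eventually_elim (simp add: xin)
  \<comment> \<open>The mean of Re k over a circle is constant, and |t| is at most 2 exp t - t. So
    the means of |Re k| are bounded by those of |\<Psi>'| and this constant.\<close>
  have "AE s in ?M. \<not> filterlim (\<lambda>n. \<bar>Re (k (of_real (r n) * cis s))\<bar>) at_top sequentially"
  proof (rule finite_nn_bound_imp_AE_not_tendsto_infinity)
    have kc: "continuous_on A (\<lambda>s. k (of_real (r n) * cis s))" for n A
      by (intro continuous_on_compose2[OF holomorphic_on_imp_continuous_on[OF k(1)]] continuous_intros) (use inb r0 r1 in auto)
    show "integrable ?M (\<lambda>s. \<bar>Re (k (of_real (r n) * cis s))\<bar>)" for n
      unfolding MI by (intro cI continuous_intros kc)
    show "(\<integral>s. \<bar>Re (k (of_real (r n) * cis s))\<bar> \<partial>?M) \<le> 4 * L - 2 * pi * Re (k 0)" for n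
    proof -
      have kI: "set_integrable lborel {0..2*pi} (\<lambda>s. k (of_real (r n) * cis s))" by (intro cI kc)
      have "(LINT s:{0..2*pi}|lborel. \<bar>Re (k (of_real (r n) * cis s))\<bar>)
         \<le> (LINT s:{0..2*pi}|lborel. 2 * norm (?D (r n) s) - Re (k (of_real (r n) * cis s)))"
      proof (rule set_integral_mono)
        show "set_integrable lborel {0..2*pi} (\<lambda>s. \<bar>Re (k (of_real (r n) * cis s))\<bar>)" by (intro cI continuous_intros kc)
        show "set_integrable lborel {0..2*pi} (\<lambda>s. 2 * norm (?D (r n) s) - Re (k (of_real (r n) * cis s)))"
          by (intro cI continuous_intros kc Dc r0 r1)
        fix s
        have "norm (?D (r n) s) = exp (Re (k (of_real (r n) * cis s)))"
          using k(2)[OF inb[OF r0 r1(1), of n s]] by simp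
        moreover have "\<bar>t\<bar> \<le> 2 * exp t - t" for t :: real
          using exp_ge_add_one_self[of t] exp_gt_zero[of t] by linarith
        ultimately show "\<bar>Re (k (of_real (r n) * cis s))\<bar> \<le> 2 * norm (?D (r n) s) - Re (k (of_real (r n) * cis s))" by simp
      qed
      also have "\<dots> = 2 * (LINT s:{0..2*pi}|lborel. norm (?D (r n) s)) - (LINT s:{0..2*pi}|lborel. Re (k (of_real (r n) * cis s)))"
      proof -
        have i: "set_integrable lborel {0..2*pi} (\<lambda>s. norm (?D (r n) s))" "set_integrable lborel {0..2*pi} (\<lambda>s. Re (k (of_real (r n) * cis s)))"
          by (intro cI continuous_intros kc Dc r0 r1)+
        show ?thesis using i by (simp add: set_integral_diff)
      qed
      also have "(LINT s:{0..2*pi}|lborel. Re (k (of_real (r n) * cis s))) = Re (LINT s:{0..2*pi}|lborel. k (of_real (r n) * cis s))"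
        using integral_Re[OF kI[unfolded set_integrable_def]] by (simp add: set_lebesgue_integral_def)
      also have "(LINT s:{0..2*pi}|lborel. k (of_real (r n) * cis s)) = of_real (2 * pi) * k 0"
        by (rule holomorphic_circle_mean[OF k(1) r0 r1(1)])
      finally show ?thesis unfolding Mi using B[OF rh r1(1), of n] by simp
    qed
  qed simp
  \<comment> \<open>A zero boundary value would send Re k to minus infinity along the radii
    \<open>r n\<close>.\<close>
  then have nz: "AE s in lborel. s \<in> {0..2*pi} \<longrightarrow> x s \<noteq> 0"
    using xAE unfolding AEM
  proof eventually_elim
    case (elim s)
    show ?case
    proof (intro impI notI)
      assume s: "s \<in> {0..2*pi}" "x s = 0"
      then have "(\<lambda>n. norm (?D (r n) s)) \<longlonglongrightarrow> 0" using elim(2) tendsto_norm_zero by auto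
      moreover have "norm (?D (r n) s) = exp (Re (k (of_real (r n) * cis s)))" for n
        using k(2)[OF inb[OF r0 r1(1), of n s]] by simp
      ultimately have "(\<lambda>n. exp (Re (k (of_real (r n) * cis s)))) \<longlonglongrightarrow> 0" by simp
      then have "filterlim (\<lambda>n. exp (Re (k (of_real (r n) * cis s)))) (at_right 0) sequentially"
        by (auto simp: filterlim_at)
      from filterlim_compose[OF ln_at_0 this]
      have "filterlim (\<lambda>n. Re (k (of_real (r n) * cis s))) at_bot sequentially" by simp
      then have "filterlim (\<lambda>n. - Re (k (of_real (r n) * cis s))) at_top sequentially"
        by (simp only: filterlim_uminus_at_bot)
      then have "filterlim (\<lambda>n. \<bar>Re (k (of_real (r n) * cis s))\<bar>) at_top sequentially"
        by (rule filterlim_at_top_mono) (auto intro!: always_eventually)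
      then show False using elim(1) s(1) by blast
    qed
  qed
  \<comment> \<open>Increments over the circles of radius \<open>r n\<close> are integrals of the
    derivative. The left side passes to the limit by continuity of \<Psi> on the closed disk, the
    right side by convergence in the mean.\<close>
  have inc: "\<Psi> (cis v) - \<Psi> (cis u) = (LINT s:{u..v}|lborel. x s * (\<i> * cis s))" if uv: "0 \<le> u" "u \<le> v" "v \<le> 2 * pi" for u v
  proof -
    have sub: "{u..v} \<subseteq> {0..2*pi}" using uv by auto
    have Psi_lim: "(\<lambda>n. \<Psi> (of_real (r n) * cis t)) \<longlonglongrightarrow> \<Psi> (cis t)" for t
    proof (rule continuous_on_tendsto_compose[OF cont])
      have "(\<lambda>n. of_real (r n) * cis t) \<longlonglongrightarrow> of_real 1 * cis t" by (intro tendsto_intros rlim)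
      then show "(\<lambda>n. of_real (r n) * cis t) \<longlonglongrightarrow> cis t" by simp
    qed (use r0 r1 in \<open>auto simp: norm_mult intro!: always_eventually less_imp_le\<close>)
    have xu: "set_integrable lborel {u..v} x" by (rule set_integrable_subset[OF xsI _ sub]) simp
    have cu: "set_integrable lborel {u..v} f" if "continuous_on {u..v} f" for f :: "real \<Rightarrow> complex"
      using that by (rule borel_integrable_atLeastAtMost')
    have xcI: "set_integrable lborel {u..v} (\<lambda>s. x s * (\<i> * cis s))"
    proof -
      have "integrable lborel (\<lambda>s. indicator {u..v} s *\<^sub>R (x s * (\<i> * cis s)))"
        by (rule Bochner_Integration.integrable_bound[OF xI])
           (use borel_measurable_integrable[OF xI] in \<open>auto simp: norm_mult indicator_def cis_conv_exp\<close>)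
      then show ?thesis by (simp add: set_integrable_def)
    qed
    have DcI: "set_integrable lborel {u..v} (\<lambda>s. ?D (r n) s * (\<i> * cis s))" for n
      by (intro cu continuous_intros Dc r0 r1)
    have "(\<lambda>n. (LINT s:{u..v}|lborel. ?D (r n) s * (\<i> * cis s)) - (LINT s:{u..v}|lborel. x s * (\<i> * cis s))) \<longlonglongrightarrow> 0"
    proof (rule Lim_null_comparison[OF _ xlim], intro always_eventually allI)
      fix n
      have "(LINT s:{u..v}|lborel. ?D (r n) s * (\<i> * cis s)) - (LINT s:{u..v}|lborel. x s * (\<i> * cis s))
          = (LINT s:{u..v}|lborel. ?D (r n) s * (\<i> * cis s) - x s * (\<i> * cis s))"
        by (rule set_integral_diff(2)[symmetric, OF DcI xcI])
      also have "norm \<dots> \<le> (LINT s:{u..v}|lborel. norm (?D (r n) s * (\<i> * cis s) - x s * (\<i> * cis s)))"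
        by (rule set_integral_norm_bound[OF set_integral_diff(1)[OF DcI xcI]])
      also have "\<dots> = (LINT s:{u..v}|lborel. norm (x s - ?D (r n) s))"
      proof -
        have "norm (?D (r n) s * (\<i> * cis s) - x s * (\<i> * cis s)) = norm (x s - ?D (r n) s)" for s
          unfolding left_diff_distrib[symmetric] by (simp add: norm_mult norm_minus_commute)
        then show ?thesis by simp
      qed
      also have "\<dots> \<le> (LINT s:{0..2*pi}|lborel. norm (x s - ?D (r n) s))"
      proof -
        have i: "set_integrable lborel {0..2*pi} (\<lambda>s. norm (x s - ?D (r n) s))"
          by (intro set_integrable_norm set_integral_diff xsI cI Dc r0 r1)
        have i2: "set_integrable lborel {u..v} (\<lambda>s. norm (x s - ?D (r n) s))" by (rule set_integrable_subset[OF i _ sub]) simp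
        show ?thesis unfolding set_lebesgue_integral_def
          by (rule integral_mono[OF i2[unfolded set_integrable_def] i[unfolded set_integrable_def]])
             (use sub in \<open>auto simp: indicator_def\<close>)
      qed
      finally show "norm ((LINT s:{u..v}|lborel. ?D (r n) s * (\<i> * cis s)) - (LINT s:{u..v}|lborel. x s * (\<i> * cis s)))
         \<le> (LINT s:{0..2*pi}|lborel. norm (x s - ?D (r n) s))" .
    qed
    then have "(\<lambda>n. LINT s:{u..v}|lborel. ?D (r n) s * (\<i> * cis s)) \<longlonglongrightarrow> (LINT s:{u..v}|lborel. x s * (\<i> * cis s))"
      by (rule LIM_zero_cancel)
    then have "(\<lambda>n. of_real (r n) * (LINT s:{u..v}|lborel. ?D (r n) s * (\<i> * cis s))) \<longlonglongrightarrow> of_real 1 * (LINT s:{u..v}|lborel. x s * (\<i> * cis s))"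
      by (intro tendsto_intros rlim)
    moreover have "of_real (r n) * (LINT s:{u..v}|lborel. ?D (r n) s * (\<i> * cis s)) = \<Psi> (of_real (r n) * cis v) - \<Psi> (of_real (r n) * cis u)" for n
    proof -
      have "?D (r n) s * (of_real (r n) * (\<i> * cis s)) = of_real (r n) * (?D (r n) s * (\<i> * cis s))" for s by (simp only: mult_ac)
      then show ?thesis unfolding circle_increment(1)[OF hol r0 r1(1) uv(2)] by (simp only: set_integral_mult_right)
    qed
    ultimately have "(\<lambda>n. \<Psi> (of_real (r n) * cis v) - \<Psi> (of_real (r n) * cis u)) \<longlonglongrightarrow> (LINT s:{u..v}|lborel. x s * (\<i> * cis s))"
      by simp
    moreover have "(\<lambda>n. \<Psi> (of_real (r n) * cis v) - \<Psi> (of_real (r n) * cis u)) \<longlonglongrightarrow> \<Psi> (cis v) - \<Psi> (cis u)"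
      by (intro tendsto_intros Psi_lim)
    ultimately show ?thesis using LIMSEQ_unique by blast
  qed
  show ?thesis by (rule that[OF r0 r1(1) rlim xI _ xlim xAE nz inc]) (auto simp: x_def)
qed

section \<open>Arc length as a measure on the circle\<close>

lemma IVT_between:
  fixes f :: "real \<Rightarrow> real"
  assumes "continuous_on {a..b} f" "a \<le> b" "min (f a) (f b) \<le> y" "y \<le> max (f a) (f b)"
  obtains c where "c \<in> {a..b}" "f c = y"
proof (cases "f a \<le> f b")
  case True
  then show ?thesis using IVT'[of f a y b] assms that by (auto simp: min_def max_def)
next
  case False
  then show ?thesis using IVT2'[of f b y a] assms that by (auto simp: min_def max_def)
qed

lemma continuous_inj_image_interval:
  fixes f :: "real \<Rightarrow> real"
  assumes f: "continuous_on {a..b} f" "inj_on f {a..b}" "a \<le> b"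
  shows "f ` {a..b} = {min (f a) (f b)..max (f a) (f b)}"
proof (intro equalityI subsetI)
  fix y assume "y \<in> {min (f a) (f b)..max (f a) (f b)}"
  then show "y \<in> f ` {a..b}" using IVT_between[OF f(1,3), of y] by (metis atLeastAtMost_iff image_eqI)
next
  fix y assume "y \<in> f ` {a..b}"
  then obtain c where c: "c \<in> {a..b}" "y = f c" by auto
  have "strict_mono_on {a..b} f \<or> strict_antimono_on {a..b} f"
    using injective_eq_monotone_map[of "{a..b}" f] f by (simp add: is_interval_cc)
  then show "y \<in> {min (f a) (f b)..max (f a) (f b)}"
  proof
    assume "strict_mono_on {a..b} f"
    then have "mono_on {a..b} f" by (rule strict_mono_on_imp_mono_on)
    then have "f a \<le> f c" "f c \<le> f b" using c f(3) by (auto intro: mono_onD)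
    then show ?thesis using c by auto
  next
    assume s: "strict_antimono_on {a..b} f"
    have "f v \<le> f u" if "u \<in> {a..b}" "v \<in> {a..b}" "u \<le> v" for u v
      using monotone_onD[OF s, of u v] that by (cases "u = v") auto
    then have "f c \<le> f a" "f b \<le> f c" using c f(3) by auto
    then show ?thesis using c by auto
  qed
qed

text \<open>The point of the circle that corresponds to \<open>\<gamma> t\<close> has a continuous
  angle, by lifting through the exponential. Simplicity of the loop makes the angle injective and
  its total change a full turn in one direction or the other. \<open>T\<close> inverts the angle and
  is increasing or decreasing according to orientation.\<close>

lemma circle_parameter:
  fixes \<gamma> :: "real \<Rightarrow> complex"
  assumes \<gamma>: "simple_path \<gamma>" "pathfinish \<gamma> = pathstart \<gamma>"
    and \<Psi>: "continuous_on (sphere 0 1) \<Psi>" "bij_betw \<Psi> (sphere 0 1) (path_image \<gamma>)" "\<Psi> 1 = \<gamma> 0"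
  obtains T where "continuous_on {0..2*pi} T" "bij_betw T {0..2*pi} {0..1}"
    "\<And>\<theta>. \<theta> \<in> {0..2*pi} \<Longrightarrow> \<gamma> (T \<theta>) = \<Psi> (cis \<theta>)"
proof -
  have free: "s = t \<or> s = 0 \<and> t = 1 \<or> s = 1 \<and> t = 0" if "s \<in> {0..1}" "t \<in> {0..1}" "\<gamma> s = \<gamma> t" for s t
    using \<gamma>(1) that by (auto simp: simple_path_def loop_free_def)
  have contg: "continuous_on {0..1} \<gamma>" using \<gamma>(1) by (simp add: simple_path_def path_def)
  define \<xi> where "\<xi> t = inv_into (sphere 0 1) \<Psi> (\<gamma> t)" for t
  have inj: "inj_on \<Psi> (sphere 0 1)" and im: "\<Psi> ` sphere 0 1 = path_image \<gamma>" using \<Psi>(2) by (auto simp: bij_betw_def)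
  have \<xi>1: "norm (\<xi> t) = 1" "\<Psi> (\<xi> t) = \<gamma> t" if "t \<in> {0..1}" for t
  proof -
    have "\<gamma> t \<in> \<Psi> ` sphere 0 1" unfolding im using that by (auto simp: path_image_def)
    then show "norm (\<xi> t) = 1" "\<Psi> (\<xi> t) = \<gamma> t"
      unfolding \<xi>_def using inv_into_into[of "\<gamma> t" \<Psi> "sphere 0 1"] f_inv_into_f[of "\<gamma> t" \<Psi> "sphere 0 1"] by auto
  qed
  have "continuous_on (\<Psi> ` sphere 0 1) (inv_into (sphere 0 1) \<Psi>)"
    by (rule continuous_on_inv[OF \<Psi>(1)]) (use inj in auto)
  then have \<xi>c: "continuous_on {0..1} \<xi>"
    unfolding \<xi>_def im by (rule continuous_on_compose2[OF _ contg]) (auto simp: path_image_def)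
  have \<xi>0: "\<xi> 0 = 1" "\<xi> 1 = 1"
  proof -
    show 0: "\<xi> 0 = 1" unfolding \<xi>_def using \<Psi>(3) inj by (metis inv_into_f_f mem_sphere_0 norm_one)
    have "\<gamma> 1 = \<gamma> 0" using \<gamma>(2) by (simp add: pathfinish_def pathstart_def)
    then show "\<xi> 1 = 1" using 0 by (simp add: \<xi>_def)
  qed
  have \<xi>free: "s = t \<or> s = 0 \<and> t = 1 \<or> s = 1 \<and> t = 0" if "s \<in> {0..1}" "t \<in> {0..1}" "\<xi> s = \<xi> t" for s t
    using free[OF that(1,2)] \<xi>1(2)[OF that(1)] \<xi>1(2)[OF that(2)] that(3) by simp
  have \<xi>nz: "\<xi> t \<noteq> 0" if "t \<in> {0..1}" for t using \<xi>1(1)[OF that] by auto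
  have "contractible {0..1::real}" by (intro convex_imp_contractible) simp
  from continuous_logarithm_on_contractible[OF \<xi>c this \<xi>nz] obtain g where g: "continuous_on {0..1} g" "\<And>t. t \<in> {0..1} \<Longrightarrow> \<xi> t = exp (g t)"
    by metis
  define \<Theta>0 where "\<Theta>0 t = Im (g t) - Im (g 0)" for t
  have c0: "continuous_on {0..1} \<Theta>0" unfolding \<Theta>0_def by (intro continuous_intros g)
  have gc: "\<xi> t = cis (Im (g t))" if "t \<in> {0..1}" for t
  proof -
    have "exp (Re (g t)) = 1" using \<xi>1(1)[OF that] g(2)[OF that] by simp
    then have "g t = \<i> * of_real (Im (g t))" by (simp add: complex_eq_iff)
    then show ?thesis using g(2)[OF that] by (metis cis_conv_exp)
  qed
  have cis0: "cis (\<Theta>0 t) = \<xi> t" if "t \<in> {0..1}" for t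
    using gc[OF that] gc[of 0] \<xi>0 by (simp add: \<Theta>0_def cis_divide[symmetric])
  have z0: "\<Theta>0 0 = 0" by (simp add: \<Theta>0_def)
  \<comment> \<open>With total change 0 the angle would take the value \<open>m / 2\<close> on both
    halves of the interval, at two parameters that the loop does not identify.\<close>
  have ne: "\<Theta>0 1 \<noteq> 0"
  proof
    assume 1: "\<Theta>0 1 = 0"
    define m where "m = \<Theta>0 (1/2)"
    have "m \<noteq> 0"
    proof
      assume "m = 0"
      then have "\<xi> (1/2) = \<xi> 0" using cis0[of "1/2"] cis0[of 0] z0 by (simp add: m_def)
      then show False using \<xi>free[of "1/2" 0] by simp
    qed
    obtain a where a: "a \<in> {0..1/2}" "\<Theta>0 a = m / 2"
      by (rule IVT_between[of 0 "1/2" \<Theta>0 "m / 2"]) (use c0 z0 in \<open>auto simp: m_def[symmetric] min_def max_def intro: continuous_on_subset\<close>)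
    obtain b where b: "b \<in> {1/2..1}" "\<Theta>0 b = m / 2"
      by (rule IVT_between[of "1/2" 1 \<Theta>0 "m / 2"]) (use c0 1 in \<open>auto simp: m_def[symmetric] min_def max_def intro: continuous_on_subset\<close>)
    have "\<xi> a = \<xi> b" using cis0[of a] cis0[of b] a b by simp
    then have "a = b \<or> a = 0 \<and> b = 1" using \<xi>free[of a b] a b by auto
    then show False
    proof
      assume "a = b"
      then have "a = 1/2" using a b by auto
      then have "\<Theta>0 a = m" by (simp only: m_def)
      then show False using a(2) \<open>m \<noteq> 0\<close> by simp
    qed (use a z0 \<open>m \<noteq> 0\<close> in auto)
  qed
  have inj0: "inj_on \<Theta>0 {0..1}"
  proof (rule inj_onI)
    fix s t :: real assume st: "s \<in> {0..1}" "t \<in> {0..1}" "\<Theta>0 s = \<Theta>0 t"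
    then have "\<xi> s = \<xi> t" using cis0 by metis
    then show "s = t" using \<xi>free[OF st(1,2)] st(3) ne z0 by auto
  qed
  have "cos (\<Theta>0 1) = 1" using cis0[of 1] \<xi>0 by (metis atLeastAtMost_iff cis.sel(1) one_complex.sel(1) order_refl zero_le_one)
  then obtain n :: int where n: "\<Theta>0 1 = of_int n * 2 * pi" using cos_one_2pi_int by blast
  have "n \<noteq> 0" using n ne by auto
  \<comment> \<open>The loop would be back at its starting point if the angle completed a turn
    before the end. By the intermediate value theorem this excludes winding more than once.\<close>
  have no_full: False if c: "c \<in> {0..1}" "\<bar>\<Theta>0 c\<bar> = 2 * pi" "\<bar>\<Theta>0 c\<bar> \<noteq> \<bar>\<Theta>0 1\<bar>" for c
  proof -
    have "cis (\<Theta>0 c) = 1" using c(2) cis_2pi cis_cnj[of "2 * pi"] by (auto simp: abs_if split: if_splits) (metis cis_cnj complex_cnj_one minus_minus)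
    then have "\<xi> c = \<xi> 0" using cis0[OF c(1)] \<xi>0 by simp
    then have "c = 0 \<or> c = 1" using \<xi>free[OF c(1), of 0] by auto
    then show False using c z0 by auto
  qed
  have full: "\<bar>\<Theta>0 1\<bar> = 2 * pi"
  proof (rule ccontr)
    assume no: "\<not> ?thesis"
    have "\<bar>n\<bar> \<ge> 1" using \<open>n \<noteq> 0\<close> by linarith
    then have "\<bar>real_of_int n\<bar> \<ge> 1" by linarith
    then have ge: "\<bar>\<Theta>0 1\<bar> \<ge> 2 * pi" unfolding n by (simp add: abs_mult)
    show False
    proof (cases "\<Theta>0 1 \<ge> 0")
      case True
      obtain c where "c \<in> {0..1}" "\<Theta>0 c = 2 * pi"
        by (rule IVT_between[OF c0, of "2 * pi"]) (use True ge z0 in auto)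
      then show False using no_full[of c] no by auto
    next
      case False
      obtain c where "c \<in> {0..1}" "\<Theta>0 c = - (2 * pi)"
        by (rule IVT_between[OF c0, of "- (2 * pi)"]) (use False ge z0 in auto)
      then show False using no_full[of c] no by auto
    qed
  qed
  \<comment> \<open>A decreasing angle ends at \<open>- 2 * pi\<close>; subtracting the minimum
    shifts the range to \<open>{0..2*pi}\<close> without changing \<open>cis\<close>.\<close>
  define \<Theta> where "\<Theta> t = \<Theta>0 t - min 0 (\<Theta>0 1)" for t
  have c: "continuous_on {0..1} \<Theta>" unfolding \<Theta>_def by (intro continuous_intros c0)
  have injT: "inj_on \<Theta> {0..1}" using inj0 by (auto simp: \<Theta>_def inj_on_def)
  have "\<Theta> ` {0..1} = {min (\<Theta> 0) (\<Theta> 1)..max (\<Theta> 0) (\<Theta> 1)}" by (rule continuous_inj_image_interval[OF c injT]) simp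
  also have "\<dots> = {0..2*pi}" using full z0 by (auto simp: \<Theta>_def min_def max_def abs_if split: if_splits)
  finally have imT: "\<Theta> ` {0..1} = {0..2*pi}" .
  have cisT: "cis (\<Theta> t) = \<xi> t" if "t \<in> {0..1}" for t
  proof -
    have "cis (- min 0 (\<Theta>0 1)) = 1" using full by (auto simp: min_def abs_if split: if_splits)
    then show ?thesis using cis0[OF that] by (simp add: \<Theta>_def cis_divide[symmetric] cis_cnj[symmetric])
  qed
  let ?T = "inv_into {0..1} \<Theta>"
  show ?thesis
  proof (rule that[of ?T])
    show "continuous_on {0..2*pi} ?T"
      using continuous_on_inv[OF c, of ?T] injT imT by simp
    show "bij_betw ?T {0..2*pi} {0..1}"
      using bij_betw_inv_into[of \<Theta> "{0..1}" "{0..2*pi}"] injT imT by (simp add: bij_betw_def)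
    fix \<theta> assume "\<theta> \<in> {0..2*pi}"
    then have "\<theta> \<in> \<Theta> ` {0..1}" using imT by simp
    then have t: "?T \<theta> \<in> {0..1}" "\<Theta> (?T \<theta>) = \<theta>" by (rule inv_into_into, rule f_inv_into_f)
    then show "\<gamma> (?T \<theta>) = \<Psi> (cis \<theta>)" using \<xi>1(2)[OF t(1)] cisT[OF t(1)] by simp
  qed
qed

lemma monotone_continuous_bij:
  fixes T :: "real \<Rightarrow> real"
  assumes "continuous_on {a..b} T" "bij_betw T {a..b} S"
  shows "mono_on {a..b} T \<or> antimono_on {a..b} T"
proof -
  have "strict_mono_on {a..b} T \<or> strict_antimono_on {a..b} T"
    using injective_eq_monotone_map[of "{a..b}" T] assms by (simp add: is_interval_cc bij_betw_def)
  then show ?thesis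
  proof
    assume "strict_mono_on {a..b} T"
    then show ?thesis by (simp add: strict_mono_on_imp_mono_on)
  next
    assume s: "strict_antimono_on {a..b} T"
    have "T v \<le> T u" if "u \<in> {a..b}" "v \<in> {a..b}" "u \<le> v" for u v
      using monotone_onD[OF s, of u v] that by (cases "u = v") auto
    then have "antimono_on {a..b} T" by (intro monotone_onI) auto
    then show ?thesis ..
  qed
qed

text \<open>\<open>T\<close> is monotone, so these angles form an initial or a final interval
  according to orientation. The length of the curve up to the parameter \<tau> thereby becomes a
  length over an interval of angles.\<close>

lemma sublevel_interval:
  fixes T :: "real \<Rightarrow> real"
  assumes T: "continuous_on {a..b} T" "bij_betw T {a..b} {0..1}" and \<tau>: "0 \<le> \<tau>" "\<tau> \<le> 1"
  obtains c d where "a \<le> c" "c \<le> d" "d \<le> b" "{\<theta>\<in>{a..b}. T \<theta> \<le> \<tau>} = {c..d}" "bij_betw T {c..d} {0..\<tau>}"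
proof -
  have im: "T ` {a..b} = {0..1}" and inj: "inj_on T {a..b}" using T(2) by (auto simp: bij_betw_def)
  have "\<tau> \<in> T ` {a..b}" using im \<tau> by auto
  then obtain e where e: "e \<in> {a..b}" "T e = \<tau>" by blast
  have sm: "strict_mono_on {a..b} T \<or> strict_antimono_on {a..b} T"
    using injective_eq_monotone_map[of "{a..b}" T] T(1) inj by (simp add: is_interval_cc)
  have bij: "bij_betw T {\<theta>\<in>{a..b}. T \<theta> \<le> \<tau>} {0..\<tau>}"
  proof -
    have "T ` {\<theta>\<in>{a..b}. T \<theta> \<le> \<tau>} = T ` {a..b} \<inter> {..\<tau>}" by auto
    also have "\<dots> = {0..\<tau>}" using im \<tau> by auto
    finally show ?thesis using inj by (auto simp: bij_betw_def intro: inj_on_subset)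
  qed
  from sm show ?thesis
  proof
    assume s: "strict_mono_on {a..b} T"
    have "{\<theta>\<in>{a..b}. T \<theta> \<le> \<tau>} = {a..e}"
      using strict_mono_on_less_eq[OF s] e by auto
    then show ?thesis using that[of a e] bij e by auto
  next
    assume s: "strict_antimono_on {a..b} T"
    have "T \<theta> \<le> \<tau> \<longleftrightarrow> e \<le> \<theta>" if "\<theta> \<in> {a..b}" for \<theta>
      using monotone_onD[OF s, of \<theta> e] monotone_onD[OF s, of e \<theta>] that e by (cases \<theta> e rule: linorder_cases) auto
    then have "{\<theta>\<in>{a..b}. T \<theta> \<le> \<tau>} = {e..b}" using e by auto
    then show ?thesis using that[of e b] bij e by auto
  qed
qed

text \<open>Half-open intervals generate the Borel sets and are stable under intersection. Arc
  length measure, being a Stieltjes measure, can thus be recognized by its distribution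
  function.\<close>

lemma interval_measure_cdf:
  assumes "finite_borel_measure M"
  shows "interval_measure (cdf M) = M"
proof -
  interpret finite_borel_measure M by fact
  have rc: "continuous (at_right a) (cdf M)" for a by (rule cdf_is_right_cont)
  have mono: "cdf M a \<le> cdf M b" if "a \<le> b" for a b using that by (rule cdf_nondecreasing)
  show ?thesis
  proof (rule measure_eqI_generator_eq[where \<Omega>=UNIV and E = "range (\<lambda>(a, b). {a<..b::real})" and A = "\<lambda>i. {- real i<..real i}"])
    fix X assume "X \<in> range (\<lambda>(a, b). {a<..b::real})"
    then obtain a b where X: "X = {a<..b}" by auto
    show "emeasure (interval_measure (cdf M)) X = emeasure M X"
    proof (cases "a \<le> b")
      case True
      then show ?thesis unfolding X using emeasure_interval_measure_Ioc[OF True mono rc] emeasure_Ioc[OF True] by simp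
    qed (simp add: X)
  next
    show "(\<Union>i. {- real (i::nat)<..real i}) = UNIV" by (rule UN_Ioc_eq_UNIV)
    show "emeasure (interval_measure (cdf M)) {- real i<..real i} \<noteq> \<infinity>" for i
      using emeasure_interval_measure_Ioc[of "- real i" "real i" "cdf M", OF _ mono rc] by simp
  qed (auto simp: M_is_borel borel_sigma_sets_Ioc Int_stable_def)
qed

text \<open>Arc length measure is the image under the boundary parametrization of the measure with
  density |x|, where x is the angular derivative of the parametrization up to a unimodular factor.\<close>

lemma arc_measure_eq_distr:
  fixes \<gamma> :: "real \<Rightarrow> complex" and x :: "real \<Rightarrow> complex" and T :: "real \<Rightarrow> real"
  assumes T: "continuous_on {0..2*pi} T" "bij_betw T {0..2*pi} {0..1}"
    and x: "integrable lborel x" "\<And>s. s \<notin> {0..2*pi} \<Longrightarrow> x s = 0"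
    and len: "\<And>c d. 0 \<le> c \<Longrightarrow> c \<le> d \<Longrightarrow> d \<le> 2 * pi \<Longrightarrow>
        curve_length (\<lambda>\<theta>. \<gamma> (T \<theta>)) c d = (LINT s:{c..d}|lborel. norm (x s))"
  shows "arc_measure \<gamma> = completion (distr (density lborel (\<lambda>s. ennreal (norm (x s)))) borel (\<lambda>\<theta>. T (max 0 (min (2*pi) \<theta>))))"
    and "curve_length \<gamma> 0 1 = (LINT s:{0..2*pi}|lborel. norm (x s))"
proof -
  let ?\<nu> = "density lborel (\<lambda>s. ennreal (norm (x s)))" and ?T = "\<lambda>\<theta>. T (max 0 (min (2*pi) \<theta>))"
  have [measurable]: "x \<in> borel_measurable lborel" using x(1) by auto
  have [measurable]: "?T \<in> borel_measurable borel"
    by (intro borel_measurable_continuous_onI continuous_on_compose2[OF T(1)] continuous_intros) auto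
  have im: "T ` {0..2*pi} = {0..1}" using T(2) by (auto simp: bij_betw_def)
  have Tin: "?T \<theta> \<in> {0..1}" for \<theta> using im by (metis atLeastAtMost_iff imageI max.cobounded1 max_def min.cobounded1 pi_ge_zero mult_nonneg_nonneg zero_le_numeral)
  have em: "emeasure ?\<nu> A = ennreal (LINT s:A \<inter> {0..2*pi}|lborel. norm (x s))" if "A \<in> sets borel" for A
  proof -
    have I: "integrable lborel (\<lambda>s. indicator (A \<inter> {0..2*pi}) s *\<^sub>R norm (x s))"
      using that x(1) by (intro integrable_mult_indicator integrable_norm) auto
    have "emeasure ?\<nu> A = (\<integral>\<^sup>+ s. ennreal (norm (x s)) * indicator A s \<partial>lborel)"
      using that by (subst emeasure_density) auto
    also have "\<dots> = (\<integral>\<^sup>+ s. ennreal (indicator (A \<inter> {0..2*pi}) s *\<^sub>R norm (x s)) \<partial>lborel)"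
      using x(2) by (intro nn_integral_cong) (auto simp: indicator_def)
    also have "\<dots> = ennreal (LINT s:A \<inter> {0..2*pi}|lborel. norm (x s))"
      unfolding set_lebesgue_integral_def using I by (intro nn_integral_eq_integral) auto
    finally show ?thesis .
  qed
  have nn: "(LINT s:A|lborel. norm (x s)) \<ge> 0" for A
    unfolding set_lebesgue_integral_def by (simp add: integral_nonneg)
  \<comment> \<open>The right side is the distribution function of the image measure at \<tau>;
    invariance of length under monotone reparametrization covers both orientations.\<close>
  have clen: "curve_length \<gamma> 0 \<tau> = measure ?\<nu> {\<theta>. ?T \<theta> \<le> \<tau>}" if \<tau>: "0 \<le> \<tau>" "\<tau> \<le> 1" for \<tau>
  proof -
    obtain c d where cd: "0 \<le> c" "c \<le> d" "d \<le> 2 * pi" "{\<theta>\<in>{0..2*pi}. T \<theta> \<le> \<tau>} = {c..d}" "bij_betw T {c..d} {0..\<tau>}"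
      by (rule sublevel_interval[OF T \<tau>])
    have "continuous_on {c..d} T" using cd by (intro continuous_on_subset[OF T(1)]) auto
    then have "inscribed_lengths (\<lambda>\<theta>. \<gamma> (T \<theta>)) c d = inscribed_lengths \<gamma> 0 \<tau>"
      using monotone_continuous_bij cd(5) by (intro inscribed_lengths_reparametrize) auto
    then have "curve_length \<gamma> 0 \<tau> = (LINT s:{c..d}|lborel. norm (x s))"
      using len[OF cd(1-3)] by (simp add: curve_length_def)
    moreover have "{\<theta>. ?T \<theta> \<le> \<tau>} \<inter> {0..2*pi} = {c..d}" unfolding cd(4)[symmetric] by (auto simp: min_def max_def)
    moreover have "{\<theta>. ?T \<theta> \<le> \<tau>} \<in> sets borel" by measurable
    ultimately show ?thesis using em[of "{\<theta>. ?T \<theta> \<le> \<tau>}"] nn by (simp add: measure_def)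
  qed
  have fin: "emeasure ?\<nu> UNIV < \<infinity>" using em[of UNIV] by simp
  let ?M = "distr ?\<nu> borel ?T"
  have fb: "finite_borel_measure ?M"
  proof (intro finite_borel_measure.intro finite_borel_measure_axioms.intro finite_measureI)
    have "emeasure ?M (space ?M) = emeasure ?\<nu> UNIV" by (subst emeasure_distr) auto
    then show "emeasure ?M (space ?M) \<noteq> \<infinity>" using fin by simp
  qed simp
  have "cdf ?M t = curve_length \<gamma> 0 (max 0 (min 1 t))" for t
  proof -
    have c: "cdf ?M t = measure ?\<nu> {\<theta>. ?T \<theta> \<le> t}"
      unfolding cdf_def by (subst measure_distr) (auto simp: vimage_def)
    show ?thesis
    proof (cases "t < 0")
      case True
      have "curve_length \<gamma> 0 0 = 0"
      proof -
        have "s = 0" if "s \<in> inscribed_lengths \<gamma> 0 0" for s using that by (auto elim!: inscribed_lengthsE)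
        then have "inscribed_lengths \<gamma> 0 0 = {0}" using zero_in_inscribed_lengths[of 0 0 \<gamma>] by blast
        then show ?thesis by (simp add: curve_length_def)
      qed
      moreover have "{\<theta>. ?T \<theta> \<le> t} = {}" using Tin True by (auto simp: not_le) (metis atLeastAtMost_iff less_le_trans)
      ultimately show ?thesis using c True by simp
    next
      case False
      have "{\<theta>. ?T \<theta> \<le> t} = {\<theta>. ?T \<theta> \<le> min 1 t}" using Tin by auto
      then show ?thesis using c clen[of "min 1 t"] False by (simp add: max_def)
    qed
  qed
  then have "cdf ?M = (\<lambda>t. curve_length \<gamma> 0 (max 0 (min 1 t)))" by auto
  then show "arc_measure \<gamma> = completion ?M"
    unfolding arc_measure_def using interval_measure_cdf[OF fb] by simp
  have "{\<theta>. ?T \<theta> \<le> 1} = UNIV" using Tin by auto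
  then show "curve_length \<gamma> 0 1 = (LINT s:{0..2*pi}|lborel. norm (x s))"
    using clen[of 1] em[of UNIV] nn by (simp add: measure_def)
qed

text \<open>Every subset of a null set is measurable for the completion. This serves boundary
  values, which are definite descriptions and are identified only almost everywhere.\<close>

lemma borel_measurable_completion_AE:
  fixes f g :: "'a \<Rightarrow> real"
  assumes g: "g \<in> borel_measurable M" and AE: "AE x in M. f x = g x"
  shows "f \<in> borel_measurable (completion M)"
proof -
  obtain N where N: "N \<in> null_sets M" "{x \<in> space M. f x \<noteq> g x} \<subseteq> N" using AE by (auto elim!: AE_E)
  show ?thesis
  proof (rule measurableI)
    fix A :: "real set" assume A: "A \<in> sets borel"
    have "f -` A \<inter> space M = (g -` A \<inter> space M - N) \<union> (f -` A \<inter> space M \<inter> N)" using N(2) by auto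
    moreover have "g -` A \<inter> space M - N \<in> sets (completion M)" using g A N(1) by (auto intro!: sets_completionI_sets)
    moreover have "f -` A \<inter> space M \<inter> N \<in> sets (completion M)" by (rule null_sets_completion[OF N(1)]) auto
    ultimately show "f -` A \<inter> space (completion M) \<in> sets (completion M)" by (metis sets.Un space_completion)
  qed simp
qed

text \<open>Change of variables from the curve parameter to the angle. \<open>B\<close> is
  uncontrolled at exceptional angles, but these form a null set for the image measure, so
  \<open>B\<close> may be replaced by the Borel function \<open>b\<close> composed with the inverse
  \<open>S\<close> of \<open>T\<close>.\<close>

lemma integral_arc_measure:
  fixes \<gamma> :: "real \<Rightarrow> complex" and x :: "real \<Rightarrow> complex" and T b B :: "real \<Rightarrow> real"
  assumes T: "continuous_on {0..2*pi} T" "bij_betw T {0..2*pi} {0..1}"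
    and x: "integrable lborel x" "\<And>s. s \<notin> {0..2*pi} \<Longrightarrow> x s = 0"
    and len: "\<And>c d. 0 \<le> c \<Longrightarrow> c \<le> d \<Longrightarrow> d \<le> 2 * pi \<Longrightarrow>
        curve_length (\<lambda>\<theta>. \<gamma> (T \<theta>)) c d = (LINT s:{c..d}|lborel. norm (x s))"
    and b: "b \<in> borel_measurable borel"
    and B: "AE s in lborel. s \<in> {0..2*pi} \<longrightarrow> B (T s) = b s"
  shows "(LINT t|arc_measure \<gamma>. B t) = (LINT s:{0..2*pi}|lborel. b s * norm (x s))"
proof -
  let ?\<nu> = "density lborel (\<lambda>s. ennreal (norm (x s)))" and ?T = "\<lambda>\<theta>. T (max 0 (min (2*pi) \<theta>))"
  let ?M = "distr ?\<nu> borel ?T"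
  have [measurable]: "x \<in> borel_measurable borel" "b \<in> borel_measurable borel" using x(1) b by auto
  have [measurable]: "?T \<in> borel_measurable borel"
    by (intro borel_measurable_continuous_onI continuous_on_compose2[OF T(1)] continuous_intros) auto
  have im: "T ` {0..2*pi} = {0..1}" and inj: "inj_on T {0..2*pi}" using T(2) by (auto simp: bij_betw_def)
  define S where "S t = inv_into {0..2*pi} T (max 0 (min 1 t))" for t
  have cinv: "continuous_on {0..1} (inv_into {0..2*pi} T)"
    using continuous_on_inv[OF T(1), of "inv_into {0..2*pi} T"] inj im by simp
  have [measurable]: "S \<in> borel_measurable borel" unfolding S_def
    by (rule borel_measurable_continuous_onI, rule continuous_on_compose2[OF cinv]) (auto intro!: continuous_intros)
  have ST: "S (T s) = s" "T s \<in> {0..1}" if "s \<in> {0..2*pi}" for s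
  proof -
    show t: "T s \<in> {0..1}" using that im by blast
    then have "max 0 (min 1 (T s)) = T s" by (simp add: min_absorb2 max_absorb2)
    then show "S (T s) = s" using that inj by (simp add: S_def)
  qed
  have TS: "S t \<in> {0..2*pi} \<and> T (S t) = t" if "t \<in> {0..1}" for t
  proof -
    have e: "max 0 (min 1 t) = t" using that by (simp add: min_absorb2 max_absorb2)
    have "t \<in> T ` {0..2*pi}" using that im by blast
    then show ?thesis unfolding S_def e by (intro conjI inv_into_into f_inv_into_f)
  qed
  obtain N where N0: "{s \<in> space lborel. \<not> (s \<in> {0..2*pi} \<longrightarrow> B (T s) = b s)} \<subseteq> N" and N1: "N \<in> null_sets lborel"
    using B unfolding eventually_ae_filter by blast
  have N2: "B (T s) = b s" if "s \<notin> N" "s \<in> {0..2*pi}" for s using N0 that by auto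
  note N = N1 N2
  \<comment> \<open>Parameters outside \<open>{0..1}\<close> carry no mass because \<open>T\<close>
    has its values there. Parameters of exceptional angles carry none because their preimage lies in
    \<open>N\<close> apart from angles outside \<open>{0..2*pi}\<close>, where \<open>x\<close>
    vanishes.\<close>
  define A where "A = - {0..1} \<union> S -` N"
  have NS: "N \<in> sets borel" using N(1) by auto
  have SN: "S -` N \<in> sets borel" using NS measurable_sets[of S borel borel N] by simp
  have AS: "A \<in> sets borel" unfolding A_def using SN by auto
  have "emeasure ?M A = emeasure ?\<nu> (?T -` A)" using AS by (subst emeasure_distr) auto
  also have "\<dots> = (\<integral>\<^sup>+ s. ennreal (norm (x s)) * indicator (?T -` A) s \<partial>lborel)"
    using measurable_sets[of ?T borel borel A] AS by (subst emeasure_density) auto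
  also have "\<dots> = (\<integral>\<^sup>+ (s::real). 0 \<partial>lborel)"
  proof (rule nn_integral_cong_AE)
    show "AE s in lborel. ennreal (norm (x s)) * indicator (?T -` A) s = 0"
      using AE_not_in[OF N(1)]
    proof eventually_elim
      case (elim s)
      show ?case
      proof (cases "s \<in> {0..2*pi}")
        case True
        then have "?T s = T s" by (simp add: min_absorb2 max_absorb2)
        then show ?thesis using ST[OF True] elim by (simp add: A_def)
      qed (use x(2) in simp)
    qed
  qed
  finally have nullA: "A \<in> null_sets ?M" using AS by (auto simp: null_sets_def)
  have eq: "B t = b (S t)" if "t \<notin> A" for t
  proof -
    have t: "t \<in> {0..1}" "S t \<notin> N" using that by (auto simp: A_def)
    have "S t \<in> {0..2*pi}" "T (S t) = t" using TS[OF t(1)] by auto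
    then have "B (T (S t)) = b (S t)" using N(2) t(2) by blast
    then show ?thesis using \<open>T (S t) = t\<close> by simp
  qed
  have AEM: "AE t in ?M. B t = b (S t)" using AE_not_in[OF nullA] by eventually_elim (rule eq)
  have bS: "(\<lambda>t. b (S t)) \<in> borel_measurable ?M" by simp
  have "(LINT t|arc_measure \<gamma>. B t) = (LINT t|completion ?M. B t)"
    using arc_measure_eq_distr(1)[OF T x len] by simp
  also have "\<dots> = (LINT t|completion ?M. b (S t))"
  proof (rule integral_cong_AE)
    show "B \<in> borel_measurable (completion ?M)" by (rule borel_measurable_completion_AE[OF bS AEM])
    show "(\<lambda>t. b (S t)) \<in> borel_measurable (completion ?M)" by (rule measurable_completion[OF bS])
    show "AE t in completion ?M. B t = b (S t)" by (rule AE_completion[OF AEM])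
  qed
  also have "\<dots> = (LINT t|?M. b (S t))" by (rule integral_completion[OF bS])
  also have "\<dots> = (LINT s|?\<nu>. b (S (?T s)))" by (subst integral_distr) auto
  also have "\<dots> = (LINT s|lborel. norm (x s) *\<^sub>R b (S (?T s)))" by (subst integral_density) auto
  also have "\<dots> = (LINT s:{0..2*pi}|lborel. b s * norm (x s))"
    unfolding set_lebesgue_integral_def
  proof (rule Bochner_Integration.integral_cong[OF refl])
    fix s
    show "norm (x s) *\<^sub>R b (S (?T s)) = indicator {0..2*pi} s *\<^sub>R (b s * norm (x s))"
    proof (cases "s \<in> {0..2*pi}")
      case True
      then have "?T s = T s" by (simp add: min_absorb2 max_absorb2)
      then show ?thesis using ST[OF True] True by simp
    qed (use x(2) in simp)
  qed
  finally show ?thesis .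
qed

section \<open>Approach regions and Stolz regions\<close>

text \<open>\<open>1 - norm w\<close> is the distance from \<open>w\<close> to the circle, so this
  is the approach region of the disk itself, with \<open>K\<close> in place of
  \<open>1 + \<alpha>\<close> and a weak inequality.\<close>

definition stolz_region :: "complex \<Rightarrow> real \<Rightarrow> complex set" where
  "stolz_region w0 K = {w \<in> ball 0 1. norm (w - w0) \<le> K * (1 - norm w)}"

text \<open>The region is cut out of the disk by a sublevel set of the convex function
  \<open>norm (w - w0) + K * norm w\<close>. Convexity keeps it connected near \<open>w0\<close>, so
  that a logarithm cannot jump between branches.\<close>

lemma convex_stolz_region: "K \<ge> 0 \<Longrightarrow> convex (stolz_region w0 K)"
proof -
  assume K: "K \<ge> 0"
  have "convex {w. norm (w - w0) + K * norm w \<le> K}"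
  proof (rule convexI)
    fix x y :: complex and u v :: real
    assume x: "x \<in> {w. norm (w - w0) + K * norm w \<le> K}" and y: "y \<in> {w. norm (w - w0) + K * norm w \<le> K}"
      and uv: "0 \<le> u" "0 \<le> v" "u + v = 1"
    have v: "v = 1 - u" using uv(3) by simp
    have "u *\<^sub>R x + v *\<^sub>R y - w0 = u *\<^sub>R (x - w0) + v *\<^sub>R (y - w0)"
      unfolding v by (simp add: algebra_simps)
    then have 1: "norm (u *\<^sub>R x + v *\<^sub>R y - w0) \<le> u * norm (x - w0) + v * norm (y - w0)"
      using norm_triangle_ineq[of "u *\<^sub>R (x - w0)" "v *\<^sub>R (y - w0)"] uv by simp
    have "norm (u *\<^sub>R x + v *\<^sub>R y) \<le> u * norm x + v * norm y"
      using norm_triangle_ineq[of "u *\<^sub>R x" "v *\<^sub>R y"] uv by simp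
    then have 2: "K * norm (u *\<^sub>R x + v *\<^sub>R y) \<le> K * (u * norm x + v * norm y)" using K by (rule mult_left_mono)
    have 3: "u * (norm (x - w0) + K * norm x) \<le> u * K" using x uv by (intro mult_left_mono) auto
    have 4: "v * (norm (y - w0) + K * norm y) \<le> v * K" using y uv by (intro mult_left_mono) auto
    have "u * K + v * K = K" using uv(3) by (metis distrib_right mult_1)
    then show "u *\<^sub>R x + v *\<^sub>R y \<in> {w. norm (w - w0) + K * norm w \<le> K}"
      using 1 2 3 4 by (simp add: algebra_simps)
  qed
  moreover have "stolz_region w0 K = ball 0 1 \<inter> {w. norm (w - w0) + K * norm w \<le> K}"
    by (auto simp: stolz_region_def algebra_simps)
  ultimately show ?thesis by (simp add: convex_Int)
qed

lemma stolz_region_mono: "K \<le> K' \<Longrightarrow> stolz_region w0 K \<subseteq> stolz_region w0 K'"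
  unfolding stolz_region_def by (auto intro: order_trans mult_right_mono)

lemma stolz_region_nontrivial:
  assumes "norm w0 = 1" "K \<ge> 1"
  shows "at w0 within stolz_region w0 K \<noteq> bot"
proof -
  have "w0 islimpt stolz_region w0 K"
    unfolding islimpt_approachable
  proof (intro allI impI)
    fix e :: real assume "e > 0"
    define t where "t = 1 - min (1/2) (e / 2)"
    have t: "0 < t" "t < 1" "1 - t < e" using \<open>e > 0\<close> by (auto simp: t_def min_def)
    have n: "norm (of_real t * w0 - w0) = 1 - t"
    proof -
      have "of_real t * w0 - w0 = of_real (t - 1) * w0" by (simp add: algebra_simps)
      then show ?thesis using t assms by (simp only: norm_mult norm_of_real) simp
    qed
    have "1 * (1 - t) \<le> K * (1 - t)" using t assms by (intro mult_right_mono) auto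
    then have "of_real t * w0 \<in> stolz_region w0 K"
      using n t assms by (simp add: stolz_region_def norm_mult)
    moreover have "of_real t * w0 \<noteq> w0" using n t by auto
    ultimately show "\<exists>x'\<in>stolz_region w0 K. x' \<noteq> w0 \<and> dist x' w0 < e"
      using n t by (intro bexI[of _ "of_real t * w0"]) (auto simp: dist_norm)
  qed
  then show ?thesis by (simp add: trivial_limit_within)
qed

lemma boundary_quotient_bound:
  fixes f :: "complex \<Rightarrow> complex"
  assumes lim: "((\<lambda>w. (f w - f w0) / (w - w0)) \<longlongrightarrow> c) (at w0 within cball 0 1)" and eps: "\<epsilon> > 0"
  obtains \<delta> where "\<delta> > 0" "\<And>w. norm w \<le> 1 \<Longrightarrow> norm (w - w0) < \<delta> \<Longrightarrow> norm (f w - f w0 - c * (w - w0)) \<le> \<epsilon> * norm (w - w0)"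
proof -
  obtain \<delta> where \<delta>: "\<delta> > 0" "\<And>w. norm w \<le> 1 \<Longrightarrow> w \<noteq> w0 \<Longrightarrow> dist w w0 < \<delta> \<Longrightarrow> dist ((f w - f w0) / (w - w0)) c < \<epsilon>"
    using tendstoD[OF lim eps] unfolding eventually_at by auto
  have "norm (f w - f w0 - c * (w - w0)) \<le> \<epsilon> * norm (w - w0)" if w: "norm w \<le> 1" "norm (w - w0) < \<delta>" for w
  proof (cases "w = w0")
    case False
    have "f w - f w0 - c * (w - w0) = ((f w - f w0) / (w - w0) - c) * (w - w0)" using False by (simp add: field_simps)
    then have "norm (f w - f w0 - c * (w - w0)) = norm ((f w - f w0) / (w - w0) - c) * norm (w - w0)" by (simp only: norm_mult)
    also have "\<dots> \<le> \<epsilon> * norm (w - w0)" using \<delta>(2)[of w] w False by (intro mult_right_mono) (auto simp: dist_norm)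
    finally show ?thesis .
  qed simp
  then show ?thesis using that \<delta>(1) by blast
qed

text \<open>Cauchy's estimate for \<open>f\<close> minus its affine approximation, on a disk of half
  the distance to the circle. The error is small relative to |w - w0|, which in the Stolz region is
  at most a constant multiple of that radius.\<close>

lemma derivative_tendsto_in_stolz_region:
  assumes hol: "f holomorphic_on ball 0 1" and w0: "norm w0 = 1"
    and lim: "((\<lambda>w. (f w - f w0) / (w - w0)) \<longlongrightarrow> c) (at w0 within cball 0 1)" and K: "K > 0"
  shows "(deriv f \<longlongrightarrow> c) (at w0 within stolz_region w0 K)"
proof (rule tendstoI)
  fix e :: real assume e: "e > 0"
  \<comment> \<open>Cauchy's estimate will yield \<open>4 * \<epsilon> * K\<close>, which is
    \<open>e / 2\<close>.\<close>
  define \<epsilon> where "\<epsilon> = e / (8 * K)"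
  have eps: "\<epsilon> > 0" using e K by (simp add: \<epsilon>_def)
  obtain \<delta> where \<delta>: "\<delta> > 0" "\<And>w. norm w \<le> 1 \<Longrightarrow> norm (w - w0) < \<delta> \<Longrightarrow> norm (f w - f w0 - c * (w - w0)) \<le> \<epsilon> * norm (w - w0)"
    using boundary_quotient_bound[OF lim eps] by blast
  have "dist (deriv f w) c < e" if w: "w \<in> stolz_region w0 K" "w \<noteq> w0" "dist w w0 < \<delta> / 2" for w
  proof -
    have w1: "norm w < 1" "norm (w - w0) \<le> K * (1 - norm w)" using w by (auto simp: stolz_region_def)
    define \<rho> where "\<rho> = (1 - norm w) / 2"
    have \<rho>: "\<rho> > 0" using w1 by (simp add: \<rho>_def)
    have tri: "1 - norm w \<le> norm (w - w0)" using norm_triangle_ineq3[of w0 w] w0 by (simp add: norm_minus_commute)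
    let ?H = "\<lambda>v. f v - f w0 - c * (v - w0)"
    have sub: "cball w \<rho> \<subseteq> ball 0 1"
    proof
      fix v assume "v \<in> cball w \<rho>"
      then have "norm (v - w) \<le> \<rho>" by (simp add: dist_norm norm_minus_commute)
      then have "norm v \<le> norm w + \<rho>" using norm_triangle_ineq2[of v w] by simp
      then have "norm v < 1" using w1(1) unfolding \<rho>_def by argo
      then show "v \<in> ball 0 1" by simp
    qed
    have Hh: "?H holomorphic_on ball 0 1" by (intro holomorphic_intros hol)
    have "norm ((deriv ^^ 1) ?H w) \<le> fact 1 * (\<epsilon> * (2 * norm (w - w0))) / \<rho> ^ 1"
    proof (rule Cauchy_inequality)
      show "?H holomorphic_on ball w \<rho>" using Hh sub by (meson ball_subset_cball holomorphic_on_subset order_trans)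
      show "continuous_on (cball w \<rho>) ?H" using holomorphic_on_imp_continuous_on[OF Hh] sub continuous_on_subset by blast
      show "0 < \<rho>" by fact
      fix v assume v: "norm (w - v) = \<rho>"
      then have "v \<in> cball w \<rho>" by (simp add: dist_norm)
      then have "norm v < 1" using sub by auto
      have t: "norm (v - w0) \<le> norm (w - w0) + \<rho>" using norm_triangle_ineq[of "v - w" "w - w0"] v by (simp add: norm_minus_commute)
      then have t2: "norm (v - w0) \<le> 2 * norm (w - w0)" using tri norm_ge_zero[of "w - w0"] unfolding \<rho>_def by argo
      then have "norm (v - w0) < \<delta>" using w(3) by (simp add: dist_norm)
      then have "norm (?H v) \<le> \<epsilon> * norm (v - w0)" using \<open>norm v < 1\<close> by (intro \<delta>(2)) auto
      also have "\<dots> \<le> \<epsilon> * (2 * norm (w - w0))" using t2 eps by (intro mult_left_mono) auto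
      finally show "norm (?H v) \<le> \<epsilon> * (2 * norm (w - w0))" .
    qed
    also have "\<dots> \<le> 4 * \<epsilon> * K"
    proof -
      have "1 - norm w = 2 * \<rho>" by (simp add: \<rho>_def)
      then have "\<epsilon> * (2 * norm (w - w0)) \<le> \<epsilon> * (2 * (K * (2 * \<rho>)))" using w1(2) eps by (intro mult_left_mono) auto
      then show ?thesis using \<rho> by (simp add: field_simps)
    qed
    also have "\<dots> < e" using e K by (simp add: \<epsilon>_def)
    finally have "norm (deriv ?H w) < e" by simp
    moreover have "deriv ?H w = deriv f w - c"
    proof -
      have "(f has_field_derivative deriv f w) (at w)" using hol w1 by (intro holomorphic_derivI[of f "ball 0 1"]) auto
      then have "(?H has_field_derivative deriv f w - c) (at w)" by (auto intro!: derivative_eq_intros)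
      then show ?thesis by (rule DERIV_imp_deriv)
    qed
    ultimately show ?thesis by (simp add: dist_norm)
  qed
  then show "\<forall>\<^sub>F w in at w0 within stolz_region w0 K. dist (deriv f w) c < e"
    unfolding eventually_at using \<delta>(1) by (intro exI[of _ "\<delta> / 2"]) auto
qed

text \<open>The frontier is approached only along the boundary curve, which is nearly straight at w0;
  hence the distance of an image point to the frontier is at most about |c| (1 - |w|).\<close>

lemma approach_region_pullback:
  assumes w0: "norm w0 = 1" and c: "c \<noteq> 0"
    and lim: "((\<lambda>w. (\<Psi> w - \<Psi> w0) / (w - w0)) \<longlongrightarrow> c) (at w0 within cball 0 1)"
    and fr: "\<Psi> ` sphere 0 1 \<subseteq> frontier G" and \<alpha>: "\<alpha> > 0"
  obtains \<delta> where "\<delta> > 0" "\<And>w. w \<in> ball 0 1 \<Longrightarrow> norm (w - w0) < \<delta> \<Longrightarrow> \<Psi> w \<in> approach_region G \<alpha> (\<Psi> w0)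
      \<Longrightarrow> w \<in> stolz_region w0 (2 * (1 + \<alpha>))"
proof -
  \<comment> \<open>The three error terms in the distance to the frontier, multiplied by
    \<open>1 + \<alpha>\<close>, amount to 3/8 of |w - w0|. On the other side at least 7/8 remain,
    and the difference 1/2 produces the factor 2 in the aperture.\<close>
  define \<epsilon> where "\<epsilon> = 1 / (8 * (1 + \<alpha>))"
  have eps: "\<epsilon> > 0" "\<epsilon> \<le> 1 / 8" "\<epsilon> * (1 + \<alpha>) = 1 / 8" using \<alpha> by (auto simp: \<epsilon>_def field_simps)
  obtain \<delta> where \<delta>: "\<delta> > 0" "\<And>w. norm w \<le> 1 \<Longrightarrow> norm (w - w0) < \<delta> \<Longrightarrow>
      norm (\<Psi> w - \<Psi> w0 - c * (w - w0)) \<le> \<epsilon> * norm c * norm (w - w0)"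
    using boundary_quotient_bound[OF lim, of "\<epsilon> * norm c"] eps c by auto
  show ?thesis
  proof (rule that[of "min (\<delta> / 2) 1"])
    show "min (\<delta> / 2) 1 > 0" using \<delta>(1) by simp
    fix w assume w: "w \<in> ball 0 1" "norm (w - w0) < min (\<delta> / 2) 1" "\<Psi> w \<in> approach_region G \<alpha> (\<Psi> w0)"
    have wn: "norm w < 1" using w by simp
    have "w \<noteq> 0" using w(2) w0 by auto
    \<comment> \<open>The radial projection yields the frontier point \<open>\<Psi> w'\<close>,
      whose distance bounds the distance of \<open>\<Psi> w\<close> to the frontier from
      above.\<close>
    define w' where "w' = w / of_real (norm w)"
    have w': "norm w' = 1" using \<open>w \<noteq> 0\<close> by (simp add: w'_def norm_divide)
    have d1: "norm (w - w') = 1 - norm w"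
    proof -
      have "w - w' = w' * of_real (norm w - 1)" using \<open>w \<noteq> 0\<close> by (simp add: w'_def field_simps)
      then have "norm (w - w') = \<bar>norm w - 1\<bar>" using w' by (simp only: norm_mult norm_of_real mult_1)
      then show ?thesis using wn by simp
    qed
    have tri: "1 - norm w \<le> norm (w - w0)" using norm_triangle_ineq3[of w0 w] w0 by (simp add: norm_minus_commute)
    have d2: "norm (w' - w0) \<le> 2 * norm (w - w0)"
      using norm_triangle_ineq[of "w' - w" "w - w0"] d1 tri by (simp add: norm_minus_commute)
    let ?E = "\<lambda>v. \<Psi> v - \<Psi> w0 - c * (v - w0)"
    have E1: "norm (?E w) \<le> \<epsilon> * norm c * norm (w - w0)" using wn w(2) \<delta>(1) by (intro \<delta>(2)) auto
    have "norm (?E w') \<le> \<epsilon> * norm c * norm (w' - w0)" using w' w(2) d2 by (intro \<delta>(2)) auto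
    also have "\<dots> \<le> \<epsilon> * norm c * (2 * norm (w - w0))" using d2 eps by (intro mult_left_mono) auto
    finally have E2: "norm (?E w') \<le> \<epsilon> * norm c * (2 * norm (w - w0))" .
    have "\<Psi> w' \<in> frontier G" using fr w' by auto
    then have "infdist (\<Psi> w) (frontier G) \<le> dist (\<Psi> w) (\<Psi> w')" by (rule infdist_le)
    also have "dist (\<Psi> w) (\<Psi> w') = norm (c * (w - w') + (?E w - ?E w'))" by (simp add: dist_norm algebra_simps)
    also have "\<dots> \<le> norm (c * (w - w')) + (norm (?E w) + norm (?E w'))"
      by (rule order_trans[OF norm_triangle_ineq add_left_mono[OF norm_triangle_ineq4]])
    also have "\<dots> \<le> norm c * (1 - norm w) + 3 * (\<epsilon> * norm c * norm (w - w0))"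
      using E1 E2 d1 by (simp add: norm_mult)
    finally have inf: "infdist (\<Psi> w) (frontier G) \<le> norm c * (1 - norm w) + 3 * (\<epsilon> * norm c * norm (w - w0))" .
    have "norm (c * (w - w0)) \<le> norm (\<Psi> w - \<Psi> w0) + norm (?E w)"
      using norm_triangle_ineq4[of "\<Psi> w - \<Psi> w0" "?E w"] by simp
    then have "norm c * norm (w - w0) - \<epsilon> * norm c * norm (w - w0) \<le> dist (\<Psi> w) (\<Psi> w0)"
      using E1 by (simp add: norm_mult dist_norm)
    also have "\<dots> < (1 + \<alpha>) * infdist (\<Psi> w) (frontier G)" using w(3) by (simp add: approach_region_def)
    also have "\<dots> \<le> (1 + \<alpha>) * (norm c * (1 - norm w) + 3 * (\<epsilon> * norm c * norm (w - w0)))"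
      using inf \<alpha> by (intro mult_left_mono) auto
    also have "\<dots> = norm c * ((1 + \<alpha>) * (1 - norm w) + 3 * (\<epsilon> * (1 + \<alpha>)) * norm (w - w0))"
      by (simp add: algebra_simps)
    finally have "norm c * ((1 - \<epsilon>) * norm (w - w0)) < norm c * ((1 + \<alpha>) * (1 - norm w) + 3 / 8 * norm (w - w0))"
      unfolding eps(3) by (simp add: algebra_simps)
    then have "(1 - \<epsilon>) * norm (w - w0) < (1 + \<alpha>) * (1 - norm w) + 3 / 8 * norm (w - w0)"
      using c by simp
    moreover have "(1 - 1 / 8) * norm (w - w0) \<le> (1 - \<epsilon>) * norm (w - w0)" using eps by (intro mult_right_mono) auto
    ultimately have "norm (w - w0) \<le> 2 * ((1 + \<alpha>) * (1 - norm w))" by argo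
    then have "norm (w - w0) \<le> 2 * (1 + \<alpha>) * (1 - norm w)" by (simp only: mult.assoc)
    then show "w \<in> stolz_region w0 (2 * (1 + \<alpha>))" using wn by (simp add: stolz_region_def)
  qed
qed

text \<open>The image of the radius to \<open>w0\<close> lies in the region near its end: since
  \<Psi> is almost linear there, the distance to \<open>\<Psi> w0\<close> is at most 9/8 |c| s while
  the frontier is at least |c| s / 2 away, and 5/2 exceeds 9/8. Without such points the limit that
  defines a boundary value would not be unique.\<close>

lemma approach_region_nontrivial:
  assumes w0: "norm w0 = 1" and c: "c \<noteq> 0"
    and lim: "((\<lambda>w. (\<Psi> w - \<Psi> w0) / (w - w0)) \<longlongrightarrow> c) (at w0 within cball 0 1)"
    and cont: "continuous_on (cball 0 1) \<Psi>" and inj: "inj_on \<Psi> (cball 0 1)"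
    and fr: "frontier G = \<Psi> ` sphere 0 1" and im: "\<Psi> ` ball 0 1 \<subseteq> G"
  shows "at (\<Psi> w0) within approach_region G 4 (\<Psi> w0) \<noteq> bot"
proof -
  obtain \<delta> where \<delta>: "\<delta> > 0" "\<And>w. norm w \<le> 1 \<Longrightarrow> norm (w - w0) < \<delta> \<Longrightarrow>
      norm (\<Psi> w - \<Psi> w0 - c * (w - w0)) \<le> norm c / 8 * norm (w - w0)"
    using boundary_quotient_bound[OF lim, of "norm c / 8"] c by auto
  \<comment> \<open>Compactness and injectivity keep the part of the frontier that comes from points
    away from \<open>w0\<close> at a positive distance from \<open>\<Psi> w0\<close>.\<close>
  obtain m where m: "m > 0" "\<And>v. norm v = 1 \<Longrightarrow> norm (v - w0) \<ge> \<delta> \<Longrightarrow> norm (\<Psi> v - \<Psi> w0) \<ge> m"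
  proof (cases "sphere 0 1 - ball w0 \<delta> = {}")
    case True
    have "norm (\<Psi> v - \<Psi> w0) \<ge> 1" if "norm v = 1" "norm (v - w0) \<ge> \<delta>" for v
      using True that by (auto simp: dist_norm norm_minus_commute)
    then show ?thesis using that[of 1] by simp
  next
    case False
    have "compact (sphere (0::complex) 1 - ball w0 \<delta>)" by (intro compact_diff) auto
    moreover have "continuous_on (sphere 0 1 - ball w0 \<delta>) (\<lambda>v. norm (\<Psi> v - \<Psi> w0))"
      by (intro continuous_intros continuous_on_subset[OF cont]) auto
    ultimately obtain v0 where v0: "v0 \<in> sphere 0 1 - ball w0 \<delta>" "\<forall>v\<in>sphere 0 1 - ball w0 \<delta>. norm (\<Psi> v0 - \<Psi> w0) \<le> norm (\<Psi> v - \<Psi> w0)"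
      using continuous_attains_inf[OF _ False] by blast
    have "v0 \<noteq> w0" using v0(1) \<delta>(1) by auto
    then have "\<Psi> v0 \<noteq> \<Psi> w0" using inj v0(1) w0 by (auto dest: inj_onD)
    then show ?thesis using v0(2) by (intro that[of "norm (\<Psi> v0 - \<Psi> w0)"]) (auto simp: dist_norm norm_minus_commute)
  qed
  have cn: "norm c > 0" using c by simp
  have "\<Psi> w0 islimpt approach_region G 4 (\<Psi> w0)"
    unfolding islimpt_approachable
  proof (intro allI impI)
    fix e :: real assume e: "e > 0"
    define s where "s = min (1 / 2) (min (\<delta> / 3) (min (e / (2 * norm c)) (m / (3 * norm c))))"
    have s0: "s > 0" using e \<delta>(1) m(1) cn by (simp add: s_def)
    have s: "s \<le> 1 / 2" "s < \<delta>" "norm c * s \<le> e / 2" "3 * (norm c * s) \<le> m"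
    proof -
      have "s \<le> e / (2 * norm c)" "s \<le> m / (3 * norm c)" "s \<le> \<delta> / 3" by (auto simp: s_def)
      then show "norm c * s \<le> e / 2" "3 * (norm c * s) \<le> m" "s < \<delta>" using cn \<delta>(1) by (auto simp: field_simps)
    qed (simp add: s_def)
    define w where "w = of_real (1 - s) * w0"
    have wn: "norm w = 1 - s" using s w0 by (simp add: w_def norm_mult del: of_real_diff)
    have ws: "norm (w - w0) = s"
    proof -
      have "w - w0 = - of_real s * w0" by (simp add: w_def algebra_simps)
      then show ?thesis using s0 w0 by (simp add: norm_mult)
    qed
    let ?E = "\<lambda>v. \<Psi> v - \<Psi> w0 - c * (v - w0)"
    have E1: "norm (?E w) \<le> norm c / 8 * s" using \<delta>(2)[of w] wn ws s s0 by simp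
    have up: "dist (\<Psi> w) (\<Psi> w0) \<le> 9 / 8 * (norm c * s)"
      using norm_triangle_ineq[of "c * (w - w0)" "?E w"] E1 ws by (simp add: dist_norm norm_mult)
    have lo: "dist (\<Psi> w) (\<Psi> w0) \<ge> 7 / 8 * (norm c * s)"
      using norm_triangle_ineq4[of "\<Psi> w - \<Psi> w0" "?E w"] E1 ws by (simp add: dist_norm norm_mult)
    have cs: "norm c * s > 0" using cn s0 by simp
    \<comment> \<open>For \<open>v\<close> near \<open>w0\<close> the errors of the linear
      approximation at \<open>v\<close> and \<open>w\<close> add up to at most 3/8 of
      \<open>norm c * norm (v - w)\<close>. For distant \<open>v\<close> the separation
      \<open>m\<close>, at least three times \<open>norm c * s\<close>, outweighs the distance from
      \<open>\<Psi> w\<close> to \<open>\<Psi> w0\<close>.\<close>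
    have low: "norm c * s / 2 \<le> dist (\<Psi> w) (\<Psi> v)" if v: "norm v = 1" for v
    proof (cases "norm (v - w0) < \<delta>")
      case True
      have vw: "norm (v - w) \<ge> s" using norm_triangle_ineq2[of v w] v wn by simp
      have "norm (v - w0) \<le> norm (v - w) + s" using norm_triangle_ineq[of "v - w" "w - w0"] ws by simp
      then have v2: "norm (v - w0) \<le> 2 * norm (v - w)" using vw by simp
      have "norm (?E v) \<le> norm c / 8 * norm (v - w0)" using \<delta>(2)[of v] v True by simp
      also have "\<dots> \<le> norm c / 8 * (2 * norm (v - w))" using v2 by (intro mult_left_mono) auto
      finally have E2: "norm (?E v) \<le> norm c / 4 * norm (v - w)" by simp
      have "norm c / 8 * s \<le> norm c / 8 * norm (v - w)" using vw by (intro mult_left_mono) auto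
      then have E1': "norm (?E w) \<le> norm c / 8 * norm (v - w)" using E1 by simp
      have "c * (v - w) = (\<Psi> v - \<Psi> w) - (?E v - ?E w)" by (simp add: algebra_simps)
      then have "norm c * norm (v - w) \<le> norm (\<Psi> v - \<Psi> w) + (norm (?E v) + norm (?E w))"
        by (metis (no_types, lifting) norm_mult order_trans[OF norm_triangle_ineq4 add_left_mono[OF norm_triangle_ineq4]])
      then have "5 / 8 * (norm c * norm (v - w)) \<le> norm (\<Psi> v - \<Psi> w)" using E1' E2 by simp
      moreover have "norm c * s \<le> norm c * norm (v - w)" using vw by (intro mult_left_mono) auto
      ultimately show ?thesis using cs by (simp add: dist_norm norm_minus_commute)
    next
      case False
      then have "m \<le> norm (\<Psi> v - \<Psi> w0)" using m(2)[OF v] by simp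
      also have "\<dots> \<le> dist (\<Psi> w) (\<Psi> v) + dist (\<Psi> w) (\<Psi> w0)"
        using dist_triangle[of "\<Psi> v" "\<Psi> w0" "\<Psi> w"] by (simp add: dist_norm norm_minus_commute)
      finally show ?thesis using up s(4) cs by simp
    qed
    have "norm c * s / 2 \<le> infdist (\<Psi> w) (frontier G)"
    proof -
      have "norm c * s / 2 \<le> (INF a\<in>frontier G. dist (\<Psi> w) a)"
        using low w0 by (intro cINF_greatest) (auto simp: fr)
      then show ?thesis using w0 by (auto simp: infdist_def fr)
    qed
    then have "dist (\<Psi> w) (\<Psi> w0) < (1 + 4) * infdist (\<Psi> w) (frontier G)" using up cs by simp
    moreover have "\<Psi> w \<in> G" using im wn s0 by auto
    ultimately have "\<Psi> w \<in> approach_region G 4 (\<Psi> w0)" by (simp add: approach_region_def)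
    moreover have "\<Psi> w \<noteq> \<Psi> w0" using lo cs by (metis dist_self less_le_trans less_numeral_extra(3) mult_pos_pos zero_less_divide_iff zero_less_numeral)
    moreover have "dist (\<Psi> w) (\<Psi> w0) < e" using up s(3) e by simp
    ultimately show "\<exists>z\<in>approach_region G 4 (\<Psi> w0). z \<noteq> \<Psi> w0 \<and> dist z (\<Psi> w0) < e" by blast
  qed
  then show ?thesis by (simp add: trivial_limit_within)
qed

lemma boundary_value_eqI:
  assumes "\<And>\<alpha>. \<alpha> > 0 \<Longrightarrow> (f \<longlongrightarrow> a) (at z within approach_region G \<alpha> z)"
    and "\<beta> > 0" "at z within approach_region G \<beta> z \<noteq> bot"
  shows "boundary_value G f z = a"
  unfolding boundary_value_def
proof (rule the_equality)
  show "\<forall>\<alpha>>0. (f \<longlongrightarrow> a) (at z within approach_region G \<alpha> z)" using assms(1) by blast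
  fix c assume "\<forall>\<alpha>>0. (f \<longlongrightarrow> c) (at z within approach_region G \<alpha> z)"
  then show "c = a" using assms tendsto_unique by blast
qed

text \<open>Near \<open>w0\<close> the quotient \<open>exp (k w) / c\<close> stays within distance 1
  of 1, where the principal logarithm is continuous. Subtracting this logarithm from
  \<open>k\<close> leaves a continuous function with values among the logarithms of
  \<open>c\<close>, a discrete set, hence a constant on the connected set \<open>C\<close>. If
  \<open>S\<close> does not accumulate at \<open>w0\<close>, any logarithm of \<open>c\<close> will
  do.\<close>

lemma exp_convergent_on_convex:
  fixes k :: "complex \<Rightarrow> complex"
  assumes S: "convex S" "w0 \<notin> S" and k: "continuous_on S k" and c: "c \<noteq> 0"
    and lim: "((\<lambda>w. exp (k w)) \<longlongrightarrow> c) (at w0 within S)"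
  obtains \<kappa> where "exp \<kappa> = c" "(k \<longlongrightarrow> \<kappa>) (at w0 within S)"
proof -
  have lim1: "((\<lambda>w. exp (k w) / c) \<longlongrightarrow> 1) (at w0 within S)"
    using tendsto_divide[OF lim tendsto_const c] c by simp
  obtain \<delta> where \<delta>: "\<delta> > 0" "\<And>w. w \<in> S \<Longrightarrow> w \<noteq> w0 \<Longrightarrow> dist w w0 < \<delta> \<Longrightarrow> dist (exp (k w) / c) 1 < 1"
    using tendstoD[OF lim1 zero_less_one] unfolding eventually_at by auto
  define C where "C = S \<inter> ball w0 \<delta>"
  have "w \<noteq> w0" if "w \<in> S" for w using that S(2) by auto
  then have near: "dist (exp (k w) / c) 1 < 1" if "w \<in> C" for w using that \<delta>(2)[of w] by (simp add: C_def dist_commute)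
  have slit: "z \<notin> \<real>\<^sub>\<le>\<^sub>0" if "dist z 1 < 1" for z :: complex
  proof
    assume "z \<in> \<real>\<^sub>\<le>\<^sub>0"
    then have "Re z \<le> 0" by (simp add: complex_nonpos_Reals_iff)
    then show False using that complex_Re_le_cmod[of "1 - z"] by (simp add: dist_norm norm_minus_commute)
  qed
  show ?thesis
  proof (cases "C = {}")
    case True
    have "at w0 within S = bot"
    proof -
      have "\<not> w0 islimpt S"
        unfolding islimpt_approachable using True \<delta>(1) by (auto simp: C_def dist_commute intro!: exI[of _ \<delta>])
      then show ?thesis by (simp add: trivial_limit_within)
    qed
    then show ?thesis using that[of "Ln c"] c by simp
  next
    case False
    define g where "g w = k w - Ln (exp (k w) / c)" for w
    have expg: "exp (g w) = c" if "w \<in> C" for w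
      using c by (simp add: g_def exp_diff)
    have gc: "continuous_on C g"
      unfolding g_def using near slit c
      by (intro continuous_intros continuous_on_subset[OF k]) (auto simp: C_def)
    have "convex C" unfolding C_def by (intro convex_Int S convex_ball)
    have "g constant_on C"
    proof (rule continuous_discrete_range_constant[OF convex_connected[OF \<open>convex C\<close>] gc])
      fix x assume x: "x \<in> C"
      show "\<exists>e>0. \<forall>y. y \<in> C \<and> g y \<noteq> g x \<longrightarrow> e \<le> norm (g y - g x)"
      proof (intro exI[of _ 1] conjI allI impI)
        fix y assume y: "y \<in> C \<and> g y \<noteq> g x"
        have "exp (g y) = exp (g x)" using expg x y by metis
        then obtain n :: int where n: "g y = g x + of_int (2 * n) * of_real pi * \<i>" by (auto simp: exp_eq)
        then have "n \<noteq> 0" using y by auto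
        then have "1 \<le> \<bar>real_of_int n\<bar>" by linarith
        have "norm (g y - g x) = 2 * \<bar>real_of_int n\<bar> * pi" unfolding n by (simp add: norm_mult)
        moreover have "1 * 1 \<le> (2 * \<bar>real_of_int n\<bar>) * pi"
          using \<open>1 \<le> \<bar>real_of_int n\<bar>\<close> pi_gt3 by (intro mult_mono) auto
        ultimately show "1 \<le> norm (g y - g x)" by simp
      qed simp
    qed
    then obtain \<kappa> where \<kappa>: "\<And>w. w \<in> C \<Longrightarrow> g w = \<kappa>" by (auto simp: constant_on_def)
    have "exp \<kappa> = c" using False expg \<kappa> by auto
    moreover have "(k \<longlongrightarrow> \<kappa>) (at w0 within S)"
    proof (rule Lim_transform_eventually)
      have "((\<lambda>w. \<kappa> + Ln (exp (k w) / c)) \<longlongrightarrow> \<kappa> + Ln 1) (at w0 within S)"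
        by (intro tendsto_intros lim1) auto
      then show "((\<lambda>w. \<kappa> + Ln (exp (k w) / c)) \<longlongrightarrow> \<kappa>) (at w0 within S)" by simp
      show "\<forall>\<^sub>F w in at w0 within S. \<kappa> + Ln (exp (k w) / c) = k w"
        unfolding eventually_at using \<delta>(1) \<kappa>
        by (intro exI[of _ \<delta>]) (auto simp: C_def g_def dist_commute algebra_simps)
    qed
    ultimately show ?thesis by (rule that)
  qed
qed

text \<open>The limit a is determined up to a root of unity by |a|^p |c| = |U|^p.\<close>

lemma nontangential_limit_of_root:
  fixes \<Psi> k h g :: "complex \<Rightarrow> complex"
  assumes w0: "norm w0 = 1" and c: "c \<noteq> 0"
    and lim: "((\<lambda>w. (\<Psi> w - \<Psi> w0) / (w - w0)) \<longlongrightarrow> c) (at w0 within cball 0 1)"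
    and hol: "\<Psi> holomorphic_on ball 0 1"
    and im: "\<Psi> ` ball 0 1 = G" and fr: "frontier G = \<Psi> ` sphere 0 1"
    and g: "continuous_on (closure G) g" "\<And>w. w \<in> cball 0 1 \<Longrightarrow> g (\<Psi> w) = w"
    and k: "k holomorphic_on ball 0 1" "\<And>w. w \<in> ball 0 1 \<Longrightarrow> deriv \<Psi> w = exp (k w)"
    and h: "\<And>w. w \<in> ball 0 1 \<Longrightarrow> h (\<Psi> w) = U * exp (- (k w / of_nat p))" and p: "p > 0"
  obtains a where "norm a ^ p * norm c = norm U ^ p"
    "\<And>\<alpha>. \<alpha> > 0 \<Longrightarrow> (h \<longlongrightarrow> a) (at (\<Psi> w0) within approach_region G \<alpha> (\<Psi> w0))"
    "\<And>r. (\<And>n. 0 \<le> r n) \<Longrightarrow> (\<And>n. r n < 1) \<Longrightarrow> r \<longlonglongrightarrow> 1 \<Longrightarrow> (\<lambda>n. h (\<Psi> (of_real (r n) * w0))) \<longlonglongrightarrow> a"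
proof -
  have nin: "w0 \<notin> stolz_region w0 K" for K using w0 by (simp add: stolz_region_def)
  have sub: "stolz_region w0 K \<subseteq> ball 0 1" for K by (auto simp: stolz_region_def)
  have kl: "\<exists>\<kappa>. exp \<kappa> = c \<and> (k \<longlongrightarrow> \<kappa>) (at w0 within stolz_region w0 K)" if K: "K > 0" for K
  proof -
    have "((\<lambda>w. exp (k w)) \<longlongrightarrow> c) (at w0 within stolz_region w0 K)"
    proof (rule Lim_transform_eventually[OF derivative_tendsto_in_stolz_region[OF hol w0 lim K]])
      show "\<forall>\<^sub>F w in at w0 within stolz_region w0 K. deriv \<Psi> w = exp (k w)"
        unfolding eventually_at_filter using k(2) sub by (intro always_eventually) blast
    qed
    moreover have "continuous_on (stolz_region w0 K) k"
      using holomorphic_on_imp_continuous_on[OF k(1)] sub continuous_on_subset by blast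
    ultimately show ?thesis
      using exp_convergent_on_convex[OF convex_stolz_region nin, of K k c] K c by (metis less_imp_le)
  qed
  obtain \<kappa> where \<kappa>: "exp \<kappa> = c" "(k \<longlongrightarrow> \<kappa>) (at w0 within stolz_region w0 1)" using kl[of 1] by auto
  \<comment> \<open>Every larger region contains the one of aperture 1, where the limit is unique;
    this fixes the same logarithm of \<open>c\<close> for all apertures.\<close>
  have \<kappa>K: "(k \<longlongrightarrow> \<kappa>) (at w0 within stolz_region w0 K)" if K: "K \<ge> 1" for K
  proof -
    obtain \<kappa>' where "exp \<kappa>' = c" and \<kappa>': "(k \<longlongrightarrow> \<kappa>') (at w0 within stolz_region w0 K)" using kl[of K] K by auto
    have "(k \<longlongrightarrow> \<kappa>') (at w0 within stolz_region w0 1)" by (rule tendsto_within_subset[OF \<kappa>' stolz_region_mono[OF K]])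
    then have "\<kappa>' = \<kappa>" using \<kappa>(2) stolz_region_nontrivial[OF w0, of 1] tendsto_unique by auto
    then show ?thesis using \<kappa>' by simp
  qed
  define a where "a = U * exp (- (\<kappa> / of_nat p))"
  have HK: "((\<lambda>w. h (\<Psi> w)) \<longlongrightarrow> a) (at w0 within stolz_region w0 K)" if K: "K \<ge> 1" for K
  proof (rule Lim_transform_eventually)
    show "((\<lambda>w. U * exp (- (k w / of_nat p))) \<longlongrightarrow> a) (at w0 within stolz_region w0 K)"
      unfolding a_def using p by (intro tendsto_intros \<kappa>K K) auto
    show "\<forall>\<^sub>F w in at w0 within stolz_region w0 K. U * exp (- (k w / of_nat p)) = h (\<Psi> w)"
      unfolding eventually_at_filter
      by (intro always_eventually allI impI h[symmetric]) (rule subsetD[OF sub])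
  qed
  have z0: "\<Psi> w0 \<in> closure G" "\<Psi> w0 \<notin> G"
  proof -
    have "\<Psi> w0 \<in> frontier G" unfolding fr using w0 by auto
    then show "\<Psi> w0 \<in> closure G" by (simp add: frontier_def)
    show "\<Psi> w0 \<notin> G"
    proof
      assume "\<Psi> w0 \<in> G"
      then have "\<Psi> w0 \<in> \<Psi> ` ball 0 1" by (simp only: im)
      then obtain v where v: "v \<in> ball 0 1" "\<Psi> w0 = \<Psi> v" by blast
      have "w0 = g (\<Psi> w0)" by (rule g(2)[symmetric]) (use w0 in simp)
      also have "\<dots> = g (\<Psi> v)" by (simp only: v(2))
      also have "\<dots> = v" by (rule g(2)) (use v in simp)
      finally have "w0 = v" .
      then show False using v w0 by auto
    qed
  qed
  show ?thesis
  proof (rule that[of a])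
    have "norm a ^ p = norm U ^ p * norm (exp (- (\<kappa> / of_nat p))) ^ p" by (simp add: a_def norm_mult power_mult_distrib)
    also have "norm (exp (- (\<kappa> / of_nat p))) ^ p = norm (exp (- (\<kappa> / of_nat p)) ^ p)" by (simp only: norm_power)
    also have "exp (- (\<kappa> / of_nat p)) ^ p = exp (- \<kappa>)" using p by (simp add: exp_of_nat_mult[symmetric])
    also have "norm (exp (- \<kappa>)) = 1 / norm c" by (simp add: exp_minus \<kappa>(1) norm_inverse norm_divide inverse_eq_divide)
    finally show "norm a ^ p * norm c = norm U ^ p" using c by simp
  next
    fix \<alpha> :: real assume \<alpha>: "\<alpha> > 0"
    obtain \<delta> where \<delta>: "\<delta> > 0" "\<And>w. w \<in> ball 0 1 \<Longrightarrow> norm (w - w0) < \<delta> \<Longrightarrow> \<Psi> w \<in> approach_region G \<alpha> (\<Psi> w0)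
      \<Longrightarrow> w \<in> stolz_region w0 (2 * (1 + \<alpha>))"
      using approach_region_pullback[OF w0 c lim _ \<alpha>, of G] fr by blast
    \<comment> \<open>The inverse \<open>g\<close> of \<Psi> carries points of \<open>?A\<close>
      close to \<open>\<Psi> w0\<close> into \<open>?S\<close>, so the limit of \<open>h\<close>
      composed with \<Psi> in the Stolz region becomes a limit of \<open>h\<close> in
      \<open>?A\<close>.\<close>
    let ?A = "approach_region G \<alpha> (\<Psi> w0)" and ?S = "stolz_region w0 (2 * (1 + \<alpha>))"
    have AG: "?A \<subseteq> G" by (auto simp: approach_region_def)
    have gG: "g z \<in> ball 0 1 \<and> \<Psi> (g z) = z" if zG: "z \<in> G" for z
    proof -
      obtain v where "v \<in> ball 0 1" "z = \<Psi> v" using zG unfolding im[symmetric] by blast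
      then show ?thesis using g(2)[of v] by auto
    qed
    have "(g \<longlongrightarrow> g (\<Psi> w0)) (at (\<Psi> w0) within closure G)" using g(1) z0(1) by (simp add: continuous_on_def)
    then have "(g \<longlongrightarrow> g (\<Psi> w0)) (at (\<Psi> w0) within ?A)"
      by (rule tendsto_within_subset) (use AG closure_subset in blast)
    then have gl: "(g \<longlongrightarrow> w0) (at (\<Psi> w0) within ?A)" using g(2)[of w0] w0 by simp
    have "\<forall>\<^sub>F z in at (\<Psi> w0) within ?A. dist (g z) w0 < \<delta>" using gl \<delta>(1) by (rule tendstoD)
    moreover have "\<forall>\<^sub>F z in at (\<Psi> w0) within ?A. z \<in> ?A" by (simp add: eventually_at_filter)
    ultimately have "\<forall>\<^sub>F z in at (\<Psi> w0) within ?A. g z \<in> ?S \<and> g z \<noteq> w0 \<and> \<Psi> (g z) = z"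
    proof eventually_elim
      case (elim z)
      then have "z \<in> G" using AG by auto
      then show ?case using gG[of z] \<delta>(2)[of "g z"] elim w0 by (auto simp: dist_norm)
    qed
    then have "filterlim g (at w0 within ?S) (at (\<Psi> w0) within ?A)" and ev: "\<forall>\<^sub>F z in at (\<Psi> w0) within ?A. \<Psi> (g z) = z"
      using gl by (auto simp: filterlim_at elim: eventually_mono)
    from filterlim_compose[OF HK this(1), OF _] \<alpha>
    have "((\<lambda>z. h (\<Psi> (g z))) \<longlongrightarrow> a) (at (\<Psi> w0) within ?A)" by simp
    then show "(h \<longlongrightarrow> a) (at (\<Psi> w0) within ?A)"
      by (rule Lim_transform_eventually) (use ev in \<open>auto elim: eventually_mono\<close>)
  next
    fix r :: "nat \<Rightarrow> real" assume r: "\<And>n. 0 \<le> r n" "\<And>n. r n < 1" "r \<longlonglongrightarrow> 1"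
    have "of_real (r n) * w0 \<in> stolz_region w0 1 \<and> of_real (r n) * w0 \<noteq> w0" for n
    proof -
      have "of_real (r n) * w0 - w0 = of_real (r n - 1) * w0" by (simp add: algebra_simps)
      then have "norm (of_real (r n) * w0 - w0) = 1 - r n" using r(2)[of n] w0 by (simp only: norm_mult norm_of_real) simp
      then show ?thesis using r(1,2)[of n] w0 by (auto simp: stolz_region_def norm_mult)
    qed
    moreover have "(\<lambda>n. of_real (r n) * w0) \<longlonglongrightarrow> of_real 1 * w0" by (intro tendsto_intros r(3))
    ultimately have "filterlim (\<lambda>n. of_real (r n) * w0) (at w0 within stolz_region w0 1) sequentially"
      by (simp add: filterlim_at)
    from filterlim_compose[OF HK this] show "(\<lambda>n. h (\<Psi> (of_real (r n) * w0))) \<longlonglongrightarrow> a" by simp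
  qed
qed

text \<open>The data of the boundary correspondence that the estimates need: the parametrization of
  the domain over the unit disk, its boundary derivative x (up to a unimodular factor), and the
  boundary values a of the root h of the derivative of the Riemann map.\<close>

locale root_boundary_data =
  fixes G :: "complex set" and \<gamma> :: "real \<Rightarrow> complex" and h \<Psi> :: "complex \<Rightarrow> complex"
    and \<zeta> :: complex and R :: real and p :: nat
    and r :: "nat \<Rightarrow> real" and x a :: "real \<Rightarrow> complex"
  assumes p: "p \<ge> 1" and R: "R > 0"
    and h_hol: "h holomorphic_on G"
    and Psi_hol: "\<Psi> holomorphic_on ball 0 1" and Psi_cont: "continuous_on (cball 0 1) \<Psi>"
    and Psi_image: "\<Psi> ` ball 0 1 = G" and Psi_0: "\<Psi> 0 = \<zeta>"
    and root_norm: "\<And>w. w \<in> ball 0 1 \<Longrightarrow> norm (h (\<Psi> w)) ^ p * norm (deriv \<Psi> w) = R"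
    and r0: "\<And>n. 0 \<le> r n" and r1: "\<And>n. r n < 1" and r_lim: "r \<longlonglongrightarrow> 1"
    and x_int: "integrable lborel x" and x_zero: "\<And>s. s \<notin> {0..2*pi} \<Longrightarrow> x s = 0"
    and x_L1: "(\<lambda>n. LINT s:{0..2*pi}|lborel. norm (x s - deriv \<Psi> (of_real (r n) * cis s))) \<longlonglongrightarrow> 0"
    and x_AE: "AE s in lborel. s \<in> {0..2*pi} \<longrightarrow> (\<lambda>n. deriv \<Psi> (of_real (r n) * cis s)) \<longlonglongrightarrow> x s"
    and a_meas: "a \<in> borel_measurable borel"
    and a_norm: "AE s in lborel. s \<in> {0..2*pi} \<longrightarrow> norm (a s) ^ p * norm (x s) = R"
    and a_AE: "AE s in lborel. s \<in> {0..2*pi} \<longrightarrow> (\<lambda>n. h (\<Psi> (of_real (r n) * cis s))) \<longlonglongrightarrow> a s"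
    and length_eq: "curve_length \<gamma> 0 1 = (LINT s:{0..2*pi}|lborel. norm (x s))"
    and norm_eq: "\<And>P. smirnov_norm (real p) G \<gamma> (\<lambda>z. h z - poly P z)
        = (LINT s:{0..2*pi}|lborel. norm (a s - poly P (\<Psi> (cis s))) ^ p * norm (x s)) powr (1 / real p)"
    and h_smirnov: "h \<in> smirnov_space (real p) G"

section \<open>Boundary data of a rectifiable Jordan domain\<close>

lemma holomorphic_exp_logarithm_on_disk:
  assumes "f holomorphic_on ball 0 1" "\<And>w. w \<in> ball 0 1 \<Longrightarrow> f w \<noteq> (0::complex)"
  obtains k where "k holomorphic_on ball 0 1" "\<And>w. w \<in> ball 0 1 \<Longrightarrow> f w = exp (k w)"
proof -
  have "simply_connected (ball (0::complex) 1)" by (simp add: convex_imp_simply_connected)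
  then show ?thesis
    using simply_connected_eq_holomorphic_log[of "ball 0 1"] assms that by fastforce
qed

text \<open>The exceptional angles are 0 and 2 pi, the zeros of the boundary density and the angles
  that are not Lebesgue points. At every other angle \<Psi> has a nonzero unrestricted derivative,
  so \<open>h\<close> has a nontangential limit there and the boundary value in \<open>G\<close> is
  unique.\<close>

lemma (in jordan_conformal) root_boundary_data_exists:
  assumes rect: "rectifiable_curve \<gamma>" and \<zeta>: "\<zeta> \<in> G" "\<phi> \<zeta> = 0"
    and p: "p \<ge> (1::nat)" and h: "h holomorphic_on G" "\<And>z. z \<in> G \<Longrightarrow> h z ^ p = deriv \<phi> z"
  obtains \<Psi> r x a where "root_boundary_data G \<gamma> h \<Psi> \<zeta> R p r x a"
proof -
  obtain \<Psi> e where e: "norm e = 1" and cont: "continuous_on (cball 0 1) \<Psi>" and hol: "\<Psi> holomorphic_on ball 0 1"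
    and bijc: "bij_betw \<Psi> (cball 0 1) (closure G)" and bij: "bij_betw \<Psi> (ball 0 1) G"
    and bijs: "bij_betw \<Psi> (sphere 0 1) (path_image \<gamma>)"
    and phi: "\<And>w. w \<in> cball 0 1 \<Longrightarrow> \<phi> (\<Psi> w) = of_real R * e * w" and start: "\<Psi> 1 = \<gamma> 0"
    by (rule disk_parametrization) (rule that; assumption)
  have e0: "e \<noteq> 0" using e by auto
  have R: "R > 0" by (rule R_pos)
  have im: "\<Psi> ` ball 0 1 = G" using bij by (simp add: bij_betw_def)
  have inj: "inj_on \<Psi> (cball 0 1)" using bijc by (simp add: bij_betw_def)
  have fr: "frontier G = \<Psi> ` sphere 0 1" using bijs frontier_G by (simp add: bij_betw_def)
  have inG: "\<Psi> w \<in> G" if "w \<in> ball 0 1" for w using that im by blast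
  have chain: "deriv \<phi> (\<Psi> w) * deriv \<Psi> w = of_real R * e" if w: "w \<in> ball 0 1" for w
  proof -
    have "(\<Psi> has_field_derivative deriv \<Psi> w) (at w)" using hol w by (intro holomorphic_derivI) auto
    moreover have "(\<phi> has_field_derivative deriv \<phi> (\<Psi> w)) (at (\<Psi> w))"
      using hol_phi open_G inG[OF w] by (intro holomorphic_derivI) auto
    ultimately have "((\<phi> \<circ> \<Psi>) has_field_derivative deriv \<phi> (\<Psi> w) * deriv \<Psi> w) (at w)" by (intro DERIV_chain)
    moreover have "((\<lambda>w. of_real R * e * w) has_field_derivative of_real R * e) (at w)" by (auto intro!: derivative_eq_intros)
    then have "((\<phi> \<circ> \<Psi>) has_field_derivative of_real R * e) (at w)"
      by (rule has_field_derivative_transform_within_open[of _ _ _ "ball 0 1"]) (use w phi in auto)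
    ultimately show ?thesis by (rule DERIV_unique)
  qed
  have Psi0: "\<Psi> 0 = \<zeta>"
  proof -
    obtain w where w: "w \<in> ball 0 1" "\<Psi> w = \<zeta>" using \<zeta>(1) unfolding im[symmetric] by blast
    then have "of_real R * e * w = 0" using phi[of w] \<zeta>(2) by auto
    then show ?thesis using w R e0 by auto
  qed
  have dnz: "deriv \<Psi> w \<noteq> 0" if "w \<in> ball 0 1" for w using chain[OF that] R e0 by auto
  obtain k where k: "k holomorphic_on ball 0 1" "\<And>w. w \<in> ball 0 1 \<Longrightarrow> deriv \<Psi> w = exp (k w)"
    using holomorphic_exp_logarithm_on_disk[OF holomorphic_deriv[OF hol open_ball] dnz] by blast
  have root: "h (\<Psi> w) ^ p * exp (k w) = of_real R * e" if "w \<in> ball 0 1" for w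
    using chain[OF that] h(2)[OF inG[OF that]] k(2)[OF that] by simp
  have hPhol: "(\<lambda>w. h (\<Psi> w)) holomorphic_on ball 0 1"
    using holomorphic_on_compose_gen[OF hol h(1)] im by (simp add: o_def)
  \<comment> \<open>The p-th power of \<open>V\<close> is constant, so \<open>V\<close> takes
    finitely many values; being continuous on the connected disk it is a constant \<open>U\<close>.
    This ties the branch of the root \<open>h\<close> to the logarithm \<open>k\<close>.\<close>
  define V where "V w = h (\<Psi> w) * exp (k w / of_nat p)" for w
  have Vp: "V w ^ p = of_real R * e" if "w \<in> ball 0 1" for w
    using root[OF that] p by (simp add: V_def power_mult_distrib exp_of_nat_mult[symmetric])
  have "V constant_on ball 0 1"
  proof (rule continuous_finite_range_constant)
    show "connected (ball (0::complex) 1)" by simp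
    show "continuous_on (ball 0 1) V" unfolding V_def
      using p by (intro holomorphic_on_imp_continuous_on holomorphic_intros hPhol k) auto
    have "V ` ball 0 1 \<subseteq> {z. z ^ p = of_real R * e}" using Vp by auto
    moreover have "finite {z. z ^ p = of_real R * e}" using p by (intro finite_nth_roots) auto
    ultimately show "finite (V ` ball 0 1)" by (rule finite_subset)
  qed
  then obtain U where U: "\<And>w. w \<in> ball 0 1 \<Longrightarrow> V w = U" by (auto simp: constant_on_def)
  have hU: "h (\<Psi> w) = U * exp (- (k w / of_nat p))" if "w \<in> ball 0 1" for w
    using U[OF that] by (simp add: V_def exp_minus field_simps)
  have Up: "norm U ^ p = R"
  proof -
    have "U ^ p = of_real R * e" using Vp[of 0] U[of 0] by simp
    then show ?thesis using e R by (simp add: norm_power[symmetric] norm_mult)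
  qed
  obtain T where T: "continuous_on {0..2*pi} T" "bij_betw T {0..2*pi} {0..1}"
    "\<And>\<theta>. \<theta> \<in> {0..2*pi} \<Longrightarrow> \<gamma> (T \<theta>) = \<Psi> (cis \<theta>)"
    by (rule circle_parameter[OF simple loop continuous_on_subset[OF cont] bijs start]) auto
  have Tlen: "curve_length (\<lambda>\<theta>. \<gamma> (T \<theta>)) c d = curve_length (\<lambda>\<theta>. \<Psi> (cis \<theta>)) c d" if "0 \<le> c" "d \<le> 2 * pi" for c d
    unfolding curve_length_def using T(3) that by (intro arg_cong[where f = Sup] inscribed_lengths_cong) auto
  have bdd: "bdd_above (inscribed_lengths (\<lambda>\<theta>. \<Psi> (cis \<theta>)) 0 (2 * pi))"
  proof -
    have "inscribed_lengths (\<lambda>\<theta>. \<Psi> (cis \<theta>)) 0 (2 * pi) = inscribed_lengths (\<lambda>\<theta>. \<gamma> (T \<theta>)) 0 (2 * pi)"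
      using T(3) by (intro inscribed_lengths_cong) auto
    also have "\<dots> = inscribed_lengths \<gamma> 0 1"
      using monotone_continuous_bij T by (intro inscribed_lengths_reparametrize) auto
    finally show ?thesis using rect by (simp add: rectifiable_curve_def)
  qed
  obtain x :: "real \<Rightarrow> complex" and r :: "nat \<Rightarrow> real" where r: "\<And>n. 0 \<le> r n" "\<And>n. r n < 1" "r \<longlonglongrightarrow> 1"
    and x: "integrable lborel x" "\<And>s. s \<notin> {0..2*pi} \<Longrightarrow> x s = 0"
    and xL1: "(\<lambda>n. LINT s:{0..2*pi}|lborel. norm (x s - deriv \<Psi> (of_real (r n) * cis s))) \<longlonglongrightarrow> 0"
    and xAE: "AE s in lborel. s \<in> {0..2*pi} \<longrightarrow> (\<lambda>n. deriv \<Psi> (of_real (r n) * cis s)) \<longlonglongrightarrow> x s"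
    and xnz: "AE s in lborel. s \<in> {0..2*pi} \<longrightarrow> x s \<noteq> 0"
    and inc: "\<And>u v. 0 \<le> u \<Longrightarrow> u \<le> v \<Longrightarrow> v \<le> 2 * pi \<Longrightarrow> \<Psi> (cis v) - \<Psi> (cis u) = (LINT s:{u..v}|lborel. x s * (\<i> * cis s))"
    by (rule derivative_boundary_density[OF cont hol k(1) _ bdd], rule k(2), assumption) (rule that; assumption)
  \<comment> \<open>\<open>y\<close> is the density of the increments of
    \<open>\<Psi> (cis \<theta>)\<close> in the angle. The factor \<open>\<i> * cis s\<close> is
    unimodular, so \<open>x\<close> and \<open>y\<close> have the same modulus.\<close>
  define y where "y s = x s * (\<i> * cis s)" for s
  define g where "g n s = deriv \<Psi> (of_real (r n) * cis s) * (\<i> * cis s)" for n s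
  have ny: "norm (y s) = norm (x s)" for s by (simp add: y_def norm_mult)
  have [measurable]: "x \<in> borel_measurable borel" using x(1) by auto
  have yI: "integrable lborel y"
  proof (rule Bochner_Integration.integrable_bound[OF x(1)])
    show "y \<in> borel_measurable lborel" by (simp add: y_def[abs_def] cis_conv_exp)
    show "AE s in lborel. norm (y s) \<le> norm (x s)" by (simp add: ny)
  qed
  have ysI: "set_integrable lborel {c..d} y" for c d
    unfolding set_integrable_def by (intro integrable_mult_indicator yI) simp
  have gc: "continuous_on A (g n)" for n A unfolding g_def by (intro continuous_intros circle_increment(2)[OF hol r(1,2) order_refl])
  have ygn: "norm (y s - g n s) = norm (x s - deriv \<Psi> (of_real (r n) * cis s))" for s n
    unfolding y_def g_def left_diff_distrib[symmetric] by (simp add: norm_mult)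
  have ylim: "(\<lambda>n. LINT s:{0..2*pi}|lborel. norm (y s - g n s)) \<longlonglongrightarrow> 0" unfolding ygn by (rule xL1)
  have len: "curve_length (\<lambda>\<theta>. \<Psi> (cis \<theta>)) c d = (LINT s:{c..d}|lborel. norm (x s))" if cd: "0 \<le> c" "c \<le> d" "d \<le> 2 * pi" for c d
    unfolding ny[symmetric]
  proof (rule absolutely_continuous_curve_length(2)[OF cd(2) ysI])
    show "\<Psi> (cis v) - \<Psi> (cis u) = (LINT s:{u..v}|lborel. y s)" if "c \<le> u" "u \<le> v" "v \<le> d" for u v
      unfolding y_def using inc[of u v] that cd by auto
    fix \<epsilon> :: real assume "\<epsilon> > 0"
    then have "\<forall>\<^sub>F n in sequentially. (LINT s:{0..2*pi}|lborel. norm (y s - g n s)) < \<epsilon>" using ylim by (intro order_tendstoD(2))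
    then obtain n where n: "(LINT s:{0..2*pi}|lborel. norm (y s - g n s)) < \<epsilon>"
      using eventually_happens'[OF sequentially_bot] by blast
    have I: "set_integrable lborel {u..v} (\<lambda>s. norm (y s - g n s))" for u v
      by (intro set_integrable_norm set_integral_diff ysI borel_integrable_atLeastAtMost' gc)
    have "(LINT s:{c..d}|lborel. norm (y s - g n s)) \<le> (LINT s:{0..2*pi}|lborel. norm (y s - g n s))"
      unfolding set_lebesgue_integral_def
      by (rule integral_mono[OF I[unfolded set_integrable_def] I[unfolded set_integrable_def]]) (use cd in \<open>auto simp: indicator_def\<close>)
    then show "\<exists>g. continuous_on {c..d} g \<and> (LINT s:{c..d}|lborel. norm (y s - g s)) < \<epsilon>"
      using n gc by (intro exI[of _ "g n"]) auto
  qed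
  have lenT: "curve_length (\<lambda>\<theta>. \<gamma> (T \<theta>)) c d = (LINT s:{c..d}|lborel. norm (x s))" if "0 \<le> c" "c \<le> d" "d \<le> 2 * pi" for c d
    using Tlen len that by simp
  obtain N where N: "negligible N"
    "\<And>\<theta> \<epsilon>. \<theta> \<in> {0<..<2*pi} - N \<Longrightarrow> \<epsilon> > 0 \<Longrightarrow> \<exists>\<delta>>0. \<forall>v. \<bar>v - \<theta>\<bar> < \<delta> \<longrightarrow>
        (LINT s:{min \<theta> v..max \<theta> v}|lborel. norm (y s - y \<theta>)) \<le> \<epsilon> * \<bar>v - \<theta>\<bar>"
    by (rule lebesgue_points[OF ysI gc ylim]) blast
  have quot: "((\<lambda>w. (\<Psi> w - \<Psi> (cis \<theta>)) / (w - cis \<theta>)) \<longlongrightarrow> x \<theta>) (at (cis \<theta>) within cball 0 1)"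
    if th: "\<theta> \<in> {0<..<2*pi} - N" for \<theta>
  proof (rule boundary_derivative_unrestricted[OF cont hol])
    have "((\<lambda>s. \<Psi> (cis s)) has_vector_derivative y \<theta>) (at \<theta>)"
      by (rule set_integral_signed_derivative[OF ysI[of 0 "2*pi"] _ _ _ N(2)[OF th]]) (use inc th in \<open>auto simp: y_def\<close>)
    then have "((\<lambda>w. (\<Psi> w - \<Psi> (cis \<theta>)) / (w - cis \<theta>)) \<longlongrightarrow> y \<theta> / (\<i> * cis \<theta>)) (at (cis \<theta>) within sphere 0 1)"
      by (rule has_vector_derivative_circle_imp_quotient)
    then show "((\<lambda>w. (\<Psi> w - \<Psi> (cis \<theta>)) / (w - cis \<theta>)) \<longlongrightarrow> x \<theta>) (at (cis \<theta>) within sphere 0 1)"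
      by (simp add: y_def)
  qed simp
  define inv where "inv z = \<phi> z / (of_real R * e)" for z
  have invc: "continuous_on (closure G) inv" unfolding inv_def using R e0 by (intro continuous_intros cont_phi) auto
  have inv: "inv (\<Psi> w) = w" if "w \<in> cball 0 1" for w unfolding inv_def phi[OF that] using R e0 by simp
  define good where "good \<theta> A \<longleftrightarrow> norm A ^ p * norm (x \<theta>) = R \<and>
     (\<forall>\<alpha>>0. (h \<longlongrightarrow> A) (at (\<Psi> (cis \<theta>)) within approach_region G \<alpha> (\<Psi> (cis \<theta>)))) \<and>
     (\<lambda>n. h (\<Psi> (of_real (r n) * cis \<theta>))) \<longlonglongrightarrow> A" for \<theta> A
  have exg: "\<exists>A. good \<theta> A" if th: "\<theta> \<in> {0<..<2*pi} - N" "x \<theta> \<noteq> 0" for \<theta>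
  proof -
    have nc: "norm (cis \<theta>) = 1" by simp
    have "p > 0" using p by simp
    from nontangential_limit_of_root[OF nc th(2) quot[OF th(1)] hol im fr invc inv k hU this]
    obtain A where "norm A ^ p * norm (x \<theta>) = norm U ^ p"
      "\<And>\<alpha>. \<alpha> > 0 \<Longrightarrow> (h \<longlongrightarrow> A) (at (\<Psi> (cis \<theta>)) within approach_region G \<alpha> (\<Psi> (cis \<theta>)))"
      "\<And>r. (\<And>n. 0 \<le> r n) \<Longrightarrow> (\<And>n. r n < 1) \<Longrightarrow> r \<longlonglongrightarrow> 1 \<Longrightarrow> (\<lambda>n. h (\<Psi> (of_real (r n) * cis \<theta>))) \<longlonglongrightarrow> A"
      by blast
    then show ?thesis using r Up by (auto simp: good_def)
  qed
  \<comment> \<open>A limit of a sequence of continuous functions, defined at every angle, so that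
    \<open>a\<close> is Borel measurable; at good angles it is the nontangential limit.\<close>
  define a where "a \<theta> = lim (\<lambda>n. h (\<Psi> (of_real (r n) * cis \<theta>)))" for \<theta>
  have agood: "good \<theta> (a \<theta>)" if th: "\<theta> \<in> {0<..<2*pi} - N" "x \<theta> \<noteq> 0" for \<theta>
  proof -
    obtain A where A: "good \<theta> A" using exg[OF th] by blast
    then have "a \<theta> = A" unfolding a_def good_def by (intro limI) auto
    then show ?thesis using A by simp
  qed
  have AEg: "AE s in lborel. s \<in> {0..2*pi} \<longrightarrow> s \<in> {0<..<2*pi} - N \<and> x s \<noteq> 0"
  proof -
    have "negligible (N \<union> {0, 2*pi})" using N(1) by (intro negligible_Un) auto
    then have "N \<union> {0, 2*pi} \<in> null_sets lebesgue" by (simp add: negligible_iff_null_sets)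
    then have "AE s in lebesgue. s \<notin> N \<union> {0, 2*pi}" by (rule AE_not_in)
    then have "AE s in lborel. s \<notin> N \<union> {0, 2*pi}" by (simp only: AE_completion_iff)
    with xnz show ?thesis by eventually_elim auto
  qed
  have hPc: "continuous_on A (\<lambda>s. h (\<Psi> (of_real (r n) * cis s)))" for n A
    by (intro continuous_on_compose2[OF holomorphic_on_imp_continuous_on[OF hPhol]] continuous_intros)
       (use r in \<open>auto simp: norm_mult\<close>)
  have [measurable]: "a \<in> borel_measurable borel"
    unfolding a_def by (intro borel_measurable_lim_metric borel_measurable_continuous_onI hPc)
  have bv: "boundary_value G (\<lambda>z. h z - poly P z) (\<Psi> (cis \<theta>)) = a \<theta> - poly P (\<Psi> (cis \<theta>))"
    if th: "\<theta> \<in> {0<..<2*pi} - N" "x \<theta> \<noteq> 0" for \<theta> P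
  proof (rule boundary_value_eqI[where \<beta> = 4])
    show "((\<lambda>z. h z - poly P z) \<longlongrightarrow> a \<theta> - poly P (\<Psi> (cis \<theta>))) (at (\<Psi> (cis \<theta>)) within approach_region G \<alpha> (\<Psi> (cis \<theta>)))" if "\<alpha> > 0" for \<alpha>
      using agood[OF th] that unfolding good_def by (intro tendsto_intros) auto
    show "at (\<Psi> (cis \<theta>)) within approach_region G 4 (\<Psi> (cis \<theta>)) \<noteq> bot"
      by (rule approach_region_nontrivial[OF _ th(2) quot[OF th(1)] cont inj fr]) (use im in auto)
  qed simp
  have Pc: "continuous_on A (\<lambda>s. poly P (\<Psi> (cis s)))" for A P
    by (intro continuous_intros continuous_on_compose2[OF cont]) auto
  show ?thesis
  proof (rule that, unfold_locales)
    show "1 \<le> p" "0 < R" "h holomorphic_on G" "\<Psi> holomorphic_on ball 0 1" "continuous_on (cball 0 1) \<Psi>"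
      "\<Psi> ` ball 0 1 = G" "\<Psi> 0 = \<zeta>" by fact+
    show "norm (h (\<Psi> w)) ^ p * norm (deriv \<Psi> w) = R" if "w \<in> ball 0 1" for w
    proof -
      have "norm (h (\<Psi> w) ^ p * exp (k w)) = R" unfolding root[OF that] using e R by (simp add: norm_mult)
      then show ?thesis unfolding k(2)[OF that] by (simp only: norm_mult norm_power)
    qed
    show "0 \<le> r n" "r n < 1" for n by (rule r)+
    show "r \<longlonglongrightarrow> 1" "integrable lborel x" by (rule r x)+
    show "x s = 0" if "s \<notin> {0..2*pi}" for s by (rule x(2)[OF that])
    show "(\<lambda>n. LINT s:{0..2*pi}|lborel. norm (x s - deriv \<Psi> (of_real (r n) * cis s))) \<longlonglongrightarrow> 0" by (rule xL1)
    show "AE s in lborel. s \<in> {0..2*pi} \<longrightarrow> (\<lambda>n. deriv \<Psi> (of_real (r n) * cis s)) \<longlonglongrightarrow> x s" by (rule xAE)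
    show "a \<in> borel_measurable borel" by simp
    show "AE s in lborel. s \<in> {0..2*pi} \<longrightarrow> norm (a s) ^ p * norm (x s) = R"
      using AEg by eventually_elim (use agood in \<open>auto simp: good_def\<close>)
    show "AE s in lborel. s \<in> {0..2*pi} \<longrightarrow> (\<lambda>n. h (\<Psi> (of_real (r n) * cis s))) \<longlonglongrightarrow> a s"
      using AEg by eventually_elim (use agood in \<open>auto simp: good_def\<close>)
    show "curve_length \<gamma> 0 1 = (LINT s:{0..2*pi}|lborel. norm (x s))"
      by (rule arc_measure_eq_distr(2)[OF T(1,2) x lenT])
    show "smirnov_norm (real p) G \<gamma> (\<lambda>z. h z - poly P z)
        = (LINT s:{0..2*pi}|lborel. norm (a s - poly P (\<Psi> (cis s))) ^ p * norm (x s)) powr (1 / real p)" for P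
    proof -
      have "(LINT t|arc_measure \<gamma>. norm (boundary_value G (\<lambda>z. h z - poly P z) (\<gamma> t)) powr real p)
        = (LINT s:{0..2*pi}|lborel. norm (a s - poly P (\<Psi> (cis s))) ^ p * norm (x s))"
      proof (rule integral_arc_measure[OF T(1,2) x lenT])
        have [measurable]: "(\<lambda>s. poly P (\<Psi> (cis s))) \<in> borel_measurable borel" by (intro borel_measurable_continuous_onI Pc)
        show "(\<lambda>s. norm (a s - poly P (\<Psi> (cis s))) ^ p) \<in> borel_measurable borel" by measurable
        show "AE s in lborel. s \<in> {0..2*pi} \<longrightarrow>
            norm (boundary_value G (\<lambda>z. h z - poly P z) (\<gamma> (T s))) powr real p = norm (a s - poly P (\<Psi> (cis s))) ^ p"
          using AEg
        proof eventually_elim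
          case (elim s)
          show ?case
          proof
            assume s: "s \<in> {0..2*pi}"
            then show "norm (boundary_value G (\<lambda>z. h z - poly P z) (\<gamma> (T s))) powr real p = norm (a s - poly P (\<Psi> (cis s))) ^ p"
              using bv[of s P] elim T(3)[OF s] p by (simp add: powr_realpow')
          qed
        qed
      qed
      then show ?thesis by (simp add: smirnov_norm_def)
    qed
    show "h \<in> smirnov_space (real p) G"
      unfolding smirnov_space_def
    proof (intro CollectI conjI exI)
      show "h holomorphic_on G" by fact
      show "(0::real) < 1" by simp
      show "\<Psi> holomorphic_on ball 0 1" "bij_betw \<Psi> (ball 0 1) G" "k holomorphic_on ball 0 1" by fact+
      show "\<forall>w\<in>ball 0 1. exp (k w) = deriv \<Psi> w" using k(2) by simp
      \<comment> \<open>The function whose membership in the Hardy space is asked for is the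
        constant \<open>U\<close>, so its circle means do not depend on the radius.\<close>
      have c: "h (\<Psi> w) * exp (k w / of_real (real p)) = U" if "w \<in> ball 0 1" for w
        using U[OF that] by (simp add: V_def)
      show "(\<lambda>w. h (\<Psi> w) * exp (k w / of_real (real p))) \<in> hardy_space (real p) 1"
        unfolding hardy_space_def
      proof (intro CollectI conjI)
        show "(\<lambda>w. h (\<Psi> w) * exp (k w / of_real (real p))) holomorphic_on ball 0 1"
          using p by (intro holomorphic_intros hPhol k) auto
        have "integral {0..2 * pi} (\<lambda>\<theta>. norm (h (\<Psi> (of_real t * cis \<theta>)) * exp (k (of_real t * cis \<theta>) / of_real (real p))) powr real p)
           = integral {0..2 * pi} (\<lambda>\<theta>. norm U powr real p)" if "t \<in> {0<..<1}" for t
          by (intro integral_cong) (use c[of "of_real t * cis _"] that in \<open>simp add: norm_mult\<close>)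
        then show "bdd_above ((\<lambda>t. integral {0..2 * pi} (\<lambda>\<theta>. norm (h (\<Psi> (of_real t * cis \<theta>)) * exp (k (of_real t * cis \<theta>) / of_real (real p))) powr real p)) ` {0<..<1})"
          by (intro bdd_aboveI[of _ "integral {0..2 * pi} (\<lambda>\<theta>. norm U powr real p)"]) auto
      qed
    qed
  qed
qed

section \<open>The norm estimates\<close>

text \<open>Young's inequality cleared of denominators; it is Bernoulli's inequality for
  \<open>s / t\<close>, multiplied by \<open>t ^ p\<close>.\<close>

lemma weighted_power_bound:
  fixes s t :: real
  assumes "s \<ge> 0" "t \<ge> 0" "p \<ge> 1"
  shows "real p * s * t ^ (p - 1) \<le> s ^ p + real (p - 1) * t ^ p"
proof (cases "t = 0")
  case True
  then show ?thesis using assms by (cases "p = 1") (auto simp: power_0_left)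
next
  case False
  have "1 + real p * (s / t - 1) \<le> (1 + (s / t - 1)) ^ p"
    using assms by (intro Bernoulli_inequality) simp
  then have "t ^ p * (1 + real p * (s / t - 1)) \<le> t ^ p * (s / t) ^ p"
    using assms by (intro mult_left_mono) auto
  also have "t ^ p * (s / t) ^ p = s ^ p" using False by (simp add: power_mult_distrib[symmetric])
  also have "t ^ p * (1 + real p * (s / t - 1)) = real p * s * t ^ (p - 1) - real (p - 1) * t ^ p"
  proof -
    obtain q where q: "p = Suc q" using assms(3) by (cases p) auto
    show ?thesis unfolding q using False by (simp add: field_simps)
  qed
  finally show ?thesis by simp
qed

lemma integrable_mult_power:
  fixes f g :: "'a \<Rightarrow> real"
  assumes p: "p \<ge> 1" and f: "integrable M (\<lambda>s. f s ^ p)" "f \<in> borel_measurable M" "\<And>s. f s \<ge> 0"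
    and g: "integrable M (\<lambda>s. g s ^ p)" "g \<in> borel_measurable M" "\<And>s. g s \<ge> 0"
  shows "integrable M (\<lambda>s. f s * g s ^ (p - 1))"
proof (rule Bochner_Integration.integrable_bound)
  show "integrable M (\<lambda>s. f s ^ p + real (p - 1) * g s ^ p)" using f g by simp
  show "(\<lambda>s. f s * g s ^ (p - 1)) \<in> borel_measurable M" using f(2) g(2) by simp
  show "AE s in M. norm (f s * g s ^ (p - 1)) \<le> norm (f s ^ p + real (p - 1) * g s ^ p)"
  proof (rule AE_I2)
    fix s
    have "1 * (f s * g s ^ (p - 1)) \<le> real p * (f s * g s ^ (p - 1))"
      using p f(3) g(3) by (intro mult_right_mono) auto
    also have "\<dots> \<le> f s ^ p + real (p - 1) * g s ^ p"
      using weighted_power_bound[OF f(3) g(3) p, of s s] by (simp add: mult.assoc)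
    finally show "norm (f s * g s ^ (p - 1)) \<le> norm (f s ^ p + real (p - 1) * g s ^ p)"
      using f(3) g(3) by simp
  qed
qed

text \<open>Young's inequality after division by bounds for the two norms. The bounds are taken
  strictly above \<open>A\<close> and \<open>B\<close> to make them positive, and then lowered to
  these. Norms enter through their p-th powers, which avoids roots.\<close>

lemma holder_power:
  fixes f g :: "'a \<Rightarrow> real"
  assumes p: "p \<ge> 1" and f: "integrable M (\<lambda>s. f s ^ p)" "f \<in> borel_measurable M" "\<And>s. f s \<ge> 0"
    and g: "integrable M (\<lambda>s. g s ^ p)" "g \<in> borel_measurable M" "\<And>s. g s \<ge> 0"
    and A: "A \<ge> 0" "(\<integral>s. f s ^ p \<partial>M) \<le> A ^ p" and B: "B \<ge> 0" "(\<integral>s. g s ^ p \<partial>M) \<le> B ^ p"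
  shows "(\<integral>s. f s * g s ^ (p - 1) \<partial>M) \<le> A * B ^ (p - 1)"
proof -
  note I = integrable_mult_power[OF p f g]
  have pos: "(\<integral>s. f s * g s ^ (p - 1) \<partial>M) \<le> A' * B' ^ (p - 1)" if A': "A' > A" and B': "B' > B" for A' B'
  proof -
    have AB: "A' > 0" "B' > 0" using A B A' B' by auto
    have "(\<integral>s. real p * (f s * g s ^ (p - 1)) / (A' * B' ^ (p - 1)) \<partial>M) \<le> (\<integral>s. f s ^ p / A' ^ p + real (p - 1) * g s ^ p / B' ^ p \<partial>M)"
    proof (rule integral_mono)
      show "integrable M (\<lambda>s. real p * (f s * g s ^ (p - 1)) / (A' * B' ^ (p - 1)))" using I by simp
      show "integrable M (\<lambda>s. f s ^ p / A' ^ p + real (p - 1) * g s ^ p / B' ^ p)" using f g by simp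
      show "real p * (f s * g s ^ (p - 1)) / (A' * B' ^ (p - 1)) \<le> f s ^ p / A' ^ p + real (p - 1) * g s ^ p / B' ^ p" for s
        using weighted_power_bound[of "f s / A'" "g s / B'" p] f(3)[of s] g(3)[of s] AB p by (simp add: power_divide)
    qed
    also have "\<dots> = (\<integral>s. f s ^ p \<partial>M) / A' ^ p + real (p - 1) * (\<integral>s. g s ^ p \<partial>M) / B' ^ p"
      using f g by simp
    also have "\<dots> \<le> 1 + real (p - 1) * 1"
    proof (intro add_mono)
      have "(\<integral>s. f s ^ p \<partial>M) \<le> A' ^ p" using A(2) power_mono[of A A' p] A(1) A' by simp
      then show "(\<integral>s. f s ^ p \<partial>M) / A' ^ p \<le> 1" using AB by simp
      have "(\<integral>s. g s ^ p \<partial>M) \<le> B' ^ p" using B(2) power_mono[of B B' p] B(1) B' by simp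
      then have "(\<integral>s. g s ^ p \<partial>M) / B' ^ p \<le> 1" using AB by simp
      then have "real (p - 1) * ((\<integral>s. g s ^ p \<partial>M) / B' ^ p) \<le> real (p - 1) * 1" by (intro mult_left_mono) auto
      then show "real (p - 1) * (\<integral>s. g s ^ p \<partial>M) / B' ^ p \<le> real (p - 1) * 1" by simp
    qed
    also have "\<dots> = real p" using p by simp
    finally have "real p * ((\<integral>s. f s * g s ^ (p - 1) \<partial>M) / (A' * B' ^ (p - 1))) \<le> real p * 1" by simp
    then have "(\<integral>s. f s * g s ^ (p - 1) \<partial>M) / (A' * B' ^ (p - 1)) \<le> 1" using p by (simp only: mult_le_cancel_left_pos)
    then show ?thesis using AB by (simp add: divide_le_eq)
  qed
  have ev: "\<forall>\<^sub>F e in at_right 0. (\<integral>s. f s * g s ^ (p - 1) \<partial>M) \<le> (A + e) * (B + e) ^ (p - 1)"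
  proof (rule eventually_at_rightI[of 0 1])
    fix e :: real assume "e \<in> {0<..<1}"
    then show "(\<integral>s. f s * g s ^ (p - 1) \<partial>M) \<le> (A + e) * (B + e) ^ (p - 1)" by (intro pos) auto
  qed simp
  have "((\<lambda>e. (A + e) * (B + e) ^ (p - 1)) \<longlongrightarrow> (A + 0) * (B + 0) ^ (p - 1)) (at_right 0)" by (intro tendsto_intros)
  from tendsto_lowerbound[OF this ev] show ?thesis by simp
qed

text \<open>Convexity of the p-th power: (f + g) / (A' + B') is the mean of f / A' and g / B' with
  weights proportional to A' and B'. Comparing both with this mean by Young's inequality gives the
  pointwise bound; integration and the passage from A', B' to \<open>A\<close>, \<open>B\<close>
  finish it.\<close>

lemma minkowski_power:
  fixes f g :: "'a \<Rightarrow> real"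
  assumes p: "p \<ge> 1" and f: "integrable M (\<lambda>s. f s ^ p)" "f \<in> borel_measurable M" "\<And>s. f s \<ge> 0"
    and g: "integrable M (\<lambda>s. g s ^ p)" "g \<in> borel_measurable M" "\<And>s. g s \<ge> 0"
    and A: "A \<ge> 0" "(\<integral>s. f s ^ p \<partial>M) \<le> A ^ p" and B: "B \<ge> 0" "(\<integral>s. g s ^ p \<partial>M) \<le> B ^ p"
  shows "integrable M (\<lambda>s. (f s + g s) ^ p)" "(\<integral>s. (f s + g s) ^ p \<partial>M) \<le> (A + B) ^ p"
proof -
  have pw: "(f s + g s) ^ p \<le> (A' + B') ^ (p - 1) * (f s ^ p / A' ^ (p - 1) + g s ^ p / B' ^ (p - 1))"
    if AB: "A' > 0" "B' > 0" for A' B' s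
  proof -
    define S where "S = A' + B'"
    have S: "S > 0" using AB by (simp add: S_def)
    define m where "m = (f s + g s) / S"
    have m0: "m \<ge> 0" using f(3)[of s] g(3)[of s] S by (simp add: m_def)
    have 1: "A' * (real p * (f s / A') * m ^ (p - 1)) \<le> A' * ((f s / A') ^ p + real (p - 1) * m ^ p)"
      using weighted_power_bound[of "f s / A'" m p] f(3)[of s] m0 AB p by (intro mult_left_mono) auto
    have 2: "B' * (real p * (g s / B') * m ^ (p - 1)) \<le> B' * ((g s / B') ^ p + real (p - 1) * m ^ p)"
      using weighted_power_bound[of "g s / B'" m p] g(3)[of s] m0 AB p by (intro mult_left_mono) auto
    have mp: "m * m ^ (p - 1) = m ^ p" using p by (cases p) auto
    have "A' * (real p * (f s / A') * m ^ (p - 1)) + B' * (real p * (g s / B') * m ^ (p - 1)) = real p * (f s + g s) * m ^ (p - 1)"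
      using AB by (simp add: algebra_simps)
    also have "\<dots> = real p * S * (m * m ^ (p - 1))" using S by (simp add: m_def)
    also have "\<dots> = real p * S * m ^ p" by (simp only: mp)
    finally have "real p * S * m ^ p \<le> A' * (f s / A') ^ p + B' * (g s / B') ^ p + real (p - 1) * S * m ^ p"
      using 1 2 by (simp add: S_def algebra_simps)
    moreover have "real p * S * m ^ p - real (p - 1) * S * m ^ p = S * m ^ p" using p by (simp add: of_nat_diff algebra_simps)
    ultimately have "S * m ^ p \<le> A' * (f s / A') ^ p + B' * (g s / B') ^ p" by linarith
    then have "S ^ (p - 1) * (S * m ^ p) \<le> S ^ (p - 1) * (A' * (f s / A') ^ p + B' * (g s / B') ^ p)"
      using S by (intro mult_left_mono) auto
    moreover have "S ^ (p - 1) * (S * m ^ p) = (f s + g s) ^ p"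
    proof -
      have "S ^ (p - 1) * S = S ^ p" using p by (cases p) auto
      then have "S ^ (p - 1) * (S * m ^ p) = S ^ p * m ^ p" by (simp only: mult.assoc[symmetric])
      also have "\<dots> = (f s + g s) ^ p" using S by (simp add: m_def power_mult_distrib[symmetric])
      finally show ?thesis .
    qed
    moreover have "c * (t / c) ^ p = t ^ p / c ^ (p - 1)" if "c > 0" for c t :: real
      using p that by (cases p) (auto simp: power_divide field_simps)
    ultimately show ?thesis using AB by (simp only: S_def)
  qed
  show I: "integrable M (\<lambda>s. (f s + g s) ^ p)"
  proof (rule Bochner_Integration.integrable_bound)
    show "integrable M (\<lambda>s. 2 ^ (p - 1) * (f s ^ p + g s ^ p))" using f g by simp
    show "(\<lambda>s. (f s + g s) ^ p) \<in> borel_measurable M" using f g by simp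
    show "AE s in M. norm ((f s + g s) ^ p) \<le> norm (2 ^ (p - 1) * (f s ^ p + g s ^ p))"
      using pw[of 1 1] f(3) g(3) by (intro AE_I2) simp
  qed
  have pos: "(\<integral>s. (f s + g s) ^ p \<partial>M) \<le> (A' + B') ^ p" if A': "A' > A" and B': "B' > B" for A' B'
  proof -
    have AB: "A' > 0" "B' > 0" using A B A' B' by auto
    have "(\<integral>s. (f s + g s) ^ p \<partial>M) \<le> (\<integral>s. (A' + B') ^ (p - 1) * (f s ^ p / A' ^ (p - 1) + g s ^ p / B' ^ (p - 1)) \<partial>M)"
      using f g by (intro integral_mono I pw AB) simp
    also have "\<dots> = (A' + B') ^ (p - 1) * ((\<integral>s. f s ^ p \<partial>M) / A' ^ (p - 1) + (\<integral>s. g s ^ p \<partial>M) / B' ^ (p - 1))"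
      using f g by simp
    also have "\<dots> \<le> (A' + B') ^ (p - 1) * (A' + B')"
    proof (intro mult_left_mono add_mono)
      have cancel: "c ^ p = c * c ^ (p - 1)" for c :: real using p by (cases p) auto
      have "(\<integral>s. f s ^ p \<partial>M) \<le> A' ^ p" using A(2) power_mono[of A A' p] A(1) A' by simp
      then show "(\<integral>s. f s ^ p \<partial>M) / A' ^ (p - 1) \<le> A'" using AB by (simp add: divide_le_eq cancel)
      have "(\<integral>s. g s ^ p \<partial>M) \<le> B' ^ p" using B(2) power_mono[of B B' p] B(1) B' by simp
      then show "(\<integral>s. g s ^ p \<partial>M) / B' ^ (p - 1) \<le> B'" using AB by (simp add: divide_le_eq cancel)
    qed (use AB in simp)
    also have "\<dots> = (A' + B') ^ p" using p by (cases p) auto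
    finally show ?thesis .
  qed
  have ev: "\<forall>\<^sub>F e in at_right 0. (\<integral>s. (f s + g s) ^ p \<partial>M) \<le> ((A + e) + (B + e)) ^ p"
  proof (rule eventually_at_rightI[of 0 1])
    fix e :: real assume "e \<in> {0<..<1}"
    then show "(\<integral>s. (f s + g s) ^ p \<partial>M) \<le> ((A + e) + (B + e)) ^ p" by (intro pos) auto
  qed simp
  have "((\<lambda>e. ((A + e) + (B + e)) ^ p) \<longlongrightarrow> ((A + 0) + (B + 0)) ^ p) (at_right 0)" by (intro tendsto_intros)
  from tendsto_lowerbound[OF this ev] show "(\<integral>s. (f s + g s) ^ p \<partial>M) \<le> (A + B) ^ p" by simp
qed

lemma norm_power_diff_le:
  fixes a q :: complex
  assumes "n \<ge> 1"
  shows "norm (a ^ n - q ^ n) \<le> norm (a - q) * (norm a + norm q) ^ (n - 1)"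
  using assms
proof (induction n rule: nat_induct_at_least)
  case base
  then show ?case by simp
next
  case (Suc n)
  obtain m where m: "n = Suc m" using Suc(1) by (cases n) auto
  let ?S = "norm a + norm q"
  have "a ^ Suc n - q ^ Suc n = a * (a ^ n - q ^ n) + (a - q) * q ^ n" by (simp add: algebra_simps)
  then have "norm (a ^ Suc n - q ^ Suc n) \<le> norm a * norm (a ^ n - q ^ n) + norm (a - q) * norm q ^ n"
    using norm_triangle_ineq[of "a * (a ^ n - q ^ n)" "(a - q) * q ^ n"] by (simp only: norm_mult norm_power)
  also have "\<dots> \<le> norm a * (norm (a - q) * ?S ^ (n - 1)) + norm (a - q) * (norm q * ?S ^ (n - 1))"
  proof (intro add_mono mult_left_mono Suc.IH)
    have "norm q ^ n = norm q * norm q ^ (n - 1)" by (simp add: m)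
    also have "\<dots> \<le> norm q * ?S ^ (n - 1)" by (intro mult_left_mono power_mono) auto
    finally show "norm q ^ n \<le> norm q * ?S ^ (n - 1)" .
  qed auto
  also have "\<dots> = norm (a - q) * ?S ^ (Suc n - 1)" by (simp add: m algebra_simps)
  finally show ?case .
qed

text \<open>The factor 1/2: the two arcs between boundary points both bound the increment of g, and the
  mean of g over each circle is g 0 = 0.\<close>

lemma norm_le_half_circle_integral:
  assumes hol: "g holomorphic_on ball 0 1" and g0: "g 0 = 0" and r: "0 < r" "r < 1" and w: "norm w \<le> r"
  shows "norm (g w) \<le> r / 2 * (LINT s:{0..2*pi}|lborel. norm (deriv g (of_real r * cis s)))"
proof -
  let ?N = "\<lambda>u v. r * (LINT s:{u..v}|lborel. norm (deriv g (of_real r * cis s)))"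
  let ?g = "\<lambda>s. g (of_real r * cis s)"
  have r0: "0 \<le> r" using r by simp
  have dc: "continuous_on A (\<lambda>s. deriv g (of_real r * cis s))" for A by (rule circle_increment(2)[OF hol r0 r(2) order_refl])
  have arc: "norm (?g v - ?g u) \<le> ?N u v" if "u \<le> v" for u v
  proof -
    have "norm (?g v - ?g u) \<le> (LINT s:{u..v}|lborel. norm (deriv g (of_real r * cis s) * (of_real r * (\<i> * cis s))))"
      unfolding circle_increment(1)[OF hol r0 r(2) that]
      by (rule set_integral_norm_bound) (intro borel_integrable_atLeastAtMost' continuous_intros dc)
    also have "\<dots> = (LINT s:{u..v}|lborel. r * norm (deriv g (of_real r * cis s)))"
      using r by (simp add: norm_mult mult.commute)
    finally show ?thesis by simp
  qed
  have Nadd: "?N u w = ?N u v + ?N v w" if "u \<le> v" "v \<le> w" for u v w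
  proof -
    have "set_integrable lborel {u..w} (\<lambda>s. norm (deriv g (of_real r * cis s)))"
      by (intro borel_integrable_atLeastAtMost' continuous_intros dc)
    from set_integral_combine[OF this that] show ?thesis by (simp only: distrib_left)
  qed
  have osc: "norm (?g v - ?g u) \<le> ?N 0 (2*pi) / 2" if uv: "0 \<le> u" "u \<le> v" "v \<le> 2*pi" for u v
  proof -
    have "?g v - ?g u = (?g 0 - ?g u) - (?g (2*pi) - ?g v)" by simp
    then have "norm (?g v - ?g u) \<le> norm (?g u - ?g 0) + norm (?g (2*pi) - ?g v)"
      using norm_triangle_ineq4[of "?g 0 - ?g u" "?g (2*pi) - ?g v"] by (simp only: norm_minus_commute[of "?g 0"])
    also have "\<dots> \<le> ?N 0 u + ?N v (2*pi)" using uv by (intro add_mono arc) auto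
    finally have "2 * norm (?g v - ?g u) \<le> ?N 0 u + ?N u v + ?N v (2*pi)" using arc[OF uv(2)] by simp
    also have "\<dots> = ?N 0 (2*pi)" using Nadd[of 0 u "2*pi"] Nadd[of u v "2*pi"] uv by simp
    finally show ?thesis by simp
  qed
  have circle: "norm (?g \<alpha>) \<le> ?N 0 (2*pi) / 2" if \<alpha>: "0 \<le> \<alpha>" "\<alpha> \<le> 2*pi" for \<alpha>
  proof -
    have gc: "continuous_on A ?g" for A
      by (intro continuous_on_compose2[OF holomorphic_on_imp_continuous_on[OF hol]] continuous_intros) (use r in \<open>auto simp: norm_mult\<close>)
    have I: "set_integrable lborel {0..2*pi} ?g" "set_integrable lborel {0..2*pi} (\<lambda>s. ?g \<alpha>)"
      by (intro borel_integrable_atLeastAtMost' continuous_intros gc)+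
    have "(LINT s:{0..2*pi}|lborel. ?g \<alpha> - ?g s) = (LINT s:{0..2*pi}|lborel. ?g \<alpha>) - (LINT s:{0..2*pi}|lborel. ?g s)"
      by (rule set_integral_diff(2)[OF I(2,1)])
    also have "(LINT s:{0..2*pi}|lborel. ?g s) = 0" using holomorphic_circle_mean[OF hol r0 r(2)] g0 by simp
    also have "(LINT s:{0..2*pi}|lborel. ?g \<alpha>) = (2 * pi) *\<^sub>R ?g \<alpha>" by (simp add: set_integral_const)
    finally have "2 * pi * norm (?g \<alpha>) = norm (LINT s:{0..2*pi}|lborel. ?g \<alpha> - ?g s)" by simp
    also have "\<dots> \<le> (LINT s:{0..2*pi}|lborel. norm (?g \<alpha> - ?g s))"
      by (rule set_integral_norm_bound[OF set_integral_diff(1)[OF I(2,1)]])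
    also have "\<dots> \<le> (LINT s:{0..2*pi}|lborel. ?N 0 (2*pi) / 2)"
    proof (rule set_integral_mono)
      show "set_integrable lborel {0..2*pi} (\<lambda>s. norm (?g \<alpha> - ?g s))" by (rule set_integrable_norm[OF set_integral_diff(1)[OF I(2,1)]])
      show "set_integrable lborel {0..2*pi} (\<lambda>s. ?N 0 (2*pi) / 2)" by (intro borel_integrable_atLeastAtMost' continuous_intros)
      fix s assume s: "s \<in> {0..2*pi}"
      show "norm (?g \<alpha> - ?g s) \<le> ?N 0 (2*pi) / 2"
        using osc[of s \<alpha>] osc[of \<alpha> s] s \<alpha> by (cases "s \<le> \<alpha>") (auto simp: norm_minus_commute)
    qed
    also have "\<dots> = 2 * pi * (?N 0 (2*pi) / 2)" by (simp add: set_integral_const)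
    finally show ?thesis by (rule mult_left_le_imp_le) simp
  qed
  have "norm (g w) \<le> ?N 0 (2*pi) / 2"
  proof (rule maximum_modulus_frontier[of g "cball 0 r"])
    have sub: "cball 0 r \<subseteq> (ball 0 1 :: complex set)" using r by auto
    show "g holomorphic_on interior (cball 0 r)" using hol sub by (meson holomorphic_on_subset interior_subset order_trans)
    show "continuous_on (closure (cball 0 r)) g" using holomorphic_on_imp_continuous_on[OF hol] sub by (auto intro: continuous_on_subset)
    show "bounded (cball (0::complex) r)" "w \<in> cball 0 r" using w by auto
    fix z :: complex assume "z \<in> frontier (cball 0 r)"
    then have z: "norm z = r" using r by simp
    have "z = of_real r * cis (Arg2pi z)" using Arg2pi[of z] z by (simp add: is_Arg_def cis_conv_exp)
    then show "norm (g z) \<le> ?N 0 (2*pi) / 2" using circle[of "Arg2pi z"] Arg2pi[of z] by (metis less_imp_le)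
  qed
  then show ?thesis by simp
qed

section \<open>Norm estimates for arc length in the angle variable\<close>

lemma root_powr_power: "y \<ge> 0 \<Longrightarrow> p \<ge> 1 \<Longrightarrow> (y powr (1 / real p)) ^ p = y"
  by (cases "y = 0") (simp_all add: powr_realpow[symmetric] powr_powr)

context root_boundary_data
begin

text \<open>Arc length carried over to the angle; it has no mass outside \<open>{0..2*pi}\<close>
  because \<open>x\<close> vanishes there.\<close>

definition \<nu> :: "real measure" where
  "\<nu> = density lborel (\<lambda>s. ennreal (norm (x s)))"

lemma x_meas [measurable]: "x \<in> borel_measurable borel" and a_measurable [measurable]: "a \<in> borel_measurable borel"
  using x_int a_meas by auto

lemma sets_nu [measurable_cong, simp]: "sets \<nu> = sets borel"
  by (simp add: \<nu>_def)

lemma integrable_nu: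
  fixes f :: "real \<Rightarrow> real"
  assumes "f \<in> borel_measurable borel"
  shows "integrable \<nu> f \<longleftrightarrow> integrable lborel (\<lambda>s. norm (x s) * f s)"
  unfolding \<nu>_def using assms by (subst integrable_density) auto

lemma integral_nu:
  fixes f :: "real \<Rightarrow> real"
  assumes "f \<in> borel_measurable borel"
  shows "(\<integral>s. f s \<partial>\<nu>) = (LINT s:{0..2*pi}|lborel. f s * norm (x s))"
proof -
  have "(\<integral>s. f s \<partial>\<nu>) = (\<integral>s. norm (x s) *\<^sub>R f s \<partial>lborel)"
    unfolding \<nu>_def using assms by (subst integral_density) auto
  also have "\<dots> = (LINT s:{0..2*pi}|lborel. f s * norm (x s))"
    unfolding set_lebesgue_integral_def using x_zero
    by (intro Bochner_Integration.integral_cong refl) (auto simp: indicator_def)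
  finally show ?thesis .
qed

lemma integrable_nu_bounded:
  fixes f :: "real \<Rightarrow> real"
  assumes [measurable]: "f \<in> borel_measurable borel" and "\<And>s. norm (f s) \<le> C"
  shows "integrable \<nu> f"
  unfolding integrable_nu[OF assms(1)]
proof (rule Bochner_Integration.integrable_bound)
  show "integrable lborel (\<lambda>s. C * norm (x s))" using x_int by simp
  have C: "C \<ge> 0" using assms(2)[of 0] norm_ge_zero[of "f 0"] by linarith
  show "AE s in lborel. norm (norm (x s) * f s) \<le> norm (C * norm (x s))"
    using assms(2) C by (intro AE_I2) (simp add: abs_mult mult.commute mult_right_mono)
qed measurable

text \<open>The integrand times the density of \<open>\<nu>\<close> is almost everywhere the
  constant \<open>R\<close> on the circle, the boundary form of |\<phi>'| |\<Psi>'| = R.\<close>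

lemma root_power_integral:
  shows "integrable \<nu> (\<lambda>s. norm (a s) ^ p)" "(\<integral>s. norm (a s) ^ p \<partial>\<nu>) = 2 * pi * R"
proof -
  have AE: "AE s in lborel. norm (x s) * norm (a s) ^ p = indicator {0..2*pi} s *\<^sub>R R"
    using a_norm by eventually_elim (use x_zero in \<open>auto simp: indicator_def mult.commute\<close>)
  have "integrable lborel (\<lambda>s. indicator {0..2*pi} s *\<^sub>R R)"
    using borel_integrable_atLeastAtMost'[OF continuous_on_const[of "{0..2*pi}" R]] by (simp add: set_integrable_def)
  then have "integrable lborel (\<lambda>s. norm (x s) * norm (a s) ^ p)"
    using AE by (subst integrable_cong_AE[OF _ _ AE]) auto
  then show "integrable \<nu> (\<lambda>s. norm (a s) ^ p)" by (subst integrable_nu) auto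
  have "(\<integral>s. norm (a s) ^ p \<partial>\<nu>) = (\<integral>s. norm (x s) *\<^sub>R norm (a s) ^ p \<partial>lborel)"
    unfolding \<nu>_def by (subst integral_density) auto
  also have "\<dots> = (\<integral>s. indicator {0..2*pi} s *\<^sub>R R \<partial>lborel)"
    using AE by (intro integral_cong_AE) auto
  finally show "(\<integral>s. norm (a s) ^ p \<partial>\<nu>) = 2 * pi * R" by simp
qed

definition boundary_poly :: "complex poly \<Rightarrow> real \<Rightarrow> complex" where
  "boundary_poly P s = poly P (\<Psi> (cis s))"

lemma boundary_poly_continuous: "continuous_on S (boundary_poly P)"
  unfolding boundary_poly_def by (intro continuous_intros continuous_on_compose2[OF Psi_cont]) auto

lemma boundary_poly_measurable [measurable]: "boundary_poly P \<in> borel_measurable borel"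
  by (intro borel_measurable_continuous_onI boundary_poly_continuous)

lemma poly_bounded_on_disk:
  obtains C where "C \<ge> 0" "\<And>w. w \<in> cball 0 1 \<Longrightarrow> norm (poly P (\<Psi> w)) \<le> C"
proof -
  have "bounded ((\<lambda>w. poly P (\<Psi> w)) ` cball 0 1)"
    by (intro compact_imp_bounded compact_continuous_image continuous_intros Psi_cont) auto
  then obtain C where "\<forall>w\<in>cball 0 1. norm (poly P (\<Psi> w)) \<le> C" unfolding bounded_iff by auto
  then show ?thesis by (intro that[of "max C 0"]) (auto intro: max.coboundedI1)
qed

lemma boundary_poly_power_integrable: "integrable \<nu> (\<lambda>s. norm (boundary_poly P s) ^ p)"
proof -
  obtain C where C: "C \<ge> 0" "\<And>w. w \<in> cball 0 1 \<Longrightarrow> norm (poly P (\<Psi> w)) \<le> C" by (rule poly_bounded_on_disk) blast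
  have "norm (norm (boundary_poly P s) ^ p) \<le> C ^ p" for s
    using C by (auto simp: boundary_poly_def norm_power intro!: power_mono)
  then show ?thesis by (intro integrable_nu_bounded[where C = "C ^ p"]) measurable
qed

definition approx_error :: "complex poly \<Rightarrow> real" where
  "approx_error P = smirnov_norm (real p) G \<gamma> (\<lambda>z. h z - poly P z)"

lemma diff_power_integrable: "integrable \<nu> (\<lambda>s. norm (a s - boundary_poly P s) ^ p)"
proof (rule Bochner_Integration.integrable_bound)
  have "integrable \<nu> (\<lambda>s. (norm (a s) + norm (boundary_poly P s)) ^ p)"
    \<comment> \<open>Only integrability is wanted, so the norm bounds are the p-th roots of the
      integrals themselves.\<close>
    by (rule minkowski_power(1)[OF p root_power_integral(1) _ _ boundary_poly_power_integrable _ _ _ order_refl[THEN order_trans, of _ "(root p (\<integral>s. norm (a s) ^ p \<partial>\<nu>)) ^ p"] _ order_refl[THEN order_trans, of _ "(root p (\<integral>s. norm (boundary_poly P s) ^ p \<partial>\<nu>)) ^ p"]])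
       (use p in \<open>auto simp: real_root_pow_pos2\<close>)
  then show "integrable \<nu> (\<lambda>s. (norm (a s) + norm (boundary_poly P s)) ^ p)" .
  show "AE s in \<nu>. norm (norm (a s - boundary_poly P s) ^ p) \<le> norm ((norm (a s) + norm (boundary_poly P s)) ^ p)"
    by (intro AE_I2) (auto simp: norm_power intro!: power_mono norm_triangle_ineq4)
qed measurable

lemma approx_error_nonneg: "approx_error P \<ge> 0" by (simp add: approx_error_def smirnov_norm_def)

lemma approx_error_power: "approx_error P ^ p = (\<integral>s. norm (a s - boundary_poly P s) ^ p \<partial>\<nu>)"
proof -
  have "(\<integral>s. norm (a s - boundary_poly P s) ^ p \<partial>\<nu>) = (LINT s:{0..2*pi}|lborel. norm (a s - poly P (\<Psi> (cis s))) ^ p * norm (x s))"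
    unfolding boundary_poly_def[symmetric] by (rule integral_nu) measurable
  then have "approx_error P = (\<integral>s. norm (a s - boundary_poly P s) ^ p \<partial>\<nu>) powr (1 / real p)" unfolding approx_error_def norm_eq by simp
  moreover have "(\<integral>s. norm (a s - boundary_poly P s) ^ p \<partial>\<nu>) \<ge> 0" by (simp add: integral_nonneg)
  ultimately show ?thesis using root_powr_power[OF _ p] by simp
qed

lemma approx_error_le: "(\<integral>s. norm (a s - boundary_poly P s) ^ p \<partial>\<nu>) \<le> B ^ p \<Longrightarrow> B \<ge> 0 \<Longrightarrow> approx_error P \<le> B"
  using approx_error_power[of P] p by (intro power_le_imp_le_base[of "approx_error P" "p - 1" B]) auto

definition root_size where "root_size = (2 * pi * R) powr (1 / real p)"

lemma root_size_nonneg: "root_size \<ge> 0" by (simp add: root_size_def)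

lemma root_size_power: "root_size ^ p = 2 * pi * R" unfolding root_size_def using p R by (intro root_powr_power) auto

text \<open>The p-norm of the constant 1, just as \<open>root_size\<close> is that of the boundary
  values of \<open>h\<close>.\<close>

definition length_root where "length_root = curve_length \<gamma> 0 1 powr (1 / real p)"

lemma length_root_nonneg: "length_root \<ge> 0" by (simp add: length_root_def)

lemma length_nu: "(\<integral>s. 1 \<partial>\<nu>) = curve_length \<gamma> 0 1"
  by (subst integral_nu) (auto simp: length_eq)

lemma length_root_power: "length_root ^ p = curve_length \<gamma> 0 1"
proof -
  have "curve_length \<gamma> 0 1 \<ge> 0" unfolding length_nu[symmetric] by (simp add: integral_nonneg)
  then show ?thesis unfolding length_root_def using p by (intro root_powr_power) auto
qed

lemma const_power_integral:
  fixes c :: real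
  shows "c \<ge> 0 \<Longrightarrow> integrable \<nu> (\<lambda>s. c ^ p)" "c \<ge> 0 \<Longrightarrow> (\<integral>s. c ^ p \<partial>\<nu>) \<le> (c * length_root) ^ p"
proof -
  show I: "integrable \<nu> (\<lambda>s. c ^ p)" if "c \<ge> 0" by (rule integrable_nu_bounded[where C = "c ^ p"]) (use that in auto)
  have "(\<integral>s. c ^ p \<partial>\<nu>) = c ^ p * (\<integral>s. 1 \<partial>\<nu>)" using integral_mult_right_zero[of \<nu> "c ^ p" "\<lambda>_. 1"] by simp
  then show "(\<integral>s. c ^ p \<partial>\<nu>) \<le> (c * length_root) ^ p" by (simp only: length_nu power_mult_distrib length_root_power)
qed

text \<open>Minkowski's inequality with a constant function. It serves twice: adding 1 to the zero
  polynomial gives the competitor 1, and in a Smirnov domain it bounds the cost of correcting the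
  value at \<zeta>.\<close>

lemma approx_error_perturb: "approx_error (P + [:c:]) \<le> approx_error P + norm c * length_root"
proof (rule approx_error_le)
  have I: "integrable \<nu> (\<lambda>s. (norm (a s - boundary_poly P s) + norm c) ^ p)"
    "(\<integral>s. (norm (a s - boundary_poly P s) + norm c) ^ p \<partial>\<nu>) \<le> (approx_error P + norm c * length_root) ^ p"
    by (rule minkowski_power[OF p diff_power_integrable _ _ const_power_integral(1) _ _ approx_error_nonneg approx_error_power[symmetric, THEN eq_refl] _ const_power_integral(2)];
        simp add: length_root_nonneg)+
  have "(\<integral>s. norm (a s - boundary_poly (P + [:c:]) s) ^ p \<partial>\<nu>) \<le> (\<integral>s. (norm (a s - boundary_poly P s) + norm c) ^ p \<partial>\<nu>)"
  proof (rule integral_mono[OF diff_power_integrable I(1)])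
    fix s
    have eq: "a s - boundary_poly (P + [:c:]) s = (a s - boundary_poly P s) - c" by (simp add: boundary_poly_def)
    show "norm (a s - boundary_poly (P + [:c:]) s) ^ p \<le> (norm (a s - boundary_poly P s) + norm c) ^ p"
      unfolding eq by (intro power_mono norm_triangle_ineq4 norm_ge_zero)
  qed
  then show "(\<integral>s. norm (a s - boundary_poly (P + [:c:]) s) ^ p \<partial>\<nu>) \<le> (approx_error P + norm c * length_root) ^ p" using I(2) by linarith
qed (simp add: approx_error_nonneg length_root_nonneg)

lemma approx_error_zero: "approx_error 0 = root_size"
proof -
  have "approx_error 0 ^ p = root_size ^ p" unfolding approx_error_power root_size_power using root_power_integral(2) by (simp add: boundary_poly_def)
  then show ?thesis using power_eq_imp_eq_base[of "approx_error 0" p root_size] approx_error_nonneg root_size_nonneg p by simp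
qed

lemma approx_error_one: "approx_error 1 \<le> root_size + length_root"
  using approx_error_perturb[of 0 1] approx_error_zero by (simp add: one_pCons)

lemma boundary_poly_power_le: "(\<integral>s. norm (boundary_poly P s) ^ p \<partial>\<nu>) \<le> (root_size + approx_error P) ^ p"
proof -
  have I: "integrable \<nu> (\<lambda>s. (norm (a s) + norm (a s - boundary_poly P s)) ^ p)"
    "(\<integral>s. (norm (a s) + norm (a s - boundary_poly P s)) ^ p \<partial>\<nu>) \<le> (root_size + approx_error P) ^ p"
    by (rule minkowski_power[OF p root_power_integral(1) _ _ diff_power_integrable _ _ root_size_nonneg _ approx_error_nonneg approx_error_power[symmetric, THEN eq_refl]];
        simp add: root_size_power root_power_integral(2))+
  have "(\<integral>s. norm (boundary_poly P s) ^ p \<partial>\<nu>) \<le> (\<integral>s. (norm (a s) + norm (a s - boundary_poly P s)) ^ p \<partial>\<nu>)"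
  proof (rule integral_mono[OF boundary_poly_power_integrable I(1)])
    fix s
    show "norm (boundary_poly P s) ^ p \<le> (norm (a s) + norm (a s - boundary_poly P s)) ^ p"
      using norm_triangle_ineq4[of "a s" "a s - boundary_poly P s"] by (intro power_mono) auto
  qed
  then show ?thesis using I(2) by linarith
qed

text \<open>Factoring the difference of powers leaves one factor |a - b| and p - 1 factors |a| +
  |b|, the shape required by Hoelder's inequality. The sum has norm at most \<open>root_size\<close>
  from \<open>a\<close> plus \<open>root_size + approx_error P\<close> from the polynomial.\<close>

lemma power_diff_integral_le:
  "integrable \<nu> (\<lambda>s. norm (a s ^ p - boundary_poly P s ^ p))"
  "(\<integral>s. norm (a s ^ p - boundary_poly P s ^ p) \<partial>\<nu>) \<le> approx_error P * (2 * root_size + approx_error P) ^ (p - 1)"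
proof -
  have I: "integrable \<nu> (\<lambda>s. (norm (a s) + norm (boundary_poly P s)) ^ p)"
    "(\<integral>s. (norm (a s) + norm (boundary_poly P s)) ^ p \<partial>\<nu>) \<le> (root_size + (root_size + approx_error P)) ^ p"
    by (rule minkowski_power[OF p root_power_integral(1) _ _ boundary_poly_power_integrable _ _ root_size_nonneg _ _ boundary_poly_power_le];
        simp add: root_size_power root_power_integral(2) root_size_nonneg approx_error_nonneg)+
  have J: "integrable \<nu> (\<lambda>s. norm (a s - boundary_poly P s) * (norm (a s) + norm (boundary_poly P s)) ^ (p - 1))"
    by (rule integrable_mult_power[OF p diff_power_integrable _ _ I(1)]) auto
  have K: "(\<integral>s. norm (a s - boundary_poly P s) * (norm (a s) + norm (boundary_poly P s)) ^ (p - 1) \<partial>\<nu>) \<le> approx_error P * (root_size + (root_size + approx_error P)) ^ (p - 1)"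
    by (rule holder_power[OF p diff_power_integrable _ _ I(1) _ _ approx_error_nonneg approx_error_power[symmetric, THEN eq_refl] _ I(2)])
       (auto simp: root_size_nonneg approx_error_nonneg)
  show D: "integrable \<nu> (\<lambda>s. norm (a s ^ p - boundary_poly P s ^ p))"
    by (rule Bochner_Integration.integrable_bound[OF J]) (auto intro!: AE_I2 order_trans[OF norm_power_diff_le[OF p]])
  have "(\<integral>s. norm (a s ^ p - boundary_poly P s ^ p) \<partial>\<nu>) \<le> (\<integral>s. norm (a s - boundary_poly P s) * (norm (a s) + norm (boundary_poly P s)) ^ (p - 1) \<partial>\<nu>)"
    by (intro integral_mono D J norm_power_diff_le p)
  then show "(\<integral>s. norm (a s ^ p - boundary_poly P s ^ p) \<partial>\<nu>) \<le> approx_error P * (2 * root_size + approx_error P) ^ (p - 1)" using K by simp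
qed

text \<open>The bound on circles of radius \<open>r n\<close> has to survive the passage to the
  boundary. The derivative of \<open>g\<close> has no fixed majorant, only C (|\<Psi>'| + 1), which
  converges in the mean. It is therefore truncated at the limit \<open>W\<close> of these majorants;
  the excess is at most \<open>C\<close> times the mean distance between \<Psi>' and
  \<open>x\<close>.\<close>

lemma norm_le_half_boundary_integral:
  assumes g: "g holomorphic_on ball 0 1" "g 0 = 0" and b [measurable]: "b \<in> borel_measurable borel" and C: "C \<ge> 0"
    and bound: "\<And>w. w \<in> ball 0 1 \<Longrightarrow> norm (deriv g w) \<le> C * (norm (deriv \<Psi> w) + 1)"
    and lim: "AE s in lborel. s \<in> {0..2*pi} \<longrightarrow> (\<lambda>n. deriv g (of_real (r n) * cis s)) \<longlonglongrightarrow> b s * x s"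
    and w: "w \<in> ball 0 1"
  shows "norm (g w) \<le> 1 / 2 * (\<integral>s. norm (b s) \<partial>\<nu>)"
proof -
  let ?M = "restrict_space lborel {0..2*pi}"
  let ?D = "\<lambda>n s. deriv \<Psi> (of_real (r n) * cis s)" and ?E = "\<lambda>n s. deriv g (of_real (r n) * cis s)"
  have MI: "integrable ?M f \<longleftrightarrow> set_integrable lborel {0..2*pi} f" for f :: "real \<Rightarrow> 'z::euclidean_space"
    unfolding set_integrable_def by (rule integrable_restrict_space) simp
  have Mi: "integral\<^sup>L ?M f = (LINT s:{0..2*pi}|lborel. f s)" for f :: "real \<Rightarrow> 'z::euclidean_space"
    unfolding set_lebesgue_integral_def by (rule integral_restrict_space) simp
  have AEM: "(AE s in ?M. P s) \<longleftrightarrow> (AE s in lborel. s \<in> {0..2*pi} \<longrightarrow> P s)" for P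
    by (rule AE_restrict_space_iff) simp
  have cI: "integrable ?M f" if "continuous_on {0..2*pi} f" for f :: "real \<Rightarrow> 'z::euclidean_space"
    unfolding MI using that by (rule borel_integrable_atLeastAtMost')
  have Dc: "continuous_on {0..2*pi} (?D n)" for n by (rule circle_increment(2)[OF Psi_hol r0 r1 order_refl])
  have Ec: "continuous_on {0..2*pi} (?E n)" for n by (rule circle_increment(2)[OF g(1) r0 r1 order_refl])
  have xI: "integrable ?M x"
    unfolding MI set_integrable_def by (intro integrable_mult_indicator x_int) simp
  have inb: "of_real (r n) * cis s \<in> ball 0 1" for n s using r0[of n] r1[of n] by (simp add: norm_mult)
  define W where "W s = C * (norm (x s) + 1)" for s
  have WI: "integrable ?M W" unfolding W_def
    by (intro integrable_mult_right Bochner_Integration.integrable_add integrable_norm xI cI continuous_intros)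
  define e where "e n = (\<integral>s. norm (x s - ?D n s) \<partial>?M)" for n
  have e0: "e \<longlonglongrightarrow> 0" unfolding e_def Mi by (rule x_L1)
  have dI: "integrable ?M (\<lambda>s. norm (x s - ?D n s))" for n by (intro integrable_norm Bochner_Integration.integrable_diff xI cI Dc)
  have EW: "norm (?E n s) \<le> W s + C * norm (x s - ?D n s)" for n s
  proof -
    have "norm (?D n s) \<le> norm (x s) + norm (x s - ?D n s)"
      using norm_triangle_ineq4[of "x s" "x s - ?D n s"] by simp
    then have "C * (norm (?D n s) + 1) \<le> C * (norm (x s) + norm (x s - ?D n s) + 1)" using C by (intro mult_left_mono) auto
    then show ?thesis using bound[OF inb, of n s] by (simp add: W_def algebra_simps)
  qed
  have EL: "AE s in ?M. (\<lambda>n. norm (?E n s)) \<longlonglongrightarrow> norm (b s * x s)"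
    using lim unfolding AEM by eventually_elim (auto intro: tendsto_norm)
  have GW: "AE s in ?M. norm (b s * x s) \<le> W s"
    using EL x_AE unfolding AEM
  proof eventually_elim
    case (elim s)
    show ?case
    proof
      assume s: "s \<in> {0..2*pi}"
      have "(\<lambda>n. C * (norm (?D n s) + 1)) \<longlonglongrightarrow> W s" unfolding W_def using elim s by (intro tendsto_intros) auto
      moreover have "(\<lambda>n. norm (?E n s)) \<longlonglongrightarrow> norm (b s * x s)" using elim s by auto
      ultimately show "norm (b s * x s) \<le> W s" using bound[OF inb] by (blast intro: LIMSEQ_le)
    qed
  qed
  have bm: "(\<lambda>s. norm (b s * x s)) \<in> borel_measurable ?M" by (intro measurable_restrict_space1) measurable
  \<comment> \<open>Truncation makes \<open>W\<close> a dominating function, and it does not alter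
    the limit, which is itself at most \<open>W\<close>.\<close>
  have minL: "(\<lambda>n. \<integral>s. min (norm (?E n s)) (W s) \<partial>?M) \<longlonglongrightarrow> (\<integral>s. norm (b s * x s) \<partial>?M)"
  proof (rule integral_dominated_convergence[where w = W])
    show "integrable ?M W" by (rule WI)
    show "(\<lambda>s. norm (b s * x s)) \<in> borel_measurable ?M" by (rule bm)
    show "(\<lambda>s. min (norm (?E n s)) (W s)) \<in> borel_measurable ?M" for n
      using borel_measurable_integrable[OF WI] borel_measurable_integrable[OF cI[OF Ec, of n]] by measurable
    show "AE s in ?M. (\<lambda>n. min (norm (?E n s)) (W s)) \<longlonglongrightarrow> norm (b s * x s)"
      using EL GW
    proof eventually_elim
      case (elim s)
      have "(\<lambda>n. min (norm (?E n s)) (W s)) \<longlonglongrightarrow> min (norm (b s * x s)) (W s)" using elim(1) by (intro tendsto_min tendsto_const)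
      then show ?case using elim(2) by (simp add: min_absorb1)
    qed
    show "AE s in ?M. norm (min (norm (?E n s)) (W s)) \<le> W s" for n
      using C by (intro AE_I2) (auto simp: W_def min_def)
  qed
  have "norm (g w) \<le> 1 / 2 * ((\<integral>s. min (norm (?E n s)) (W s) \<partial>?M) + C * e n)" if n: "norm w \<le> r n" "0 < r n" for n
  proof -
    have I: "integrable ?M (\<lambda>s. min (norm (?E n s)) (W s))" by (intro integrable_min integrable_norm cI Ec WI)
    have "(\<integral>s. norm (?E n s) \<partial>?M) \<le> (\<integral>s. min (norm (?E n s)) (W s) + C * norm (x s - ?D n s) \<partial>?M)"
    proof (rule integral_mono)
      show "integrable ?M (\<lambda>s. norm (?E n s))" by (intro integrable_norm cI Ec)
      show "integrable ?M (\<lambda>s. min (norm (?E n s)) (W s) + C * norm (x s - ?D n s))"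
        by (intro Bochner_Integration.integrable_add I integrable_mult_right dI)
      show "norm (?E n s) \<le> min (norm (?E n s)) (W s) + C * norm (x s - ?D n s)" for s
        using EW[of n s] C by (auto simp: min_def)
    qed
    also have "\<dots> = (\<integral>s. min (norm (?E n s)) (W s) \<partial>?M) + C * e n"
      unfolding e_def using I dI[of n] by simp
    finally have le: "(\<integral>s. norm (?E n s) \<partial>?M) \<le> (\<integral>s. min (norm (?E n s)) (W s) \<partial>?M) + C * e n" .
    have "norm (g w) \<le> r n / 2 * (\<integral>s. norm (?E n s) \<partial>?M)"
      unfolding Mi by (rule norm_le_half_circle_integral[OF g n(2) r1 n(1)])
    also have "\<dots> \<le> 1 / 2 * (\<integral>s. norm (?E n s) \<partial>?M)"
      using r1[of n] by (intro mult_right_mono) (auto simp: integral_nonneg)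
    also have "\<dots> \<le> 1 / 2 * ((\<integral>s. min (norm (?E n s)) (W s) \<partial>?M) + C * e n)" using le by simp
    finally show ?thesis .
  qed
  moreover have "\<forall>\<^sub>F n in sequentially. norm w \<le> r n \<and> 0 < r n"
  proof -
    have "\<forall>\<^sub>F n in sequentially. norm w < r n" using w by (intro order_tendstoD(1)[OF r_lim]) simp
    then show ?thesis by eventually_elim (use norm_ge_zero[of w] in linarith)
  qed
  ultimately have ev: "\<forall>\<^sub>F n in sequentially. norm (g w) \<le> 1 / 2 * ((\<integral>s. min (norm (?E n s)) (W s) \<partial>?M) + C * e n)"
    by (auto elim: eventually_mono)
  have "(\<lambda>n. 1 / 2 * ((\<integral>s. min (norm (?E n s)) (W s) \<partial>?M) + C * e n)) \<longlonglongrightarrow> 1 / 2 * ((\<integral>s. norm (b s * x s) \<partial>?M) + C * 0)"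
    by (intro tendsto_intros minL e0)
  from tendsto_lowerbound[OF this ev] have "norm (g w) \<le> 1 / 2 * (\<integral>s. norm (b s * x s) \<partial>?M)" by simp
  also have "(\<integral>s. norm (b s * x s) \<partial>?M) = (\<integral>s. norm (b s) \<partial>\<nu>)"
    unfolding Mi by (subst integral_nu) (auto simp: norm_mult)
  finally show ?thesis .
qed

lemma h_Psi_hol: "(\<lambda>w. h (\<Psi> w)) holomorphic_on ball 0 1"
  using holomorphic_on_compose_gen[OF Psi_hol h_hol] Psi_image by (simp add: o_def)

lemma poly_Psi_lim: "(\<lambda>n. poly P (\<Psi> (of_real (r n) * cis s))) \<longlonglongrightarrow> boundary_poly P s"
proof -
  have "(\<lambda>n. of_real (r n) * cis s) \<longlonglongrightarrow> of_real 1 * cis s" by (intro tendsto_intros r_lim)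
  then have "(\<lambda>n. of_real (r n) * cis s) \<longlonglongrightarrow> cis s" by simp
  then have "(\<lambda>n. \<Psi> (of_real (r n) * cis s)) \<longlonglongrightarrow> \<Psi> (cis s)"
    by (rule continuous_on_tendsto_compose[OF Psi_cont]) (use r0 r1 in \<open>auto simp: norm_mult intro!: always_eventually less_imp_le\<close>)
  then show ?thesis unfolding boundary_poly_def by (intro tendsto_intros)
qed

lemma primitive_bound:
  assumes g: "g holomorphic_on ball 0 1" "g 0 = 0"
    and dg: "\<And>w. w \<in> ball 0 1 \<Longrightarrow> deriv g w = (h (\<Psi> w) ^ p - poly P (\<Psi> w) ^ p) * deriv \<Psi> w"
    and w: "w \<in> ball 0 1"
  shows "norm (g w) \<le> 1 / 2 * (2 * root_size + approx_error P) ^ (p - 1) * approx_error P"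
proof -
  obtain C where C: "C \<ge> 0" "\<And>w. w \<in> cball 0 1 \<Longrightarrow> norm (poly P (\<Psi> w)) \<le> C" by (rule poly_bounded_on_disk) blast
  have "norm (g w) \<le> 1 / 2 * (\<integral>s. norm (a s ^ p - boundary_poly P s ^ p) \<partial>\<nu>)"
  proof (rule norm_le_half_boundary_integral[OF g _ _ _ _ w])
    \<comment> \<open>Of the two terms of the derivative, the one with \<open>h\<close> has constant
      modulus \<open>R\<close> and the one with \<open>P\<close> is at most \<open>C ^ p\<close>
      times |\<Psi>'|. The first accounts for the summand 1 beside |\<Psi>'| in the
      majorant.\<close>
    show "0 \<le> R + C ^ p" using R C by simp
    show "(\<lambda>s. a s ^ p - boundary_poly P s ^ p) \<in> borel_measurable borel" by measurable
    show "norm (deriv g w) \<le> (R + C ^ p) * (norm (deriv \<Psi> w) + 1)" if w: "w \<in> ball 0 1" for w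
    proof -
      have "norm (deriv g w) = norm (h (\<Psi> w) ^ p * deriv \<Psi> w - poly P (\<Psi> w) ^ p * deriv \<Psi> w)"
        using dg[OF w] by (simp add: left_diff_distrib)
      also have "\<dots> \<le> norm (h (\<Psi> w)) ^ p * norm (deriv \<Psi> w) + norm (poly P (\<Psi> w)) ^ p * norm (deriv \<Psi> w)"
        by (rule order_trans[OF norm_triangle_ineq4]) (simp add: norm_mult norm_power)
      also have "\<dots> \<le> R + C ^ p * norm (deriv \<Psi> w)"
        unfolding root_norm[OF w] using C w by (intro add_mono mult_right_mono power_mono) auto
      also have "\<dots> \<le> (R + C ^ p) * (norm (deriv \<Psi> w) + 1)" using R C(1) by (simp add: algebra_simps)
      finally show ?thesis .
    qed
    show "AE s in lborel. s \<in> {0..2*pi} \<longrightarrow> (\<lambda>n. deriv g (of_real (r n) * cis s)) \<longlonglongrightarrow> (a s ^ p - boundary_poly P s ^ p) * x s"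
      using a_AE x_AE
    proof eventually_elim
      case (elim s)
      have e: "deriv g (of_real (r n) * cis s) = (h (\<Psi> (of_real (r n) * cis s)) ^ p - poly P (\<Psi> (of_real (r n) * cis s)) ^ p) * deriv \<Psi> (of_real (r n) * cis s)" for n
        using r0[of n] r1[of n] by (intro dg) (simp add: norm_mult)
      show ?case unfolding e using elim by (auto intro!: tendsto_intros poly_Psi_lim)
    qed
  qed
  also have "\<dots> \<le> 1 / 2 * (approx_error P * (2 * root_size + approx_error P) ^ (p - 1))" using power_diff_integral_le(2)[of P] by simp
  finally show ?thesis by (simp add: mult_ac)
qed

text \<open>Cauchy's estimate for a primitive of the p-th power turns the boundary bound into a bound for
  point evaluation at the centre.\<close>

lemma point_evaluation_bound:
  "norm (h \<zeta> - poly P \<zeta>) ^ p * norm (deriv \<Psi> 0) \<le> approx_error P ^ p"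
proof -
  let ?f = "\<lambda>w. (h (\<Psi> w) - poly P (\<Psi> w)) ^ p * deriv \<Psi> w"
  have pol: "(\<lambda>w. poly P (\<Psi> w)) holomorphic_on ball 0 1"
    using holomorphic_on_compose[OF Psi_hol, of "poly P"] by (simp add: o_def holomorphic_intros)
  have fh: "?f holomorphic_on ball 0 1" by (intro holomorphic_intros h_Psi_hol pol holomorphic_deriv Psi_hol) auto
  obtain g0 where g0: "\<And>w. w \<in> ball 0 1 \<Longrightarrow> (g0 has_field_derivative ?f w) (at w)"
    using holomorphic_convex_primitive'[OF convex_ball open_ball fh] by (metis open_ball at_within_open)
  define g where "g w = g0 w - g0 0" for w
  have gd: "(g has_field_derivative ?f w) (at w)" if "w \<in> ball 0 1" for w
    unfolding g_def using g0[OF that] by (auto intro!: derivative_eq_intros)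
  have gh: "g holomorphic_on ball 0 1" using gd by (meson field_differentiable_at_within field_differentiable_def holomorphic_on_def)
  have dg: "deriv g w = ?f w" if "w \<in> ball 0 1" for w using gd[OF that] by (rule DERIV_imp_deriv)
  obtain C where C: "C \<ge> 0" "\<And>w. w \<in> cball 0 1 \<Longrightarrow> norm (poly P (\<Psi> w)) \<le> C" by (rule poly_bounded_on_disk) blast
  have gb: "norm (g w) \<le> 1 / 2 * approx_error P ^ p" if w: "w \<in> ball 0 1" for w
  proof -
    have "norm (g w) \<le> 1 / 2 * (\<integral>s. norm ((a s - boundary_poly P s) ^ p) \<partial>\<nu>)"
    proof (rule norm_le_half_boundary_integral[OF gh _ _ _ _ _ w])
      show "g 0 = 0" by (simp add: g_def)
      show "0 \<le> 2 ^ p * (R + C ^ p)" using R C by simp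
      show "(\<lambda>s. (a s - boundary_poly P s) ^ p) \<in> borel_measurable borel" by measurable
      show "norm (deriv g w) \<le> 2 ^ p * (R + C ^ p) * (norm (deriv \<Psi> w) + 1)" if w: "w \<in> ball 0 1" for w
      proof -
        have "norm (h (\<Psi> w) - poly P (\<Psi> w)) ^ p \<le> 2 ^ p * (norm (h (\<Psi> w)) ^ p + norm (poly P (\<Psi> w)) ^ p)"
        proof -
          have "norm (h (\<Psi> w) - poly P (\<Psi> w)) \<le> 2 * max (norm (h (\<Psi> w))) (norm (poly P (\<Psi> w)))"
            using norm_triangle_ineq4[of "h (\<Psi> w)" "poly P (\<Psi> w)"] by (simp add: max_def)
          then have "norm (h (\<Psi> w) - poly P (\<Psi> w)) ^ p \<le> (2 * max (norm (h (\<Psi> w))) (norm (poly P (\<Psi> w)))) ^ p" by (intro power_mono) auto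
          also have "\<dots> \<le> 2 ^ p * (norm (h (\<Psi> w)) ^ p + norm (poly P (\<Psi> w)) ^ p)" by (auto simp: power_mult_distrib max_def)
          finally show ?thesis .
        qed
        then have "norm (deriv g w) \<le> 2 ^ p * (norm (h (\<Psi> w)) ^ p + norm (poly P (\<Psi> w)) ^ p) * norm (deriv \<Psi> w)"
          unfolding dg[OF w] norm_mult norm_power by (intro mult_right_mono) auto
        also have "\<dots> = 2 ^ p * (norm (h (\<Psi> w)) ^ p * norm (deriv \<Psi> w) + norm (poly P (\<Psi> w)) ^ p * norm (deriv \<Psi> w))" by (simp add: algebra_simps)
        also have "\<dots> \<le> 2 ^ p * (R + C ^ p * norm (deriv \<Psi> w))"
          unfolding root_norm[OF w] using C w by (intro mult_left_mono add_mono mult_right_mono power_mono) auto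
        also have "\<dots> \<le> 2 ^ p * ((R + C ^ p) * (norm (deriv \<Psi> w) + 1))"
          using R C(1) by (intro mult_left_mono) (simp_all add: algebra_simps)
        finally show ?thesis by (simp add: mult.assoc)
      qed
      show "AE s in lborel. s \<in> {0..2*pi} \<longrightarrow> (\<lambda>n. deriv g (of_real (r n) * cis s)) \<longlonglongrightarrow> (a s - boundary_poly P s) ^ p * x s"
        using a_AE x_AE
      proof eventually_elim
        case (elim s)
        have e: "deriv g (of_real (r n) * cis s) = ?f (of_real (r n) * cis s)" for n
          using r0[of n] r1[of n] by (intro dg) (simp add: norm_mult)
        show ?case unfolding e using elim by (auto intro!: tendsto_intros poly_Psi_lim)
      qed
    qed
    then show ?thesis unfolding approx_error_power by (simp add: norm_power)
  qed
  \<comment> \<open>On the circle of radius 1/2 the radius in Cauchy's estimate cancels the factor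
    1/2 of the boundary bound, which leaves the constant 1.\<close>
  have "norm ((deriv ^^ 1) g 0) \<le> fact 1 * (1 / 2 * approx_error P ^ p) / (1 / 2) ^ 1"
  proof (rule Cauchy_inequality)
    have sub: "cball (0::complex) (1/2) \<subseteq> ball 0 1" by auto
    show "g holomorphic_on ball 0 (1/2)" using gh by (rule holomorphic_on_subset) auto
    show "continuous_on (cball 0 (1/2)) g" using holomorphic_on_imp_continuous_on[OF gh] sub by (rule continuous_on_subset)
    show "norm (g v) \<le> 1 / 2 * approx_error P ^ p" if "norm (0 - v) = 1 / 2" for v using that by (intro gb) auto
  qed simp
  then show ?thesis using dg[of 0] by (simp add: norm_mult norm_power Psi_0)
qed

end

text \<open>\<phi> minus \<open>J_poly\<close> vanishes at \<zeta> and has derivative h^p - Q^p in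
  \<open>G\<close>. Composed with \<Psi> it is a primitive of the kind already bounded on the disk,
  and continuity carries the bound from \<open>G\<close> to its closure.\<close>

lemma jordan_conformal_primitive_bound:
  fixes Q :: "complex poly"
  assumes J: "jordan_conformal G \<gamma> \<phi> R" and D: "root_boundary_data G \<gamma> h \<Psi> \<zeta> R p r x a"
    and phi: "\<phi> \<zeta> = 0" and h: "\<And>z. z \<in> G \<Longrightarrow> h z ^ p = deriv \<phi> z" and z: "z \<in> closure G"
  shows "norm (\<phi> z - J_poly p \<zeta> Q z)
    \<le> 1 / 2 * (2 * root_boundary_data.root_size R p + root_boundary_data.approx_error G \<gamma> h p Q) ^ (p - 1) * root_boundary_data.approx_error G \<gamma> h p Q"
proof -
  interpret J: jordan_conformal G \<gamma> \<phi> R by fact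
  interpret D: root_boundary_data G \<gamma> h \<Psi> \<zeta> R p r x a by fact
  \<comment> \<open>An entire primitive represents \<open>J_poly\<close> along the whole segment,
    also where the segment leaves \<open>G\<close>.\<close>
  have "(\<lambda>z. poly Q z ^ p) holomorphic_on UNIV" by (intro holomorphic_intros)
  then obtain T where T: "\<And>z. (T has_field_derivative poly Q z ^ p) (at z)"
    using holomorphic_convex_primitive'[OF convex_UNIV open_UNIV, of "\<lambda>z. poly Q z ^ p"] by auto
  have JT: "J_poly p \<zeta> Q z = T z - T \<zeta>" for z
  proof -
    have "((\<lambda>t. poly Q t ^ p) has_contour_integral (T (pathfinish (linepath \<zeta> z)) - T (pathstart (linepath \<zeta> z)))) (linepath \<zeta> z)"
      by (rule contour_integral_primitive[of UNIV T]) (use T in auto)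
    then show ?thesis unfolding J_poly_def by (simp add: contour_integral_unique)
  qed
  define F where "F z = \<phi> z - (T z - T \<zeta>)" for z
  have Tc: "continuous_on S T" for S using T by (meson DERIV_isCont continuous_at_imp_continuous_on)
  have "norm (F z) \<le> 1 / 2 * (2 * D.root_size + D.approx_error Q) ^ (p - 1) * D.approx_error Q"
  proof (rule continuous_on_closure_norm_le[OF _ _ z])
    show "continuous_on (closure G) F" unfolding F_def by (intro continuous_intros J.cont_phi Tc)
    have dF: "((\<lambda>w. F (\<Psi> w)) has_field_derivative (h (\<Psi> w) ^ p - poly Q (\<Psi> w) ^ p) * deriv \<Psi> w) (at w)" if w: "w \<in> ball 0 1" for w
    proof -
      have "\<Psi> w \<in> G" using w D.Psi_image by blast
      then have "(\<phi> has_field_derivative h (\<Psi> w) ^ p) (at (\<Psi> w))"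
        unfolding h[OF \<open>\<Psi> w \<in> G\<close>] using J.hol_phi J.open_G by (intro holomorphic_derivI) auto
      then have "(F has_field_derivative h (\<Psi> w) ^ p - poly Q (\<Psi> w) ^ p) (at (\<Psi> w))"
        unfolding F_def using T by (auto intro!: derivative_eq_intros)
      moreover have "(\<Psi> has_field_derivative deriv \<Psi> w) (at w)" using D.Psi_hol w by (intro holomorphic_derivI) auto
      ultimately show ?thesis using DERIV_chain[of F _ \<Psi> w] by (simp add: o_def)
    qed
    have "norm (F (\<Psi> w)) \<le> 1 / 2 * (2 * D.root_size + D.approx_error Q) ^ (p - 1) * D.approx_error Q" if w: "w \<in> ball 0 1" for w
    proof (rule D.primitive_bound[OF _ _ _ w])
      show "(\<lambda>w. F (\<Psi> w)) holomorphic_on ball 0 1"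
        unfolding holomorphic_on_def field_differentiable_def using dF has_field_derivative_at_within by blast
      show "F (\<Psi> 0) = 0" by (simp add: F_def D.Psi_0 phi)
      show "deriv (\<lambda>w. F (\<Psi> w)) w = (h (\<Psi> w) ^ p - poly Q (\<Psi> w) ^ p) * deriv \<Psi> w" if "w \<in> ball 0 1" for w
        using dF[OF that] by (rule DERIV_imp_deriv)
    qed
    then show "\<forall>z\<in>G. norm (F z) \<le> 1 / 2 * (2 * D.root_size + D.approx_error Q) ^ (p - 1) * D.approx_error Q" using D.Psi_image by blast
  qed
  then show ?thesis by (simp add: F_def JT)
qed

theorem theorem1p2:
  fixes G :: "complex set" and \<gamma> :: "real \<Rightarrow> complex" and \<zeta> :: complex
    and \<phi> :: "complex \<Rightarrow> complex" and R l :: real and p :: nat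
    and h :: "complex \<Rightarrow> complex" and Q :: "nat \<Rightarrow> complex poly"
  assumes "jordan_domain_bounded_by G \<gamma>"
    and "rectifiable_curve \<gamma>" and "l = curve_length \<gamma> 0 1"
    and "\<zeta> \<in> G"
    and "\<phi> holomorphic_on G" and "bij_betw \<phi> G (ball 0 R)"
    and "\<phi> \<zeta> = 0" and "deriv \<phi> \<zeta> = 1"
    and "continuous_on (closure G) \<phi>"
    and "p \<ge> 1"
    and "h holomorphic_on G" and "\<And>z. z \<in> G \<Longrightarrow> h z ^ p = deriv \<phi> z" and "h \<zeta> = 1"
    and "\<And>n. n \<ge> 1 \<Longrightarrow> degree (Q n) \<le> n"
    and "\<And>n. n \<ge> 1 \<Longrightarrow> poly (Q n) \<zeta> = 1"
    and "\<And>n. n \<ge> 1 \<Longrightarrow>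
           smirnov_norm (real p) G \<gamma> (\<lambda>z. h z - poly (Q n) z) =
             (INF P\<in>{P :: complex poly. degree P \<le> n \<and> poly P \<zeta> = 1}.
                smirnov_norm (real p) G \<gamma> (\<lambda>z. h z - poly P z))"
  shows "(\<forall>n\<ge>1. sup_norm_on (closure G) (\<lambda>z. \<phi> z - J_poly p \<zeta> (Q n) z)
             \<le> 1 / 2 * (3 * (2 * pi * R) powr (1 / real p) + l powr (1 / real p)) ^ (p - 1)
                 * smirnov_norm (real p) G \<gamma> (\<lambda>z. h z - poly (Q n) z))
       \<and> (smirnov_domain (real p) G \<gamma> \<longrightarrow>
            (\<lambda>n. sup_norm_on (closure G) (\<lambda>z. \<phi> z - J_poly p \<zeta> (Q n) z)) \<longlonglongrightarrow> 0)"
proof -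
  note p = \<open>p \<ge> 1\<close>
  interpret J: jordan_conformal G \<gamma> \<phi> R by unfold_locales (fact assms)+
  obtain \<Psi> r x a where data: "root_boundary_data G \<gamma> h \<Psi> \<zeta> R p r x a"
    by (rule J.root_boundary_data_exists[OF assms(2) assms(4) assms(7) p assms(11) assms(12)])
  interpret D: root_boundary_data G \<gamma> h \<Psi> \<zeta> R p r x a by (rule data)
  let ?N = "\<lambda>n. D.approx_error (Q n)" and ?K = "3 * D.root_size + D.length_root"
  let ?s = "\<lambda>n. sup_norm_on (closure G) (\<lambda>z. \<phi> z - J_poly p \<zeta> (Q n) z)"
  have \<zeta>c: "\<zeta> \<in> closure G" using assms(4) closure_subset by blast
  have min: "?N n \<le> D.approx_error P" if n: "n \<ge> 1" and P: "degree P \<le> n" "poly P \<zeta> = 1" for n P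
    unfolding D.approx_error_def assms(16)[OF n]
    by (rule cINF_lower) (use P D.approx_error_nonneg in \<open>auto simp: D.approx_error_def intro!: bdd_belowI2[where m = 0]\<close>)
  have bound: "norm (\<phi> z - J_poly p \<zeta> (Q n) z) \<le> 1 / 2 * ?K ^ (p - 1) * ?N n" if n: "n \<ge> 1" and z: "z \<in> closure G" for n z
  proof -
    \<comment> \<open>The constant 1 is admissible in every degree, so the error is at most
      \<open>root_size + length_root\<close>.\<close>
    have "?N n \<le> D.approx_error 1" by (rule min[OF n]) auto
    then have "2 * D.root_size + ?N n \<le> ?K" using D.approx_error_one by simp
    then have "(2 * D.root_size + ?N n) ^ (p - 1) \<le> ?K ^ (p - 1)" using D.root_size_nonneg D.approx_error_nonneg by (intro power_mono) auto
    then have "1 / 2 * (2 * D.root_size + ?N n) ^ (p - 1) * ?N n \<le> 1 / 2 * ?K ^ (p - 1) * ?N n"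
      using D.approx_error_nonneg by (intro mult_right_mono mult_left_mono) auto
    moreover have "norm (\<phi> z - J_poly p \<zeta> (Q n) z) \<le> 1 / 2 * (2 * D.root_size + ?N n) ^ (p - 1) * ?N n"
      by (rule jordan_conformal_primitive_bound[OF J.jordan_conformal_axioms data assms(7) assms(12) z])
    ultimately show ?thesis by linarith
  qed
  have up: "?s n \<le> 1 / 2 * ?K ^ (p - 1) * ?N n" if n: "n \<ge> 1" for n
    unfolding sup_norm_on_def using \<zeta>c by (intro cSUP_least bound[OF n]) auto
  \<comment> \<open>Nonnegativity of the supremum is inferred from the value at \<zeta>, which
    requires the norms to be bounded above; the preceding bound provides this.\<close>
  have low: "0 \<le> ?s n" if n: "n \<ge> 1" for n
    unfolding sup_norm_on_def
    by (rule cSUP_upper2[OF bdd_aboveI2[where M = "1 / 2 * ?K ^ (p - 1) * ?N n"] \<zeta>c])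
       (fact bound[OF n], fact norm_ge_zero)
  have first: "\<forall>n\<ge>1. ?s n
      \<le> 1 / 2 * (3 * (2 * pi * R) powr (1 / real p) + l powr (1 / real p)) ^ (p - 1)
          * smirnov_norm (real p) G \<gamma> (\<lambda>z. h z - poly (Q n) z)"
    using up unfolding D.root_size_def D.length_root_def D.approx_error_def assms(3) by blast
  have second: "?s \<longlonglongrightarrow> 0" if smirnov: "smirnov_domain (real p) G \<gamma>"
  proof -
    define \<rho> where "\<rho> = R powr (1 / real p)"
    have \<rho>: "\<rho> > 0" "\<rho> ^ p = R" using J.R_pos p by (auto simp: \<rho>_def intro!: root_powr_power)
    have "?N \<longlonglongrightarrow> 0"
    proof (rule LIMSEQ_I)
      fix e :: real assume "e > 0"
      \<comment> \<open>Correcting the value at \<zeta> multiplies the error by at most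
        \<open>1 + length_root / \<rho>\<close>, where \<open>1 / \<rho>\<close> bounds point
        evaluation at \<zeta>.\<close>
      define e' where "e' = e / (1 + D.length_root / \<rho>)"
      have k: "1 + D.length_root / \<rho> > 0" using D.length_root_nonneg \<rho>(1) by (simp add: add_pos_nonneg)
      have "e' > 0" using \<open>e > 0\<close> k by (simp add: e'_def)
      then obtain P where P: "D.approx_error P < e'"
        using smirnov D.h_smirnov unfolding smirnov_domain_def D.approx_error_def by blast
      \<comment> \<open>The added constant restores the value 1 at \<zeta> without raising the
        degree, so \<open>P1\<close> competes with \<open>Q n\<close> for all large
        \<open>n\<close>. Since \<open>h \<zeta> = 1\<close>, the constant is the value of
        \<open>h - P\<close> at \<zeta>, which the error of \<open>P\<close> controls.\<close>
      define P1 where "P1 = P + [:1 - poly P \<zeta>:]"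
      have P1: "poly P1 \<zeta> = 1" "degree P1 \<le> degree P"
        unfolding P1_def by (auto intro!: degree_add_le)
      have "norm (deriv \<Psi> 0) = R" using D.root_norm[of 0] D.Psi_0 assms(13) by simp
      then have "(norm (1 - poly P \<zeta>) * \<rho>) ^ p \<le> D.approx_error P ^ p"
        using D.point_evaluation_bound[of P] assms(13) \<rho>(2) by (simp add: power_mult_distrib)
      then have "norm (1 - poly P \<zeta>) * \<rho> \<le> D.approx_error P"
        using power_le_imp_le_base[of _ "p - 1" "D.approx_error P"] p D.approx_error_nonneg[of P] by simp
      then have "norm (1 - poly P \<zeta>) \<le> D.approx_error P / \<rho>" using \<rho>(1) by (simp add: pos_le_divide_eq)
      then have "D.approx_error P1 \<le> D.approx_error P + D.approx_error P / \<rho> * D.length_root"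
        unfolding P1_def using D.approx_error_perturb[of P "1 - poly P \<zeta>"] mult_right_mono[OF _ D.length_root_nonneg] by fastforce
      also have "\<dots> = D.approx_error P * (1 + D.length_root / \<rho>)" by (simp add: algebra_simps)
      also have "\<dots> < e' * (1 + D.length_root / \<rho>)" using P k by (intro mult_strict_right_mono)
      also have "\<dots> = e" using k by (simp add: e'_def)
      finally have "D.approx_error P1 < e" .
      then have "norm (?N n - 0) < e" if "n \<ge> max 1 (degree P)" for n
        using min[of n P1] P1 that D.approx_error_nonneg[of "Q n"] by simp
      then show "\<exists>no. \<forall>n\<ge>no. norm (?N n - 0) < e" by blast
    qed
    then have "(\<lambda>n. 1 / 2 * ?K ^ (p - 1) * ?N n) \<longlonglongrightarrow> 1 / 2 * ?K ^ (p - 1) * 0" by (intro tendsto_intros)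
    then have "(\<lambda>n. 1 / 2 * ?K ^ (p - 1) * ?N n) \<longlonglongrightarrow> 0" by simp
    moreover have "\<forall>\<^sub>F n in sequentially. 0 \<le> ?s n" "\<forall>\<^sub>F n in sequentially. ?s n \<le> 1 / 2 * ?K ^ (p - 1) * ?N n"
      by (rule eventually_sequentiallyI[of 1], erule low, rule eventually_sequentiallyI[of 1], erule up)
    ultimately show ?thesis
      using tendsto_sandwich[of "\<lambda>_. 0" ?s sequentially "\<lambda>n. 1 / 2 * ?K ^ (p - 1) * ?N n" 0] tendsto_const by blast
  qed
  show ?thesis using first second by blast
qed

end
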